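(* Let $m,n$ be coprime positive integers and $C=\{x^m=y^n\}$. There is an isomorphism $$\mathrm{Spr}(b_1,Y)\cong\bigsqcup_{k\ge0}\mathrm{PHilb}_{k,n+k}(C)$$ between the generalized affine Springer fiber $\mathrm{Spr}(b_1,Y)$ and the parabolic Hilbert scheme of $C$.
   Context: $\mathbb K=\mathbb C((\epsilon))$, $\mathbb O=\mathbb C[[\epsilon]]$, $G=GL_n$, $G_{\mathbb K}=GL_n(\mathbb K)$. $b_1,\dots,b_n$ is the standard $\mathbb O$-basis of $\mathbb O^n$. $Y\in\mathfrak{gl}_n(\mathbb O)$ is the matrix with $Yb_i=b_{i+1}$ for $1\le i\le n-1$ and $Yb_n=\epsilon^mb_1$. $\mathfrak i=\{X\in\mathfrak{gl}_n(\mathbb O): X|_{\epsilon=0}\text{ is lower triangular}\}$, and $I\subset GL_n(\mathbb O)$ is the standard Iwahori subgroup of those $g$ with $g|_{\epsilon=0}$ lower triangular. The affine flag variety is $\mathcal{F}l=G_{\mathbb K}/I$, and $$\mathrm{Spr}(b_1,Y)=\{[g]\in\mathcal{F}l:\ (g^{-1}b_1,\,g^{-1}Yg)\in\mathbb O^n\oplus\mathfrak i\}.$$ $\mathcal O_C=\mathbb C[[x,y]]/(x^m-y^n)$; $\mathrm{PHilb}_{k,n+k}(C)$ is the moduli space of flags of ideals $\mathcal O_C\supset I_k\supset I_{k+1}\supset\cdots\supset I_{k+n}=xI_k$ with $\dim\mathcal O_C/I_s=s$. *)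

theory Defs
  imports
    "HOL-Computational_Algebra.Formal_Laurent_Series"
    "HOL-Algebra.QuotRing"
    "HOL-Algebra.Left_Coset"
    "Jordan_Normal_Form.VS_Connect"
begin

section \<open>The affine flag variety and the generalized affine Springer fibre\<close>

text \<open>
  Matrix indices start at 0, so \<open>b\<^sub>1, \<dots>, b\<^sub>n\<close> are \<open>unit_vec n 0, \<dots>, unit_vec n (n - 1)\<close>.
  The field \<open>\<complex>((\<epsilon>))\<close> is the type \<open>complex fls\<close> with \<open>\<epsilon> = fls_X\<close>; its subring
  \<open>\<complex>[[\<epsilon>]]\<close> is the range of \<open>fps_to_fls\<close>.
\<close>

abbreviation int_ring :: "complex fls set" where
  "int_ring \<equiv> range fps_to_fls"

definition int_vec :: "nat \<Rightarrow> complex fls vec set" where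
  "int_vec n = {v \<in> carrier_vec n. \<forall>i<n. v $ i \<in> int_ring}"

definition int_mat :: "nat \<Rightarrow> complex fls mat set" where
  "int_mat n = {X \<in> carrier_mat n n. \<forall>i<n. \<forall>j<n. X $$ (i, j) \<in> int_ring}"

definition GL_K :: "nat \<Rightarrow> complex fls mat monoid" where
  "GL_K n = units_of (ring_mat TYPE(complex fls) n ())"

definition GL_O :: "nat \<Rightarrow> complex fls mat set" where
  "GL_O n = {g \<in> carrier (GL_K n). g \<in> int_mat n \<and> inv\<^bsub>GL_K n\<^esub> g \<in> int_mat n}"

definition Iwahori_algebra :: "nat \<Rightarrow> complex fls mat set" where
  "Iwahori_algebra n =
     {X \<in> int_mat n. \<forall>i<n. \<forall>j<n. i < j \<longrightarrow> fls_nth (X $$ (i, j)) 0 = 0}"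

definition Iwahori :: "nat \<Rightarrow> complex fls mat set" where
  "Iwahori n = GL_O n \<inter> Iwahori_algebra n"

definition Fl :: "nat \<Rightarrow> complex fls mat set set" where
  "Fl n = lcosets\<^bsub>GL_K n\<^esub> (Iwahori n)"

definition Y_mat :: "nat \<Rightarrow> nat \<Rightarrow> complex fls mat" where
  "Y_mat m n = mat n n (\<lambda>(i, j).
     if i = Suc j then 1 else if i = 0 \<and> Suc j = n then fls_X ^ m else 0)"

definition Spr :: "nat \<Rightarrow> nat \<Rightarrow> complex fls mat set set" where
  "Spr m n = {P \<in> Fl n. \<exists>g \<in> carrier (GL_K n). P = g <#\<^bsub>GL_K n\<^esub> Iwahori n \<and>
     inv\<^bsub>GL_K n\<^esub> g *\<^sub>v unit_vec n 0 \<in> int_vec n \<and>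
     inv\<^bsub>GL_K n\<^esub> g * Y_mat m n * g \<in> Iwahori_algebra n}"


section \<open>The parabolic Hilbert scheme\<close>

text \<open>
  \<open>\<complex>[[x,y]]\<close> is the type \<open>complex fps fps\<close>, read as \<open>\<complex>[[x]][[y]]\<close>.
\<close>

definition xx :: "complex fps fps" where
  "xx = fps_const fps_X"

definition yy :: "complex fps fps" where
  "yy = fps_X"

definition curve_ideal :: "nat \<Rightarrow> nat \<Rightarrow> complex fps fps set" where
  "curve_ideal m n = PIdl\<^bsub>class_ring\<^esub> (xx ^ m - yy ^ n)"

definition OC :: "nat \<Rightarrow> nat \<Rightarrow> complex fps fps set ring" where
  "OC m n = class_ring Quot (curve_ideal m n)"

definition OC_class :: "nat \<Rightarrow> nat \<Rightarrow> complex fps fps \<Rightarrow> complex fps fps set" where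
  "OC_class m n p = curve_ideal m n +>\<^bsub>class_ring\<^esub> p"

definition OC_const :: "nat \<Rightarrow> nat \<Rightarrow> complex \<Rightarrow> complex fps fps set" where
  "OC_const m n c = OC_class m n (fps_const (fps_const c))"

definition quot_space ::
    "nat \<Rightarrow> nat \<Rightarrow> complex fps fps set set \<Rightarrow> (complex, complex fps fps set set) module" where
  "quot_space m n J =
     \<lparr>carrier = carrier (OC m n Quot J), mult = mult (OC m n Quot J),
      one = one (OC m n Quot J), zero = zero (OC m n Quot J), add = add (OC m n Quot J),
      smult = (\<lambda>c a. (J +>\<^bsub>OC m n\<^esub> OC_const m n c) \<otimes>\<^bsub>OC m n Quot J\<^esub> a)\<rparr>"

definition has_colength :: "nat \<Rightarrow> nat \<Rightarrow> complex fps fps set set \<Rightarrow> nat \<Rightarrow> bool" where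
  "has_colength m n J s \<longleftrightarrow>
     vectorspace.fin_dim class_ring (quot_space m n J) \<and>
     vectorspace.dim class_ring (quot_space m n J) = s"

definition PHilb :: "nat \<Rightarrow> nat \<Rightarrow> nat \<Rightarrow> (nat \<Rightarrow> complex fps fps set set) set" where
  "PHilb m n k = {J \<in> extensional {k..k + n}.
     (\<forall>s\<in>{k..k + n}. ideal (J s) (OC m n) \<and> has_colength m n (J s) s) \<and>
     (\<forall>s\<in>{k..<k + n}. J (Suc s) \<subseteq> J s) \<and>
     J (k + n) = OC_class m n xx <#\<^bsub>OC m n\<^esub> J k}"


section \<open>Algebraic structure\<close>

text \<open>
  Both sides are (ind-)varieties over \<open>\<complex>\<close>, given by their sets of \<open>\<complex>\<close>-points.  The algebraic
  structure on such a point set is recorded by saying which maps into it, from a Zariski closed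
  set \<open>T \<subseteq> \<complex>\<^sup>N\<close>, are morphisms; by the Yoneda lemma this determines a (reduced) ind-variety, and
  an isomorphism is a bijection on points that identifies the morphisms from every such \<open>T\<close>.
\<close>

inductive_set poly_fun :: "nat \<Rightarrow> (complex vec \<Rightarrow> complex) set" for N :: nat where
  const: "(\<lambda>_. c) \<in> poly_fun N"
| coord: "i < N \<Longrightarrow> (\<lambda>t. t $ i) \<in> poly_fun N"
| add: "a \<in> poly_fun N \<Longrightarrow> b \<in> poly_fun N \<Longrightarrow> (\<lambda>t. a t + b t) \<in> poly_fun N"
| mult: "a \<in> poly_fun N \<Longrightarrow> b \<in> poly_fun N \<Longrightarrow> (\<lambda>t. a t * b t) \<in> poly_fun N"

definition affine_variety :: "nat \<Rightarrow> complex vec set \<Rightarrow> bool" where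
  "affine_variety N T \<longleftrightarrow>
     (\<exists>E \<subseteq> poly_fun N. T = {t \<in> carrier_vec N. \<forall>e\<in>E. e t = 0})"

definition basic_open :: "complex vec set \<Rightarrow> (complex vec \<Rightarrow> complex) \<Rightarrow> complex vec set" where
  "basic_open T f = {t \<in> T. f t \<noteq> 0}"

text \<open>The ring of regular functions on \<open>basic_open T f\<close> is the localization \<open>\<complex>[T]\<^sub>f\<close>.\<close>

definition regular_fun ::
    "nat \<Rightarrow> complex vec set \<Rightarrow> (complex vec \<Rightarrow> complex) \<Rightarrow> (complex vec \<Rightarrow> complex) \<Rightarrow> bool" where
  "regular_fun N T f \<phi> \<longleftrightarrow>
     (\<exists>a\<in>poly_fun N. \<exists>r::nat. \<forall>t\<in>basic_open T f. \<phi> t = a t / f t ^ r)"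

definition locally_on ::
    "nat \<Rightarrow> complex vec set \<Rightarrow> ((complex vec \<Rightarrow> complex) \<Rightarrow> bool) \<Rightarrow> bool" where
  "locally_on N T P \<longleftrightarrow> (\<forall>p\<in>T. \<exists>f\<in>poly_fun N. f p \<noteq> 0 \<and> P f)"

text \<open>
  A family of matrices over \<open>\<complex>((\<epsilon>))\<close> is an element of \<open>Mat\<^sub>n(R((\<epsilon>)))\<close>, with
  \<open>R = \<complex>[T]\<^sub>f\<close>: the coefficients are regular and the pole order is bounded uniformly.
  An element of \<open>GL\<^sub>n(R((\<epsilon>)))\<close> is such a family whose inverse is one too.
\<close>

definition regular_mat_family ::
    "nat \<Rightarrow> nat \<Rightarrow> complex vec set \<Rightarrow> (complex vec \<Rightarrow> complex) \<Rightarrow>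
     (complex vec \<Rightarrow> complex fls mat) \<Rightarrow> bool" where
  "regular_mat_family n N T f \<gamma> \<longleftrightarrow>
     (\<forall>i<n. \<forall>j<n.
        (\<forall>l. regular_fun N T f (\<lambda>t. fls_nth (\<gamma> t $$ (i, j)) l)) \<and>
        (\<exists>d. \<forall>t\<in>basic_open T f. \<forall>l<d. fls_nth (\<gamma> t $$ (i, j)) l = 0))"

definition regular_GL_family ::
    "nat \<Rightarrow> nat \<Rightarrow> complex vec set \<Rightarrow> (complex vec \<Rightarrow> complex) \<Rightarrow>
     (complex vec \<Rightarrow> complex fls mat) \<Rightarrow> bool" where
  "regular_GL_family n N T f \<gamma> \<longleftrightarrow>
     (\<forall>t\<in>basic_open T f. \<gamma> t \<in> carrier (GL_K n)) \<and>
     regular_mat_family n N T f \<gamma> \<and>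
     regular_mat_family n N T f (\<lambda>t. inv\<^bsub>GL_K n\<^esub> \<gamma> t)"

text \<open>
  \<open>GL\<^sub>n(\<complex>((\<epsilon>))) \<rightarrow> Fl\<close> is a Zariski locally trivial quotient, so morphisms to \<open>Fl\<close> are the maps
  that lift locally to \<open>GL\<^sub>n(R((\<epsilon>)))\<close>.  The subvariety \<open>Spr \<subseteq> Fl\<close> carries the induced structure.
\<close>

definition Fl_morphism ::
    "nat \<Rightarrow> nat \<Rightarrow> complex vec set \<Rightarrow> (complex vec \<Rightarrow> complex fls mat set) \<Rightarrow> bool" where
  "Fl_morphism n N T u \<longleftrightarrow> locally_on N T (\<lambda>f. \<exists>\<gamma>. regular_GL_family n N T f \<gamma> \<and>
     (\<forall>t\<in>basic_open T f. u t = \<gamma> t <#\<^bsub>GL_K n\<^esub> Iwahori n))"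

text \<open>
  A trivialization, over \<open>basic_open T f\<close>, of the family of quotients \<open>O\<^sub>C / J t\<close>: a surjection
  \<open>R \<otimes> O\<^sub>C \<rightarrow> R\<^sup>s\<close> whose fibre at \<open>t\<close> is \<open>q t\<close>, with kernel \<open>J t\<close>.
\<close>

definition trivializes_quotient ::
    "nat \<Rightarrow> nat \<Rightarrow> nat \<Rightarrow> nat \<Rightarrow> complex vec set \<Rightarrow> (complex vec \<Rightarrow> complex) \<Rightarrow>
     (complex vec \<Rightarrow> complex fps fps set set) \<Rightarrow>
     (complex vec \<Rightarrow> complex fps fps set \<Rightarrow> complex vec) \<Rightarrow> bool" where
  "trivializes_quotient m n s N T f J q \<longleftrightarrow>
     (\<forall>t\<in>basic_open T f.
        q t ` carrier (OC m n) = carrier_vec s \<and>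
        (\<forall>a\<in>carrier (OC m n). \<forall>b\<in>carrier (OC m n).
           q t (a \<oplus>\<^bsub>OC m n\<^esub> b) = q t a + q t b) \<and>
        (\<forall>c. \<forall>a\<in>carrier (OC m n).
           q t (OC_const m n c \<otimes>\<^bsub>OC m n\<^esub> a) = c \<cdot>\<^sub>v q t a) \<and>
        {a \<in> carrier (OC m n). q t a = 0\<^sub>v s} = J t) \<and>
     (\<forall>a\<in>carrier (OC m n). \<forall>i<s. regular_fun N T f (\<lambda>t. q t a $ i))"

text \<open>
  Morphisms to \<open>\<Squnion>\<^sub>k PHilb\<^bsub>k,n+k\<^esub>(C)\<close> are algebraic families of flags of ideals: locally \<open>k\<close> is
  constant and every \<open>O\<^sub>C / J\<^sub>s\<close> is a free module of rank \<open>s\<close> over the base.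
\<close>

definition PHilb_morphism ::
    "nat \<Rightarrow> nat \<Rightarrow> nat \<Rightarrow> complex vec set \<Rightarrow>
     (complex vec \<Rightarrow> nat \<times> (nat \<Rightarrow> complex fps fps set set)) \<Rightarrow> bool" where
  "PHilb_morphism m n N T v \<longleftrightarrow> locally_on N T (\<lambda>f. \<exists>k.
     (\<forall>t\<in>basic_open T f. fst (v t) = k) \<and>
     (\<forall>s\<in>{k..k + n}. \<exists>q. trivializes_quotient m n s N T f (\<lambda>t. snd (v t) s) q))"

definition isomorphic_via_morphisms ::
    "'a set \<Rightarrow> (nat \<Rightarrow> complex vec set \<Rightarrow> (complex vec \<Rightarrow> 'a) \<Rightarrow> bool) \<Rightarrow>
     'b set \<Rightarrow> (nat \<Rightarrow> complex vec set \<Rightarrow> (complex vec \<Rightarrow> 'b) \<Rightarrow> bool) \<Rightarrow> bool" where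
  "isomorphic_via_morphisms A morA B morB \<longleftrightarrow>
     (\<exists>\<Phi>. bij_betw \<Phi> A B \<and>
        (\<forall>N T u. affine_variety N T \<and> u \<in> T \<rightarrow> A \<longrightarrow>
           (morA N T u \<longleftrightarrow> morB N T (\<lambda>t. \<Phi> (u t)))))"

end

theory Submission
  imports Defs
begin

text \<open>
  Sending \<open>b\<^sub>i\<close> to \<open>y^(i-1)\<close> identifies \<open>\<complex>[[\<epsilon>]]^n\<close> with \<open>O\<^sub>C\<close> in such a way that \<open>\<epsilon>\<close> acts as \<open>x\<close> and \<open>Y\<close> as
  \<open>y\<close>.  A point \<open>gI\<close> of the Springer fibre is then a flag of \<open>O\<^sub>C\<close>-lattices whose largest member contains
  \<open>O\<^sub>C\<close>.  Since \<open>O\<^sub>C\<close> is Gorenstein, the residue pairing turns it into a flag of ideals inside \<open>O\<^sub>C\<close>; on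
  representatives this is \<open>g \<mapsto> h\<close>, where \<open>h\<close> is the anti-transpose of \<open>g^-1\<close>.

  The inverse map picks vectors in the successive differences of a flag of ideals, which by Nakayama form an
  adapted \<open>\<complex>[[\<epsilon>]]\<close>-basis.  In families, the coefficients of the principal parts of \<open>h^-1 v\<close> contain a
  trivialization of the quotients; conversely a trivialization of the quotients yields an adapted basis by
  Cramer's rule, and the coefficients of \<open>h^-1\<close> are found one by one as ratios of its values.
\<close>

text \<open>Two obstacles shape the treatment of families. A trivialization is regular only on each
  fixed element of O_C, whereas the vectors of an adapted basis move with the parameter. The remedy
  is that a Y-stable submodule of colength s contains \<epsilon>^s times every integral vector, so
  that only finitely many coefficients of a moving vector matter. In the other direction, the
  colength of a regular family of matrices has to be shown locally constant. Independence of
  finitely many functionals is an open condition, which bounds the colength near a point from below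
  only. The bound from above comes from the identity that the colengths attached to h and to
  \<epsilon>^d h^-1 add up to nd. Colengths are recorded by explicit linear surjections onto C^s
  rather than by dimensions of quotient spaces: the ambient spaces are infinite-dimensional over C,
  and such surjections are what varies in a family.\<close>

no_notation fps_nth (infixl "$" 75)

section \<open>Power series inside Laurent series\<close>

lemma int_ring_iff: "x \<in> int_ring \<longleftrightarrow> (\<forall>l<0. fls_nth x l = 0)"
proof
  assume "\<forall>l<0. fls_nth x l = 0"
  then have "x = fps_to_fls (fls_regpart x)"
    by (intro fls_eqI) auto
  then show "x \<in> int_ring" by blast
qed auto

lemma int_ring_regpart: "x \<in> int_ring \<Longrightarrow> fps_to_fls (fls_regpart x) = x"
  by auto

lemma int_ring_add: "x \<in> int_ring \<Longrightarrow> y \<in> int_ring \<Longrightarrow> x + y \<in> int_ring"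
  by (simp add: int_ring_iff)

lemma int_ring_mult: "x \<in> int_ring \<Longrightarrow> y \<in> int_ring \<Longrightarrow> x * y \<in> int_ring"
  by (metis (mono_tags) fls_times_fps_to_fls imageE rangeI)

lemma int_ring_uminus: "x \<in> int_ring \<Longrightarrow> - x \<in> int_ring"
  by (simp add: int_ring_iff)

lemma int_ring_const: "fls_const c \<in> int_ring"
  by (simp add: int_ring_iff)

lemma int_ring_0: "0 \<in> int_ring" and int_ring_1: "1 \<in> int_ring"
  by (simp_all add: int_ring_iff)

lemma int_ring_X: "fls_X \<in> int_ring"
  by (simp add: int_ring_iff)

lemma int_ring_X_power: "fls_X ^ d \<in> int_ring"
  by (induction d) (simp_all add: int_ring_1 int_ring_mult[OF int_ring_X] del: range_eqI)

lemma int_ring_sum: "(\<And>i. i \<in> A \<Longrightarrow> g i \<in> int_ring) \<Longrightarrow> sum g A \<in> int_ring"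
  by (induction A rule: infinite_finite_induct) (simp_all add: int_ring_0 int_ring_add)

lemma fls_nth_mult_int_0:
  assumes "x \<in> int_ring" "y \<in> int_ring"
  shows "fls_nth (x * y) 0 = fls_nth x 0 * fls_nth y 0"
proof -
  obtain f g where "x = fps_to_fls f" "y = fps_to_fls g" using assms by blast
  then show ?thesis by (simp flip: fls_times_fps_to_fls)
qed

section \<open>The curve\<close>

text \<open>Iterating the hypothesis makes \<open>D b\<close> divisible by arbitrarily high powers
  of \<open>fps_X\<close>. Each iteration moves \<open>b\<close> to \<open>b + n\<close>, so the
  induction on the coefficient index leaves \<open>b\<close> arbitrary.\<close>

lemma fps_geometric_unique:
  fixes D :: "nat \<Rightarrow> complex fps"
  assumes m: "m > 0" and D: "\<And>b. D b = fps_X ^ m * D (b + n)"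
  shows "D b = 0"
proof (rule fps_ext)
  fix a
  show "fps_nth (D b) a = fps_nth 0 a"
  proof (induction a arbitrary: b rule: less_induct)
    case (less a)
    have "fps_nth (D b) a = fps_nth (fps_X ^ m * D (b + n)) a"
      by (rule arg_cong[OF D])
    also have "\<dots> = 0"
      using less m by (auto simp: fps_X_power_mult_nth)
    finally show ?case by simp
  qed
qed

text \<open>The sum of the coefficients of \<open>y^b, y^(b+n), y^(b+2n), \<dots>\<close>, each multiplied by the power of \<open>x\<close>
  that \<open>y^n = x^m\<close> produces.\<close>

definition fold_coeff :: "nat \<Rightarrow> nat \<Rightarrow> complex fps fps \<Rightarrow> nat \<Rightarrow> complex fps" where
  "fold_coeff m n p b =
     Abs_fps (\<lambda>a. \<Sum>l\<le>a. if m * l \<le> a then fps_nth (fps_nth p (b + l * n)) (a - m * l) else 0)"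

text \<open>The first summand is split off as in Horner's scheme. From here on the recursion
  replaces the explicit coefficients.\<close>

lemma fold_coeff_rec:
  assumes m: "m > 0"
  shows "fold_coeff m n p b = fps_nth p b + fps_X ^ m * fold_coeff m n p (b + n)"
proof (rule fps_ext)
  fix a
  let ?h = "\<lambda>l. if m * l \<le> a then fps_nth (fps_nth p (b + l * n)) (a - m * l) else 0"
  have "fps_nth (fold_coeff m n p b) a = ?h 0 + (\<Sum>l<a. ?h (Suc l))"
    by (simp add: fold_coeff_def sum.atMost_shift)
  also have "(\<Sum>l<a. ?h (Suc l)) = fps_nth (fps_X ^ m * fold_coeff m n p (b + n)) a"
  proof (cases "a < m")
    case True
    then show ?thesis by (auto simp: fps_X_power_mult_nth intro!: sum.neutral)
  next
    case False
    let ?g = "\<lambda>l. if m * l \<le> a - m then fps_nth (fps_nth p (b + n + l * n)) (a - m - m * l) else 0"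
    have eq: "?h (Suc l) = ?g l" for l
    proof -
      have "m * Suc l \<le> a \<longleftrightarrow> m * l \<le> a - m" using False by auto
      moreover have "a - m * Suc l = a - m - m * l" by simp
      moreover have "b + Suc l * n = b + n + l * n" by simp
      ultimately show ?thesis by presburger
    qed
    have sub: "{..a - m} \<subseteq> {..<a}" using False m by auto
    have "(\<Sum>l<a. ?h (Suc l)) = (\<Sum>l<a. ?g l)" by (simp only: eq)
    also have "\<dots> = (\<Sum>l\<le>a - m. ?g l)"
    \<comment> \<open>The larger range adds only zeros: beyond \<open>a - m\<close> the condition
      \<open>m * l \<le> a - m\<close> fails, since \<open>l \<le> m * l\<close>.\<close>
    proof (rule sum.mono_neutral_right[OF _ sub], simp, rule ballI)
      fix l assume "l \<in> {..<a} - {..a - m}"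
      then have "l > a - m" by auto
      moreover have "l \<le> m * l" using m by simp
      ultimately have "\<not> m * l \<le> a - m" by linarith
      then show "?g l = 0" by simp
    qed
    also have "\<dots> = fps_nth (fps_X ^ m * fold_coeff m n p (b + n)) a"
      using False by (simp add: fps_X_power_mult_nth fold_coeff_def)
    finally show ?thesis .
  qed
  finally show "fps_nth (fold_coeff m n p b) a =
      fps_nth (fps_nth p b + fps_X ^ m * fold_coeff m n p (b + n)) a" by simp
qed

text \<open>Two solutions of the recursion differ by a solution of the homogeneous one, which
  vanishes. Evaluating \<open>fold_coeff\<close> thus amounts to guessing a closed form and checking
  the recursion.\<close>

lemma fold_coeff_unique:
  assumes m: "m > 0" and F: "\<And>b. F b = fps_nth p b + fps_X ^ m * F (b + n)"
  shows "fold_coeff m n p b = F b"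
proof -
  have "(\<lambda>b. fold_coeff m n p b - F b) b = 0"
  proof (rule fps_geometric_unique[OF m, where n = n])
    fix b
    show "fold_coeff m n p b - F b = fps_X ^ m * (fold_coeff m n p (b + n) - F (b + n))"
      by (subst fold_coeff_rec[OF m], subst F) (simp add: algebra_simps)
  qed
  then show ?thesis by simp
qed

lemma fold_coeff_diff:
  assumes m: "m > 0"
  shows "fold_coeff m n (p - q) b = fold_coeff m n p b - fold_coeff m n q b"
proof (rule fold_coeff_unique[OF m, where F = "\<lambda>b. fold_coeff m n p b - fold_coeff m n q b"])
  fix b
  show "fold_coeff m n p b - fold_coeff m n q b = fps_nth (p - q) b +
      fps_X ^ m * (fold_coeff m n p (b + n) - fold_coeff m n q (b + n))"
    unfolding fold_coeff_rec[OF m, of n p b] fold_coeff_rec[OF m, of n q b]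
    by (simp add: right_diff_distrib)
qed

lemma xx_power: "xx ^ m = fps_const (fps_X ^ m)"
  by (simp add: xx_def fps_const_power)

lemma curve_ideal_iff: "p \<in> curve_ideal m n \<longleftrightarrow> (\<exists>q. p = q * (xx ^ m - yy ^ n))"
  by (auto simp: curve_ideal_def cgenideal_def)

lemma curve_nth:
  "fps_nth (q * (xx ^ m - yy ^ n)) b = fps_X ^ m * fps_nth q b - (if b < n then 0 else fps_nth q (b - n))"
proof -
  have "q * (xx ^ m - yy ^ n) = fps_const (fps_X ^ m) * q - fps_X ^ n * q"
    by (simp add: xx_power yy_def algebra_simps)
  then show ?thesis by (simp add: fps_X_power_mult_nth)
qed

text \<open>Division with remainder: the values of \<open>fold_coeff\<close> below \<open>n\<close>
  are the remainder modulo \<open>xx ^ m - yy ^ n\<close>, and those from \<open>n\<close> on are,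
  up to sign, the coefficients of the quotient.\<close>

lemma curve_ideal_iff_fold_coeff:
  assumes m: "m > 0"
  shows "p \<in> curve_ideal m n \<longleftrightarrow> (\<forall>b<n. fold_coeff m n p b = 0)"
proof
  assume "p \<in> curve_ideal m n"
  then obtain q where q: "p = q * (xx ^ m - yy ^ n)" by (auto simp: curve_ideal_iff)
  have "fold_coeff m n p b = (if b < n then 0 else - fps_nth q (b - n))" for b
    by (rule fold_coeff_unique[OF m, where F = "\<lambda>b. if b < n then 0 else - fps_nth q (b - n)"])
      (simp add: q curve_nth)
  then show "\<forall>b<n. fold_coeff m n p b = 0" by simp
next
  assume z: "\<forall>b<n. fold_coeff m n p b = 0"
  let ?q = "Abs_fps (\<lambda>b. - fold_coeff m n p (b + n))"
  have "p = ?q * (xx ^ m - yy ^ n)"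
  proof (rule fps_ext)
    fix b
    show "fps_nth p b = fps_nth (?q * (xx ^ m - yy ^ n)) b"
    proof (cases "b < n")
      case True
      then have "0 = fps_nth p b + fps_X ^ m * fold_coeff m n p (b + n)"
        using z fold_coeff_rec[OF m, of n p b] by metis
      then show ?thesis using True by (simp add: curve_nth eq_neg_iff_add_eq_0)
    next
      case False
      have "fps_nth p b = fold_coeff m n p b - fps_X ^ m * fold_coeff m n p (b + n)"
        unfolding fold_coeff_rec[OF m, of n p b] by simp
      then show ?thesis using False by (simp add: curve_nth)
    qed
  qed
  then show "p \<in> curve_ideal m n" by (auto simp: curve_ideal_iff)
qed

section \<open>The local ring O_C and its residue classes\<close>

lemma ideal_curve: "ideal (curve_ideal m n) class_ring"
  unfolding curve_ideal_def by (rule cring.cgenideal_ideal[OF class_cring.is_cring]) simp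

lemma cring_OC: "cring (OC m n)"
  unfolding OC_def by (rule ideal.quotient_is_cring[OF ideal_curve]) unfold_locales

lemma OC_class_hom: "OC_class m n \<in> Ring.ring_hom class_ring (OC m n)"
  using ideal.rcos_ring_hom[OF ideal_curve, of m n] by (simp add: OC_def OC_class_def[abs_def])

lemma OC_class_add: "OC_class m n (p + q) = OC_class m n p \<oplus>\<^bsub>OC m n\<^esub> OC_class m n q"
  using ring_hom_add[OF OC_class_hom[of m n], of p q] by simp

lemma OC_class_mult: "OC_class m n (p * q) = OC_class m n p \<otimes>\<^bsub>OC m n\<^esub> OC_class m n q"
  using ring_hom_mult[OF OC_class_hom[of m n], of p q] by simp

lemma OC_class_one: "OC_class m n 1 = \<one>\<^bsub>OC m n\<^esub>"
  using ring_hom_one[OF OC_class_hom[of m n]] by simp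

lemma OC_class_closed: "OC_class m n p \<in> carrier (OC m n)"
  using ring_hom_closed[OF OC_class_hom[of m n], of p] by simp

lemma carrier_OC: "carrier (OC m n) = range (OC_class m n)"
  by (auto simp: OC_def FactRing_def A_RCOSETS_def RCOSETS_def OC_class_def a_r_coset_def)

lemma OC_class_eq_iff: "OC_class m n p = OC_class m n q \<longleftrightarrow> p - q \<in> curve_ideal m n"
  unfolding OC_class_def
  using ring.quotient_eq_iff_same_a_r_cos[OF class_ring.ring_axioms ideal_curve, of p q]
  by (simp add: class_ring_simps)

lemma OC_class_zero: "OC_class m n 0 = \<zero>\<^bsub>OC m n\<^esub>"
proof -
  interpret ring_hom_ring class_ring "OC m n" "OC_class m n"
    using ideal.rcos_ring_hom_ring[OF ideal_curve, of m n] by (simp add: OC_def OC_class_def[abs_def])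
  show ?thesis using hom_zero by simp
qed

section \<open>Integral vectors and their identification with O_C\<close>

lemma int_vec_carrier: "v \<in> int_vec n \<Longrightarrow> v \<in> carrier_vec n"
  by (simp add: int_vec_def)

lemma int_vec_index: "v \<in> int_vec n \<Longrightarrow> i < n \<Longrightarrow> v $ i \<in> int_ring"
  by (simp add: int_vec_def)

lemma int_vec_dim: "v \<in> int_vec n \<Longrightarrow> dim_vec v = n"
  by (auto simp: int_vec_def)

lemma int_vecI: "dim_vec v = n \<Longrightarrow> (\<And>i. i < n \<Longrightarrow> v $ i \<in> int_ring) \<Longrightarrow> v \<in> int_vec n"
  unfolding int_vec_def carrier_vec_def by blast

lemma int_vec_add: "v \<in> int_vec n \<Longrightarrow> w \<in> int_vec n \<Longrightarrow> v + w \<in> int_vec n"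
  by (rule int_vecI) (simp_all add: int_vec_dim int_vec_index int_ring_add)

lemma int_vec_smult: "r \<in> int_ring \<Longrightarrow> v \<in> int_vec n \<Longrightarrow> r \<cdot>\<^sub>v v \<in> int_vec n"
  by (rule int_vecI) (simp_all add: int_vec_dim int_vec_index int_ring_mult)

lemma int_vec_0: "0\<^sub>v n \<in> int_vec n"
  by (rule int_vecI) (simp_all add: int_ring_0)

lemma int_matI:
  "X \<in> carrier_mat n n \<Longrightarrow> (\<And>i j. i < n \<Longrightarrow> j < n \<Longrightarrow> X $$ (i, j) \<in> int_ring) \<Longrightarrow> X \<in> int_mat n"
  unfolding int_mat_def by blast

lemma int_mat_carrier: "X \<in> int_mat n \<Longrightarrow> X \<in> carrier_mat n n"
  by (simp add: int_mat_def)

lemma int_mat_index: "X \<in> int_mat n \<Longrightarrow> i < n \<Longrightarrow> j < n \<Longrightarrow> X $$ (i, j) \<in> int_ring"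
  by (simp add: int_mat_def)

lemma mult_mat_vec_index:
  assumes "X \<in> carrier_mat n k" "v \<in> carrier_vec k" "i < n"
  shows "(X *\<^sub>v v) $ i = (\<Sum>j<k. X $$ (i, j) * v $ j)"
  using assms by (auto simp: scalar_prod_def atLeast0LessThan)

lemma int_mat_mult_vec:
  assumes X: "X \<in> int_mat n" and v: "v \<in> int_vec n"
  shows "X *\<^sub>v v \<in> int_vec n"
proof (rule int_vecI)
  show "dim_vec (X *\<^sub>v v) = n" using int_mat_carrier[OF X] by simp
  show "(X *\<^sub>v v) $ i \<in> int_ring" if "i < n" for i
    unfolding mult_mat_vec_index[OF int_mat_carrier[OF X] int_vec_carrier[OF v] that]
    by (rule int_ring_sum) (simp add: int_ring_mult int_mat_index[OF X] int_vec_index[OF v] that)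
qed

lemma Y_mat_carrier: "Y_mat m n \<in> carrier_mat n n"
  by (simp add: Y_mat_def)

lemma Y_mat_int: "Y_mat m n \<in> int_mat n"
  by (simp add: Y_mat_def int_mat_def int_ring_0 int_ring_1 int_ring_X_power)

lemma Y_mat_mult_vec:
  assumes v: "v \<in> carrier_vec n" and i: "i < n"
  shows "(Y_mat m n *\<^sub>v v) $ i = (if i = 0 then fls_X ^ m * v $ (n - 1) else v $ (i - 1))"
proof -
  let ?c = "if i = 0 then n - 1 else i - 1"
  have "(Y_mat m n *\<^sub>v v) $ i = (\<Sum>j<n. Y_mat m n $$ (i, j) * v $ j)"
    by (rule mult_mat_vec_index[OF Y_mat_carrier v i])
  also have "\<dots> = (\<Sum>j<n. if j = ?c then (if i = 0 then fls_X ^ m else 1) * v $ j else 0)"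
    using i by (intro sum.cong refl) (auto simp: Y_mat_def)
  also have "\<dots> = (if i = 0 then fls_X ^ m * v $ (n - 1) else v $ (i - 1))"
    using i by (subst sum.delta) auto
  finally show ?thesis .
qed

definition lift_vec :: "nat \<Rightarrow> complex fls vec \<Rightarrow> complex fps fps" where
  "lift_vec n v = Abs_fps (\<lambda>b. if b < n then fls_regpart (v $ b) else 0)"

definition vec_to_OC :: "nat \<Rightarrow> nat \<Rightarrow> complex fls vec \<Rightarrow> complex fps fps set" where
  "vec_to_OC m n v = OC_class m n (lift_vec n v)"

lemma lift_vec_add:
  assumes "v \<in> int_vec n" "w \<in> int_vec n"
  shows "lift_vec n (v + w) = lift_vec n v + lift_vec n w"
  using assms[THEN int_vec_dim] by (intro fps_ext) (simp add: lift_vec_def)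

lemma lift_vec_smult:
  assumes "v \<in> int_vec n"
  shows "lift_vec n (fps_to_fls r \<cdot>\<^sub>v v) = fps_const r * lift_vec n v"
proof (rule fps_ext)
  fix b
  show "fps_nth (lift_vec n (fps_to_fls r \<cdot>\<^sub>v v)) b = fps_nth (fps_const r * lift_vec n v) b"
  proof (cases "b < n")
    case True
    then obtain f where "v $ b = fps_to_fls f" using int_vec_index[OF assms] by blast
    then show ?thesis using True int_vec_dim[OF assms]
      by (simp add: lift_vec_def flip: fls_times_fps_to_fls)
  qed (simp add: lift_vec_def)
qed

lemma vec_to_OC_closed: "vec_to_OC m n v \<in> carrier (OC m n)"
  by (simp add: vec_to_OC_def OC_class_closed)

lemma vec_to_OC_add:
  "v \<in> int_vec n \<Longrightarrow> w \<in> int_vec n \<Longrightarrow>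
   vec_to_OC m n (v + w) = vec_to_OC m n v \<oplus>\<^bsub>OC m n\<^esub> vec_to_OC m n w"
  by (simp add: vec_to_OC_def lift_vec_add OC_class_add)

lemma vec_to_OC_smult:
  "v \<in> int_vec n \<Longrightarrow>
   vec_to_OC m n (fps_to_fls r \<cdot>\<^sub>v v) = OC_class m n (fps_const r) \<otimes>\<^bsub>OC m n\<^esub> vec_to_OC m n v"
  by (simp add: vec_to_OC_def lift_vec_smult OC_class_mult)

lemma vec_to_OC_const:
  assumes "v \<in> int_vec n"
  shows "vec_to_OC m n (fls_const c \<cdot>\<^sub>v v) = OC_const m n c \<otimes>\<^bsub>OC m n\<^esub> vec_to_OC m n v"
  using vec_to_OC_smult[OF assms, of m "fps_const c"] by (simp add: OC_const_def)

lemma vec_to_OC_X: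
  assumes "v \<in> int_vec n"
  shows "vec_to_OC m n (fls_X \<cdot>\<^sub>v v) = OC_class m n xx \<otimes>\<^bsub>OC m n\<^esub> vec_to_OC m n v"
  using vec_to_OC_smult[OF assms, of m fps_X] by (simp add: xx_def)

lemma vec_to_OC_0: "vec_to_OC m n (0\<^sub>v n) = \<zero>\<^bsub>OC m n\<^esub>"
proof -
  have "lift_vec n (0\<^sub>v n) = 0" by (rule fps_ext) (simp add: lift_vec_def)
  then show ?thesis by (simp add: vec_to_OC_def OC_class_zero)
qed

text \<open>The lift of \<open>Y v\<close> and \<open>yy\<close> times the lift of \<open>v\<close>
  differ only by the wrap-around: the top coefficient moves to y^n in one and, multiplied by x^m, to
  y^0 in the other. The difference is therefore the top coefficient times x^m - y^n.\<close>

lemma vec_to_OC_Y: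
  assumes v: "v \<in> int_vec n" and n: "n > 0"
  shows "vec_to_OC m n (Y_mat m n *\<^sub>v v) = OC_class m n yy \<otimes>\<^bsub>OC m n\<^esub> vec_to_OC m n v"
proof -
  have nth: "fps_nth (lift_vec n (Y_mat m n *\<^sub>v v)) b =
     (if b < n then if b = 0 then fps_X ^ m * fls_regpart (v $ (n - 1)) else fls_regpart (v $ (b - 1)) else 0)" for b
  proof -
    obtain f where "v $ (n - 1) = fps_to_fls f" using int_vec_index[OF v, of "n - 1"] n by auto
    then have "fls_regpart (fls_X ^ m * v $ (n - 1)) = fps_X ^ m * fls_regpart (v $ (n - 1))"
      by (metis fls_regpart_fps_trivial fls_times_fps_to_fls fps_to_fls_power fps_X_to_fls)
    then show ?thesis
      using Y_mat_mult_vec[OF int_vec_carrier[OF v], of b m] by (simp add: lift_vec_def)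
  qed
  let ?q = "fps_const (fls_regpart (v $ (n - 1)))"
  have "lift_vec n (Y_mat m n *\<^sub>v v) - yy * lift_vec n v = ?q * (xx ^ m - yy ^ n)"
  proof (rule fps_ext)
    fix b
    have 1: "fps_nth (yy * lift_vec n v) b = (if b = 0 then 0 else fps_nth (lift_vec n v) (b - 1))"
      by (simp add: yy_def)
    show "fps_nth (lift_vec n (Y_mat m n *\<^sub>v v) - yy * lift_vec n v) b =
        fps_nth (?q * (xx ^ m - yy ^ n)) b"
      unfolding fps_sub_nth nth 1 curve_nth using n by (auto simp: lift_vec_def)
  qed
  then have "OC_class m n (lift_vec n (Y_mat m n *\<^sub>v v)) = OC_class m n (yy * lift_vec n v)"
    by (auto simp: OC_class_eq_iff curve_ideal_iff)
  then show ?thesis by (simp add: vec_to_OC_def OC_class_mult)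
qed

lemma fold_coeff_lift:
  assumes m: "m > 0" and b: "b < n"
  shows "fold_coeff m n (lift_vec n v) b = fls_regpart (v $ b)"
proof -
  have "fold_coeff m n (lift_vec n v) b = (if b < n then fls_regpart (v $ b) else 0)"
    by (rule fold_coeff_unique[OF m, where F = "\<lambda>b. if b < n then fls_regpart (v $ b) else 0"])
      (simp add: lift_vec_def)
  then show ?thesis using b by simp
qed

text \<open>O_C is free over C[[x]] on 1, y, ..., y^(n-1): uniqueness of the remainder is
  injectivity, and the vector of remainders is the required preimage.\<close>

lemma bij_vec_to_OC:
  assumes m: "m > 0"
  shows "bij_betw (vec_to_OC m n) (int_vec n) (carrier (OC m n))"
proof (rule bij_betw_imageI)
  show "inj_on (vec_to_OC m n) (int_vec n)"
  proof (rule inj_onI)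
    fix v w assume v: "v \<in> int_vec n" and w: "w \<in> int_vec n" and eq: "vec_to_OC m n v = vec_to_OC m n w"
    then have z: "\<forall>b<n. fold_coeff m n (lift_vec n v - lift_vec n w) b = 0"
      by (simp add: vec_to_OC_def OC_class_eq_iff curve_ideal_iff_fold_coeff[OF m])
    have "v $ b = w $ b" if b: "b < n" for b
    proof -
      have "fls_regpart (v $ b) = fls_regpart (w $ b)"
        using z b fold_coeff_lift[OF m b, of v] fold_coeff_lift[OF m b, of w]
        by (simp add: fold_coeff_diff[OF m])
      then show ?thesis
        using int_ring_regpart[OF int_vec_index[OF v b]] int_ring_regpart[OF int_vec_index[OF w b]] by metis
    qed
    then show "v = w" using v w by (intro eq_vecI) (auto simp: int_vec_def)
  qed
  show "vec_to_OC m n ` int_vec n = carrier (OC m n)"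
  proof
    show "carrier (OC m n) \<subseteq> vec_to_OC m n ` int_vec n"
    proof
      fix a assume "a \<in> carrier (OC m n)"
      then obtain p where p: "a = OC_class m n p" by (auto simp: carrier_OC)
      let ?v = "vec n (\<lambda>b. fps_to_fls (fold_coeff m n p b))"
      have "OC_class m n p = vec_to_OC m n ?v"
        by (simp add: vec_to_OC_def OC_class_eq_iff curve_ideal_iff_fold_coeff[OF m]
            fold_coeff_diff[OF m] fold_coeff_lift[OF m])
      moreover have "?v \<in> int_vec n" by (simp add: int_vec_def)
      ultimately show "a \<in> vec_to_OC m n ` int_vec n" using p by blast
    qed
  qed (auto simp: vec_to_OC_closed)
qed

section \<open>Ideals of O_C as Y-stable submodules\<close>

definition Y_submodule :: "nat \<Rightarrow> nat \<Rightarrow> complex fls vec set \<Rightarrow> bool" where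
  "Y_submodule m n M \<longleftrightarrow> M \<subseteq> int_vec n \<and> 0\<^sub>v n \<in> M \<and> (\<forall>v\<in>M. \<forall>w\<in>M. v + w \<in> M) \<and>
     (\<forall>r\<in>int_ring. \<forall>v\<in>M. r \<cdot>\<^sub>v v \<in> M) \<and> (\<forall>v\<in>M. Y_mat m n *\<^sub>v v \<in> M)"

lemma ideal_imp_Y_submodule:
  assumes m: "m > 0" and n: "n > 0" and J: "ideal J (OC m n)"
  shows "Y_submodule m n {v \<in> int_vec n. vec_to_OC m n v \<in> J}"
proof -
  interpret ideal J "OC m n" by (rule J)
  show ?thesis
    unfolding Y_submodule_def
    by (auto simp: int_vec_0 vec_to_OC_0 int_vec_add vec_to_OC_add int_vec_smult vec_to_OC_smult
        int_mat_mult_vec[OF Y_mat_int] vec_to_OC_Y[OF _ n] OC_class_closed I_l_closed)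
qed

lemma lift_vec_expand: "lift_vec n w = (\<Sum>j<n. fps_const (fls_regpart (w $ j)) * yy ^ j)"
proof (rule fps_ext)
  fix b
  have "fps_nth (\<Sum>j<n. fps_const (fls_regpart (w $ j)) * yy ^ j) b =
      (\<Sum>j<n. if j = b then fls_regpart (w $ j) else 0)"
    unfolding fps_sum_nth by (rule sum.cong) (simp_all add: yy_def)
  then show "fps_nth (lift_vec n w) b = fps_nth (\<Sum>j<n. fps_const (fls_regpart (w $ j)) * yy ^ j) b"
    by (simp add: lift_vec_def)
qed

text \<open>Every element of O_C has a representative of degree less than n in y with coefficients
  in C[[x]]. Stability under C[[\<epsilon>]] and under Y therefore gives stability under O_C by
  finite sums, without a limit in y.\<close>

lemma Y_submodule_imp_ideal:
  assumes m: "m > 0" and n: "n > 0" and M: "Y_submodule m n M"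
  shows "ideal (vec_to_OC m n ` M) (OC m n)"
proof -
  interpret cring "OC m n" by (rule cring_OC)
  let ?s = "vec_to_OC m n"
  have M0: "0\<^sub>v n \<in> M" and Ma: "\<And>v w. v \<in> M \<Longrightarrow> w \<in> M \<Longrightarrow> v + w \<in> M"
    and Ms: "\<And>r v. v \<in> M \<Longrightarrow> fps_to_fls r \<cdot>\<^sub>v v \<in> M" and MY: "\<And>v. v \<in> M \<Longrightarrow> Y_mat m n *\<^sub>v v \<in> M"
    and Mi: "\<And>v. v \<in> M \<Longrightarrow> v \<in> int_vec n"
    using M by (auto simp: Y_submodule_def)
  have add: "a \<oplus>\<^bsub>OC m n\<^esub> b \<in> ?s ` M" if "a \<in> ?s ` M" "b \<in> ?s ` M" for a b
    using that Ma Mi by (auto simp flip: vec_to_OC_add)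
  have scal: "OC_class m n (fps_const r) \<otimes>\<^bsub>OC m n\<^esub> a \<in> ?s ` M" if "a \<in> ?s ` M" for a r
    using that Ms Mi by (auto simp flip: vec_to_OC_smult)
  have ymul: "OC_class m n (yy ^ j) \<otimes>\<^bsub>OC m n\<^esub> a \<in> ?s ` M" if a: "a \<in> ?s ` M" for a j
  proof (induction j)
    case 0
    then show ?case using a by (auto simp: OC_class_one vec_to_OC_closed)
  next
    case (Suc j)
    then obtain w where w: "w \<in> M" "OC_class m n (yy ^ j) \<otimes>\<^bsub>OC m n\<^esub> a = ?s w" by blast
    have "a \<in> carrier (OC m n)" using a by (auto simp: vec_to_OC_closed)
    then have "OC_class m n (yy ^ Suc j) \<otimes>\<^bsub>OC m n\<^esub> a = OC_class m n yy \<otimes>\<^bsub>OC m n\<^esub> ?s w"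
      unfolding w(2)[symmetric] by (simp add: OC_class_mult OC_class_closed m_assoc)
    also have "\<dots> = ?s (Y_mat m n *\<^sub>v w)" using vec_to_OC_Y[OF Mi[OF w(1)] n] by simp
    finally show ?case using MY[OF w(1)] by blast
  qed
  have lmul: "x \<otimes>\<^bsub>OC m n\<^esub> a \<in> ?s ` M" if a: "a \<in> ?s ` M" and x: "x \<in> carrier (OC m n)" for a x
  proof -
    obtain w where w: "x = ?s w"
      using x bij_betw_imp_surj_on[OF bij_vec_to_OC[OF m, of n]] by blast
    have ac: "a \<in> carrier (OC m n)" using a by (auto simp: vec_to_OC_closed)
    have "OC_class m n (\<Sum>j<k. fps_const (fls_regpart (w $ j)) * yy ^ j) \<otimes>\<^bsub>OC m n\<^esub> a \<in> ?s ` M" for k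
    proof (induction k)
      case 0
      have "\<zero>\<^bsub>OC m n\<^esub> \<in> ?s ` M" using M0 vec_to_OC_0 by (metis imageI)
      then show ?case using ac by (simp add: OC_class_zero)
    next
      case (Suc k)
      have "OC_class m n (fps_const (fls_regpart (w $ k)) * yy ^ k) \<otimes>\<^bsub>OC m n\<^esub> a \<in> ?s ` M"
        using scal[OF ymul[OF a]] ac by (simp add: OC_class_mult OC_class_closed m_assoc)
      from add[OF Suc this] show ?case
        by (simp add: OC_class_add OC_class_closed l_distr ac)
    qed
    then show ?thesis by (simp add: w vec_to_OC_def lift_vec_expand)
  qed
  have neg: "\<ominus>\<^bsub>OC m n\<^esub> a \<in> ?s ` M" if a: "a \<in> ?s ` M" for a
  proof -
    have "a \<in> carrier (OC m n)" using a by (auto simp: vec_to_OC_closed)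
    then have "\<ominus>\<^bsub>OC m n\<^esub> a = (\<ominus>\<^bsub>OC m n\<^esub> \<one>\<^bsub>OC m n\<^esub>) \<otimes>\<^bsub>OC m n\<^esub> a" by (simp add: l_minus)
    then show ?thesis using lmul[OF a] by simp
  qed
  show ?thesis
  proof (rule idealI)
    show "ring (OC m n)" by (rule ring_axioms)
    show "subgroup (?s ` M) (add_monoid (OC m n))"
      by (rule add.subgroupI) (use M0 add neg in \<open>auto simp: vec_to_OC_closed a_inv_def\<close>)
    show "x \<otimes>\<^bsub>OC m n\<^esub> a \<in> ?s ` M" if "a \<in> ?s ` M" "x \<in> carrier (OC m n)" for a x
      using lmul that by blast
    show "a \<otimes>\<^bsub>OC m n\<^esub> x \<in> ?s ` M" if "a \<in> ?s ` M" "x \<in> carrier (OC m n)" for a x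
    proof -
      have "a \<in> carrier (OC m n)" using that by (auto simp: vec_to_OC_closed)
      then show ?thesis using lmul[OF that] m_comm[OF _ that(2)] by metis
    qed
  qed
qed

section \<open>Colength\<close>

text \<open>One fibre of \<open>trivializes_quotient\<close>. The abstract dimension in
  \<open>has_colength\<close> is translated into this form, where it can be handled by
  coordinates.\<close>

definition OC_quotient_map ::
    "nat \<Rightarrow> nat \<Rightarrow> nat \<Rightarrow> complex fps fps set set \<Rightarrow> (complex fps fps set \<Rightarrow> complex vec) \<Rightarrow> bool" where
  "OC_quotient_map m n s J q \<longleftrightarrow>
     q ` carrier (OC m n) = carrier_vec s \<and>
     (\<forall>a\<in>carrier (OC m n). \<forall>b\<in>carrier (OC m n). q (a \<oplus>\<^bsub>OC m n\<^esub> b) = q a + q b) \<and>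
     (\<forall>c. \<forall>a\<in>carrier (OC m n). q (OC_const m n c \<otimes>\<^bsub>OC m n\<^esub> a) = c \<cdot>\<^sub>v q a) \<and>
     {a \<in> carrier (OC m n). q a = 0\<^sub>v s} = J"

lemma add_vec_eq_right_iff:
  fixes u w :: "'a :: ab_group_add vec"
  assumes "u \<in> carrier_vec s" "w \<in> carrier_vec s"
  shows "u + w = w \<longleftrightarrow> u = 0\<^sub>v s"
proof
  assume eq: "u + w = w"
  have "u $ i = 0" if "i < s" for i
    using arg_cong[OF eq, of "\<lambda>v. v $ i"] assms that by simp
  then show "u = 0\<^sub>v s" using assms by (intro eq_vecI) auto
qed (use assms in auto)

lemma vectorspace_coordinates:
  fixes V :: "(complex, 'b) module"
  assumes V: "vectorspace class_ring V" and fd: "vectorspace.fin_dim class_ring V"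
  obtains q where "q ` carrier V = carrier_vec (vectorspace.dim class_ring V)"
    "\<And>a b. a \<in> carrier V \<Longrightarrow> b \<in> carrier V \<Longrightarrow> q (a \<oplus>\<^bsub>V\<^esub> b) = q a + q b"
    "\<And>c a. a \<in> carrier V \<Longrightarrow> q (c \<odot>\<^bsub>V\<^esub> a) = c \<cdot>\<^sub>v q a"
    "\<And>a. a \<in> carrier V \<Longrightarrow> q a = 0\<^sub>v (vectorspace.dim class_ring V) \<longleftrightarrow> a = \<zero>\<^bsub>V\<^esub>"
proof -
  interpret vectorspace class_ring V by (rule V)
  obtain B where fB: "finite B" and B: "basis B" using finite_basis_exists[OF fd] by blast
  have BC: "B \<subseteq> carrier V" using B by (simp add: basis_def)
  have dim: "dim = card B" by (rule dim_basis[OF fB B])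
  obtain e where e: "bij_betw e {..<dim} B"
    using ex_bij_betw_nat_finite[OF fB] unfolding dim atLeast0LessThan by blast
  \<comment> \<open>Coefficient functions are taken extensional on \<open>B\<close>, so that a
    vector determines its coefficient function and not merely the values on
    \<open>B\<close>.\<close>
  have ex1: "\<exists>!a. a \<in> B \<rightarrow>\<^sub>E UNIV \<and> lincomb a B = v" if "v \<in> carrier V" for v
    using basis_criterion[OF fB BC] B that by simp
  define co where "co v = (THE a. a \<in> B \<rightarrow>\<^sub>E UNIV \<and> lincomb a B = v)" for v
  have co: "co v \<in> B \<rightarrow>\<^sub>E UNIV" "lincomb (co v) B = v" if "v \<in> carrier V" for v
    using theI'[OF ex1[OF that]] by (simp_all add: co_def)
  have co_eq: "restrict a B = co v" if "lincomb a B = v" for a v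
  proof -
    have "v \<in> carrier V" using lincomb_closed[OF BC, of a] that by simp
    moreover have "lincomb (restrict a B) B = v"
      using that lincomb_cong[OF refl BC, of "restrict a B" a] by simp
    ultimately show ?thesis using ex1[of v] co[of v] by (metis restrict_PiE UNIV_I restrict_PiE_iff)
  qed
  define q where "q v = vec dim (\<lambda>i. co v (e i))" for v
  have eB: "e i \<in> B" if "i < dim" for i using e that by (auto simp: bij_betw_def)
  show ?thesis
  proof (rule that[of q])
    show add: "q (a \<oplus>\<^bsub>V\<^esub> b) = q a + q b" if a: "a \<in> carrier V" and b: "b \<in> carrier V" for a b
    proof -
      have "lincomb (\<lambda>v. co a v + co b v) B = a \<oplus>\<^bsub>V\<^esub> b"
        using lincomb_sum[OF fB BC, of "co a" "co b"] co a b by simp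
      from co_eq[OF this, symmetric] show ?thesis
        by (intro eq_vecI) (auto simp: q_def eB)
    qed
    show smult: "q (c \<odot>\<^bsub>V\<^esub> a) = c \<cdot>\<^sub>v q a" if a: "a \<in> carrier V" for a c
    proof -
      have "lincomb (\<lambda>v. c * co a v) B = c \<odot>\<^bsub>V\<^esub> a"
        using lincomb_smult[OF BC, of "co a" c] co a by simp
      from co_eq[OF this, symmetric] show ?thesis
        by (intro eq_vecI) (auto simp: q_def eB)
    qed
    show "q ` carrier V = carrier_vec dim"
    proof
      show "carrier_vec dim \<subseteq> q ` carrier V"
      proof
        fix w :: "complex vec" assume w: "w \<in> carrier_vec dim"
        let ?a = "\<lambda>b. w $ (the_inv_into {..<dim} e b)"
        have "w = q (lincomb ?a B)"
        proof (rule eq_vecI)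
          fix i assume "i < dim_vec (q (lincomb ?a B))"
          then have i: "i < dim" by (simp add: q_def)
          have "co (lincomb ?a B) (e i) = ?a (e i)"
            unfolding co_eq[OF refl, of ?a, symmetric] using eB[OF i] by simp
          then show "w $ i = q (lincomb ?a B) $ i"
            using i e by (simp add: q_def the_inv_into_f_f bij_betw_def)
        qed (use w in \<open>simp add: q_def\<close>)
        then show "w \<in> q ` carrier V" by (rule image_eqI) (simp add: lincomb_closed[OF BC])
      qed
    qed (auto simp: q_def)
    have z: "q \<zero>\<^bsub>V\<^esub> = 0\<^sub>v dim"
    proof -
      have "q \<zero>\<^bsub>V\<^esub> = q (0 \<odot>\<^bsub>V\<^esub> \<zero>\<^bsub>V\<^esub>)" by simp
      also have "\<dots> = 0 \<cdot>\<^sub>v q \<zero>\<^bsub>V\<^esub>" by (rule smult) simp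
      finally have *: "q \<zero>\<^bsub>V\<^esub> = 0 \<cdot>\<^sub>v q \<zero>\<^bsub>V\<^esub>" .
      show ?thesis by (subst *, intro eq_vecI) (simp_all add: q_def)
    qed
    show "q a = 0\<^sub>v dim \<longleftrightarrow> a = \<zero>\<^bsub>V\<^esub>" if a: "a \<in> carrier V" for a
    proof
      assume "q a = 0\<^sub>v dim"
      then have "q a = q \<zero>\<^bsub>V\<^esub>" using z by simp
      have "co a b = co \<zero>\<^bsub>V\<^esub> b" if "b \<in> B" for b
      proof -
        obtain i where "i < dim" "b = e i" using e \<open>b \<in> B\<close> by (auto simp: bij_betw_def)
        moreover have "q a $ i = q \<zero>\<^bsub>V\<^esub> $ i" using \<open>q a = q \<zero>\<^bsub>V\<^esub>\<close> by simp
        ultimately show ?thesis by (simp add: q_def)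
      qed
      then have "co a = co \<zero>\<^bsub>V\<^esub>" using co(1)[OF a] co(1)[of "\<zero>\<^bsub>V\<^esub>"]
        by (intro PiE_ext[of _ B "\<lambda>_. UNIV"]) simp_all
      then show "a = \<zero>\<^bsub>V\<^esub>" using co(2)[OF a] co(2)[OF M.zero_closed] by metis
    qed (use z in simp)
  qed
qed

lemma OC_const_add: "OC_const m n (c + d) = OC_const m n c \<oplus>\<^bsub>OC m n\<^esub> OC_const m n d"
  by (simp add: OC_const_def flip: OC_class_add)

lemma OC_const_mult: "OC_const m n (c * d) = OC_const m n c \<otimes>\<^bsub>OC m n\<^esub> OC_const m n d"
  by (simp add: OC_const_def flip: OC_class_mult)

lemma OC_const_one: "OC_const m n 1 = \<one>\<^bsub>OC m n\<^esub>"
  by (simp add: OC_const_def OC_class_one)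

lemma OC_const_closed: "OC_const m n c \<in> carrier (OC m n)"
  by (simp add: OC_const_def OC_class_closed)

text \<open>Scalars act through the ring homomorphism from C to the quotient ring, so the vector
  space axioms become ring axioms.\<close>

lemma quot_space_vectorspace:
  assumes J: "ideal J (OC m n)"
  shows "vectorspace class_ring (quot_space m n J)"
proof -
  interpret J: ideal J "OC m n" by (rule J)
  interpret Q: cring "OC m n Quot J" by (rule J.quotient_is_cring[OF cring_OC])
  define k where "k c = J +>\<^bsub>OC m n\<^esub> OC_const m n c" for c
  note hom = J.rcos_ring_hom
  have k: "k c \<in> carrier (OC m n Quot J)" "k (c + d) = k c \<oplus>\<^bsub>OC m n Quot J\<^esub> k d"
     "k (c * d) = k c \<otimes>\<^bsub>OC m n Quot J\<^esub> k d" "k 1 = \<one>\<^bsub>OC m n Quot J\<^esub>" for c d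
    using ring_hom_closed[OF hom OC_const_closed, of c] ring_hom_one[OF hom]
      ring_hom_add[OF hom OC_const_closed OC_const_closed, of c d]
      ring_hom_mult[OF hom OC_const_closed OC_const_closed, of c d]
    by (simp_all only: k_def OC_const_add OC_const_mult OC_const_one)
  show ?thesis
    unfolding quot_space_def k_def[symmetric]
  proof (rule vs_criteria[OF class_field], goal_cases)
    case 3
    show ?case using Q.a_inv_closed Q.r_neg by auto
  next
    case 5
    show ?case using Q.a_comm by auto
  qed (auto simp: k Q.l_distr Q.r_distr Q.m_assoc Q.a_assoc)
qed

lemma has_colength_iff:
  assumes J: "ideal J (OC m n)"
  shows "has_colength m n J s \<longleftrightarrow> (\<exists>q. OC_quotient_map m n s J q)"
proof -
  interpret J: ideal J "OC m n" by (rule J)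
  let ?Q = "quot_space m n J"
  let ?p = "\<lambda>a. J +>\<^bsub>OC m n\<^esub> a"
  interpret Q: vectorspace class_ring ?Q by (rule quot_space_vectorspace[OF J])
  have carQ: "carrier ?Q = ?p ` carrier (OC m n)"
    by (auto simp: quot_space_def FactRing_def A_RCOSETS_def RCOSETS_def a_r_coset_def)
  have addQ: "?p a \<oplus>\<^bsub>?Q\<^esub> ?p b = ?p (a \<oplus>\<^bsub>OC m n\<^esub> b)"
    if "a \<in> carrier (OC m n)" "b \<in> carrier (OC m n)" for a b
    using ring_hom_add[OF J.rcos_ring_hom that] by (simp add: quot_space_def)
  have smultQ: "c \<odot>\<^bsub>?Q\<^esub> ?p a = ?p (OC_const m n c \<otimes>\<^bsub>OC m n\<^esub> a)"
    if "a \<in> carrier (OC m n)" for a c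
    using ring_hom_mult[OF J.rcos_ring_hom OC_const_closed that] by (simp add: quot_space_def)
  have zQ: "\<zero>\<^bsub>?Q\<^esub> = J" by (simp add: quot_space_def FactRing_def)
  have pz: "?p a = J \<longleftrightarrow> a \<in> J" if "a \<in> carrier (OC m n)" for a
    using J.a_rcos_const[of a] J.a_rcos_self[OF that] by metis
  show ?thesis
  proof
    assume h: "has_colength m n J s"
    have fd: Q.fin_dim and s: "Q.dim = s" using h unfolding has_colength_def by blast+
    obtain q where q: "q ` carrier ?Q = carrier_vec s"
      "\<And>a b. a \<in> carrier ?Q \<Longrightarrow> b \<in> carrier ?Q \<Longrightarrow> q (a \<oplus>\<^bsub>?Q\<^esub> b) = q a + q b"
      "\<And>c a. a \<in> carrier ?Q \<Longrightarrow> q (c \<odot>\<^bsub>?Q\<^esub> a) = c \<cdot>\<^sub>v q a"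
      "\<And>a. a \<in> carrier ?Q \<Longrightarrow> q a = 0\<^sub>v s \<longleftrightarrow> a = \<zero>\<^bsub>?Q\<^esub>"
      using vectorspace_coordinates[OF Q.vectorspace_axioms fd, unfolded s] by blast
    have "OC_quotient_map m n s J (\<lambda>a. q (?p a))"
      unfolding OC_quotient_map_def
    proof (intro conjI ballI allI)
      show "(\<lambda>a. q (?p a)) ` carrier (OC m n) = carrier_vec s"
        using q(1) by (simp add: carQ image_image)
      show "q (?p (a \<oplus>\<^bsub>OC m n\<^esub> b)) = q (?p a) + q (?p b)"
        if "a \<in> carrier (OC m n)" "b \<in> carrier (OC m n)" for a b
        using q(2) that by (simp add: addQ[symmetric] carQ)
      show "q (?p (OC_const m n c \<otimes>\<^bsub>OC m n\<^esub> a)) = c \<cdot>\<^sub>v q (?p a)" if "a \<in> carrier (OC m n)" for a c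
        using q(3) that by (simp add: smultQ[symmetric] carQ)
      show "{a \<in> carrier (OC m n). q (?p a) = 0\<^sub>v s} = J"
        using q(4) pz J.a_subset by (auto simp: carQ zQ)
    qed
    then show "\<exists>q. OC_quotient_map m n s J q" by blast
  next
    assume "\<exists>q. OC_quotient_map m n s J q"
    then obtain q where q: "q ` carrier (OC m n) = carrier_vec s"
      "\<And>a b. a \<in> carrier (OC m n) \<Longrightarrow> b \<in> carrier (OC m n) \<Longrightarrow> q (a \<oplus>\<^bsub>OC m n\<^esub> b) = q a + q b"
      "\<And>c a. a \<in> carrier (OC m n) \<Longrightarrow> q (OC_const m n c \<otimes>\<^bsub>OC m n\<^esub> a) = c \<cdot>\<^sub>v q a"
      "{a \<in> carrier (OC m n). q a = 0\<^sub>v s} = J"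
      unfolding OC_quotient_map_def by blast
    have qc: "q a \<in> carrier_vec s" if "a \<in> carrier (OC m n)" for a using q(1) that by blast
    have eq: "q a = q b \<longleftrightarrow> ?p a = ?p b" if a: "a \<in> carrier (OC m n)" and b: "b \<in> carrier (OC m n)" for a b
    proof -
      let ?d = "a \<ominus>\<^bsub>OC m n\<^esub> b"
      have dc: "?d \<in> carrier (OC m n)" using a b by simp
      have ad: "?d \<oplus>\<^bsub>OC m n\<^esub> b = a" using a b by (simp add: J.minus_eq J.a_assoc J.l_neg)
      have "q a = q ?d + q b" using q(2)[OF dc b] ad by simp
      then have "q a = q b \<longleftrightarrow> q ?d = 0\<^sub>v s"
        using add_vec_eq_right_iff[OF qc[OF dc] qc[OF b]] by simp
      also have "\<dots> \<longleftrightarrow> ?d \<in> J" using q(4) dc by blast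
      also have "\<dots> \<longleftrightarrow> ?p a = ?p b" by (rule J.quotient_eq_iff_same_a_r_cos[OF J a b])
      finally show ?thesis .
    qed
    \<comment> \<open>A set-theoretic section of \<open>q\<close>. Since \<open>q a = q b\<close>
      holds exactly when \<open>a\<close> and \<open>b\<close> have the same coset, its composite
      with the projection is a linear isomorphism from C^s to the quotient.\<close>
    define g where "g v = (SOME a. a \<in> carrier (OC m n) \<and> q a = v)" for v
    have g: "g v \<in> carrier (OC m n)" "q (g v) = v" if "v \<in> carrier_vec s" for v
    proof -
      have "v \<in> q ` carrier (OC m n)" using that by (simp only: q(1))
      then have "\<exists>a. a \<in> carrier (OC m n) \<and> q a = v" by blast
      from someI_ex[OF this] show "g v \<in> carrier (OC m n)" "q (g v) = v" by (simp_all add: g_def)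
    qed
    interpret W: vec_space "TYPE(complex)" s .
    have lin: "linear_map class_ring W.V ?Q (\<lambda>v. ?p (g v))"
    proof -
      have add: "?p (g (v + w)) = ?p (g v) \<oplus>\<^bsub>?Q\<^esub> ?p (g w)" if "v \<in> carrier_vec s" "w \<in> carrier_vec s" for v w
      proof -
        have "v + w \<in> carrier_vec s" using that by simp
        then have "q (g (v + w)) = q (g v \<oplus>\<^bsub>OC m n\<^esub> g w)"
          using that by (simp only: g q(2))
        moreover have "g v \<oplus>\<^bsub>OC m n\<^esub> g w \<in> carrier (OC m n)" using that g by simp
        ultimately show ?thesis
          using eq[OF g(1)] \<open>v + w \<in> carrier_vec s\<close> addQ[OF g(1) g(1)] that by metis
      qed
      have smult: "?p (g (c \<cdot>\<^sub>v v)) = c \<odot>\<^bsub>?Q\<^esub> ?p (g v)" if "v \<in> carrier_vec s" for v c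
      proof -
        have "c \<cdot>\<^sub>v v \<in> carrier_vec s" using that by simp
        then have "q (g (c \<cdot>\<^sub>v v)) = q (OC_const m n c \<otimes>\<^bsub>OC m n\<^esub> g v)"
          using that by (simp only: g q(3))
        moreover have "OC_const m n c \<otimes>\<^bsub>OC m n\<^esub> g v \<in> carrier (OC m n)"
          using that g OC_const_closed by simp
        ultimately show ?thesis
          using eq[OF g(1)] \<open>c \<cdot>\<^sub>v v \<in> carrier_vec s\<close> smultQ[OF g(1)] that by metis
      qed
      show ?thesis
        unfolding linear_map_def mod_hom_def mod_hom_axioms_def module_hom_def
        using vec_vs[where ?'a = complex and n = s] vec_module[where ?'a = complex and n = s] Q.vectorspace_axioms Q.module_axioms
        by (auto simp: add smult carQ g module_vec_simps)
    qed
    interpret L: linear_map class_ring W.V ?Q "\<lambda>v. ?p (g v)" by (rule lin)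
    have surj: "(\<lambda>v. ?p (g v)) ` carrier W.V = carrier ?Q"
    proof -
      have "?p a \<in> (\<lambda>v. ?p (g v)) ` carrier_vec s" if a: "a \<in> carrier (OC m n)" for a
      proof -
        have "?p (g (q a)) = ?p a" using eq[OF g(1)[OF qc[OF a]] a] g(2)[OF qc[OF a]] by blast
        then show ?thesis using qc[OF a] by (metis imageI)
      qed
      then show ?thesis using g by (auto simp: carQ module_vec_simps)
    qed
    have inj: "inj_on (\<lambda>v. ?p (g v)) (carrier W.V)"
    proof (rule inj_onI)
      fix v w assume "v \<in> carrier W.V" "w \<in> carrier W.V" "?p (g v) = ?p (g w)"
      then show "v = w" using eq[of "g v" "g w"] g[of v] g[of w] by (simp add: module_vec_simps)
    qed
    have "Q.fin_dim" by (rule L.surj_fin_dim[OF W.fin_dim surj])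
    moreover have "W.dim = Q.dim" by (rule L.dim_eq[OF W.fin_dim inj surj])
    ultimately show "has_colength m n J s" by (simp add: has_colength_def W.dim_is_n)
  qed
qed

section \<open>Finite-dimensional quotients\<close>

definition cx_subspace :: "nat \<Rightarrow> complex fls vec set \<Rightarrow> bool" where
  "cx_subspace n V \<longleftrightarrow> V \<subseteq> carrier_vec n \<and> 0\<^sub>v n \<in> V \<and> (\<forall>a\<in>V. \<forall>b\<in>V. a + b \<in> V) \<and>
     (\<forall>c. \<forall>a\<in>V. fls_const c \<cdot>\<^sub>v a \<in> V)"

text \<open>States that \<open>M\<close> has codimension \<open>s\<close> in \<open>V\<close>, with
  witness \<open>q\<close>. The analogue of \<open>OC_quotient_map\<close> for vectors;
  \<open>V\<close> and \<open>M\<close> may both be infinite-dimensional.\<close>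

definition quotient_map ::
    "complex fls vec set \<Rightarrow> nat \<Rightarrow> complex fls vec set \<Rightarrow> (complex fls vec \<Rightarrow> complex vec) \<Rightarrow> bool" where
  "quotient_map V s M q \<longleftrightarrow> q ` V = carrier_vec s \<and>
     (\<forall>a\<in>V. \<forall>b\<in>V. q (a + b) = q a + q b) \<and>
     (\<forall>c. \<forall>a\<in>V. q (fls_const c \<cdot>\<^sub>v a) = c \<cdot>\<^sub>v q a) \<and>
     {a \<in> V. q a = 0\<^sub>v s} = M"

definition lin_comb ::
    "nat \<Rightarrow> (nat \<Rightarrow> complex fls vec) \<Rightarrow> (nat \<Rightarrow> complex) \<Rightarrow> nat \<Rightarrow> complex fls vec" where
  "lin_comb n w c k = vec n (\<lambda>j. \<Sum>i<k. fls_const (c i) * w i $ j)"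

lemma cx_subspaceD:
  assumes "cx_subspace n V"
  shows "a \<in> V \<Longrightarrow> a \<in> carrier_vec n" "0\<^sub>v n \<in> V" "a \<in> V \<Longrightarrow> b \<in> V \<Longrightarrow> a + b \<in> V"
    "a \<in> V \<Longrightarrow> fls_const c \<cdot>\<^sub>v a \<in> V"
  using assms unfolding cx_subspace_def by blast+

lemma quotient_mapD:
  assumes "quotient_map V s M q"
  shows "q ` V = carrier_vec s" "a \<in> V \<Longrightarrow> q a \<in> carrier_vec s"
    "a \<in> V \<Longrightarrow> b \<in> V \<Longrightarrow> q (a + b) = q a + q b"
    "a \<in> V \<Longrightarrow> q (fls_const c \<cdot>\<^sub>v a) = c \<cdot>\<^sub>v q a"
    "a \<in> M \<longleftrightarrow> a \<in> V \<and> q a = 0\<^sub>v s"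
  using assms unfolding quotient_map_def by blast+

lemma int_vec_subspace: "cx_subspace n (int_vec n)"
  unfolding cx_subspace_def
  by (auto simp: int_vec_carrier int_vec_0 int_vec_add int_vec_smult[OF int_ring_const])

lemma quotient_map_kernel_subspace:
  assumes V: "cx_subspace n V" and q: "quotient_map V s M q"
  shows "cx_subspace n M"
proof -
  note V = cx_subspaceD[OF V] and q = quotient_mapD[OF q]
  have z: "q (0\<^sub>v n) = 0\<^sub>v s"
  proof -
    have "0\<^sub>v n + 0\<^sub>v n = (0\<^sub>v n :: complex fls vec)" by simp
    then have "q (0\<^sub>v n) + q (0\<^sub>v n) = q (0\<^sub>v n)" using q(3)[OF V(2) V(2)] by simp
    then show ?thesis using add_vec_eq_right_iff[OF q(2)[OF V(2)] q(2)[OF V(2)]] by blast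
  qed
  show ?thesis
    unfolding cx_subspace_def using V q(3,4) z by (auto simp: q(5))
qed

lemma lin_comb_0: "lin_comb n w c 0 = 0\<^sub>v n"
  by (intro eq_vecI) (simp_all add: lin_comb_def)

lemma lin_comb_Suc:
  "w k \<in> carrier_vec n \<Longrightarrow> lin_comb n w c (Suc k) = lin_comb n w c k + fls_const (c k) \<cdot>\<^sub>v w k"
  by (intro eq_vecI) (auto simp: lin_comb_def)

lemma lin_comb_carrier: "lin_comb n w c k \<in> carrier_vec n"
  by (simp add: lin_comb_def)

lemma lin_comb_closed:
  assumes V: "cx_subspace n V" and w: "\<And>i. i < k \<Longrightarrow> w i \<in> V"
  shows "lin_comb n w c k \<in> V"
  using w
proof (induction k)
  case (Suc k)
  then have "w k \<in> V" "lin_comb n w c k \<in> V" by simp_all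
  then show ?case using cx_subspaceD[OF V] by (simp add: lin_comb_Suc)
qed (simp add: lin_comb_0 cx_subspaceD[OF V])

lemma lin_comb_split:
  "lin_comb n w c (s + k) = lin_comb n w c s + lin_comb n (\<lambda>i. w (s + i)) (\<lambda>i. c (s + i)) k"
proof (rule eq_vecI)
  fix j assume "j < dim_vec (lin_comb n w c s + lin_comb n (\<lambda>i. w (s + i)) (\<lambda>i. c (s + i)) k)"
  then have j: "j < n" by (simp add: lin_comb_def)
  have "(\<Sum>i<s + k. fls_const (c i) * w i $ j) =
      (\<Sum>i<s. fls_const (c i) * w i $ j) + (\<Sum>i<k. fls_const (c (s + i)) * w (s + i) $ j)"
    by (induction k) (simp_all add: add.assoc)
  then show "lin_comb n w c (s + k) $ j =
      (lin_comb n w c s + lin_comb n (\<lambda>i. w (s + i)) (\<lambda>i. c (s + i)) k) $ j"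
    using j by (simp add: lin_comb_def)
qed (simp add: lin_comb_def)

lemma lin_comb_cong:
  "(\<And>i. i < k \<Longrightarrow> w i = w' i) \<Longrightarrow> (\<And>i. i < k \<Longrightarrow> c i = c' i) \<Longrightarrow> lin_comb n w c k = lin_comb n w' c' k"
  by (intro eq_vecI) (simp_all add: lin_comb_def)

lemma lin_comb_coeff_0: "(\<And>i. i < k \<Longrightarrow> c i = 0) \<Longrightarrow> lin_comb n w c k = 0\<^sub>v n"
  by (intro eq_vecI) (simp_all add: lin_comb_def)

lemma quotient_map_lin_comb:
  assumes V: "cx_subspace n V" and q: "quotient_map V s M q" and w: "\<And>i. i < k \<Longrightarrow> w i \<in> V"
  shows "q (lin_comb n w c k) = vec s (\<lambda>r. \<Sum>i<k. c i * q (w i) $ r)"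
  using w
proof (induction k)
  case 0
  have "0\<^sub>v n \<in> M" by (rule cx_subspaceD(2)[OF quotient_map_kernel_subspace[OF V q]])
  then have "q (0\<^sub>v n) = 0\<^sub>v s" using quotient_mapD(5)[OF q] by blast
  then show ?case by (auto simp: lin_comb_0)
next
  case (Suc k)
  have wk: "w k \<in> V" using Suc.prems by simp
  have lc: "lin_comb n w c k \<in> V" using lin_comb_closed[OF V] Suc.prems by simp
  have IH: "q (lin_comb n w c k) = vec s (\<lambda>r. \<Sum>i<k. c i * q (w i) $ r)" using Suc by simp
  have "q (lin_comb n w c (Suc k)) = q (lin_comb n w c k) + c k \<cdot>\<^sub>v q (w k)"
    using quotient_mapD(3)[OF q lc cx_subspaceD(4)[OF V wk, of "c k"]] quotient_mapD(4)[OF q wk]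
      lin_comb_Suc[of w k n c, OF cx_subspaceD(1)[OF V wk]] by simp
  then show ?case
    unfolding IH using quotient_mapD(2)[OF q wk] by (intro eq_vecI) auto
qed

lemma underdetermined_system:
  fixes a :: "nat \<Rightarrow> nat \<Rightarrow> 'a :: field"
  obtains c where "\<exists>i\<le>s. c i \<noteq> 0" "\<And>r. r < s \<Longrightarrow> (\<Sum>i<Suc s. c i * a r i) = 0"
proof -
  \<comment> \<open>Padding with a zero row makes the system square, and its transpose kills the
    last unit vector; a singular matrix then has a kernel vector.\<close>
  let ?A = "mat (Suc s) (Suc s) (\<lambda>(r, i). if r < s then a r i else 0)"
  have A: "?A \<in> carrier_mat (Suc s) (Suc s)" by simp
  have "transpose_mat ?A *\<^sub>v unit_vec (Suc s) s = 0\<^sub>v (Suc s)"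
    by (intro eq_vecI) (auto simp: scalar_prod_def unit_vec_def intro!: sum.neutral)
  moreover have "unit_vec (Suc s) s \<noteq> (0\<^sub>v (Suc s) :: 'a vec)" by simp
  moreover have "transpose_mat ?A \<in> carrier_mat (Suc s) (Suc s)" by simp
  ultimately have "det (transpose_mat ?A) = 0"
    using det_0_iff_vec_prod_zero unit_vec_carrier[of "Suc s" s] by blast
  then have "det ?A = 0" using det_transpose[OF A] by simp
  then obtain v where v: "v \<in> carrier_vec (Suc s)" "v \<noteq> 0\<^sub>v (Suc s)" "?A *\<^sub>v v = 0\<^sub>v (Suc s)"
    using det_0_iff_vec_prod_zero[OF A] by blast
  have "\<exists>i\<le>s. v $ i \<noteq> 0"
  proof (rule ccontr)
    assume "\<not> ?thesis"
    then have "v = 0\<^sub>v (Suc s)" using v(1) by (intro eq_vecI) auto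
    then show False using v(2) by simp
  qed
  moreover have "(\<Sum>i<Suc s. v $ i * a r i) = 0" if r: "r < s" for r
  proof -
    have "(?A *\<^sub>v v) $ r = (\<Sum>i<Suc s. ?A $$ (r, i) * v $ i)"
      by (rule mult_mat_vec_index[OF A v(1)]) (use r in simp)
    also have "\<dots> = (\<Sum>i<Suc s. v $ i * a r i)"
      by (rule sum.cong) (use r in auto)
    finally show ?thesis using v(3) r by simp
  qed
  ultimately show ?thesis by (rule that)
qed

lemma quotient_map_dependence:
  assumes V: "cx_subspace n V" and q: "quotient_map V s M q" and w: "\<And>i. i \<le> s \<Longrightarrow> w i \<in> V"
  obtains c where "\<exists>i\<le>s. c i \<noteq> 0" "lin_comb n w c (Suc s) \<in> M"
proof -
  obtain c where c: "\<exists>i\<le>s. c i \<noteq> 0" "\<And>r. r < s \<Longrightarrow> (\<Sum>i<Suc s. c i * q (w i) $ r) = 0"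
    using underdetermined_system[of s "\<lambda>r i. q (w i) $ r"] by blast
  have "q (lin_comb n w c (Suc s)) = 0\<^sub>v s"
    using quotient_map_lin_comb[OF V q, of "Suc s" w c] w c(2) by (simp del: sum.lessThan_Suc) auto
  moreover have "lin_comb n w c (Suc s) \<in> V" using lin_comb_closed[OF V, of "Suc s" w] w by simp
  ultimately show ?thesis using that[OF c(1)] quotient_mapD(5)[OF q] by blast
qed

lemma quotient_map_dual_basis:
  assumes q: "quotient_map V s M q"
  obtains v where "\<And>i. i < s \<Longrightarrow> v i \<in> V" "\<And>i. i < s \<Longrightarrow> q (v i) = unit_vec s i"
proof -
  have "\<exists>a\<in>V. q a = unit_vec s i" for i
  proof -
    have "unit_vec s i \<in> q ` V" unfolding quotient_mapD(1)[OF q] by simp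
    then show ?thesis by force
  qed
  then obtain v where "\<forall>i. v i \<in> V \<and> q (v i) = unit_vec s i" by metis
  then show ?thesis using that by blast
qed

lemma quotient_map_dual_lin_comb:
  assumes V: "cx_subspace n V" and q: "quotient_map V s M q"
    and v: "\<And>i. i < s \<Longrightarrow> v i \<in> V" "\<And>i. i < s \<Longrightarrow> q (v i) = unit_vec s i"
  shows "q (lin_comb n v c s) = vec s c"
proof -
  have "(\<Sum>i<s. c i * q (v i) $ r) = c r" if r: "r < s" for r
  proof -
    have "(\<Sum>i<s. c i * q (v i) $ r) = (\<Sum>i<s. if i = r then c i else 0)"
      by (rule sum.cong) (use v(2) r in \<open>auto simp: unit_vec_def\<close>)
    then show ?thesis using r by simp
  qed
  then show ?thesis
    using quotient_map_lin_comb[OF V q, of s v c] v(1) by (auto intro!: eq_vecI)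
qed

lemma vec_eq_0D: "vec s c = 0\<^sub>v s \<Longrightarrow> i < s \<Longrightarrow> c i = 0"
  by (drule arg_cong[of _ _ "\<lambda>v. v $ i"]) simp

text \<open>If \<open>s' < s\<close>, then \<open>s' + 1\<close> of the preimages of unit vectors
  under \<open>q\<close> are dependent modulo \<open>M'\<close>, hence modulo \<open>M\<close>,
  which contradicts their independence there. With \<open>M = M'\<close> this gives uniqueness of
  the codimension.\<close>

lemma quotient_map_le:
  assumes V: "cx_subspace n V" and q: "quotient_map V s M q" and q': "quotient_map V s' M' q'"
    and sub: "M' \<subseteq> M"
  shows "s \<le> s'"
proof (rule ccontr)
  assume "\<not> s \<le> s'"
  then have lt: "s' < s" by simp
  obtain v where v: "\<And>i. i < s \<Longrightarrow> v i \<in> V" "\<And>i. i < s \<Longrightarrow> q (v i) = unit_vec s i"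
    using quotient_map_dual_basis[OF q] by blast
  obtain c where c: "\<exists>i\<le>s'. c i \<noteq> 0" "lin_comb n v c (Suc s') \<in> M'"
    using quotient_map_dependence[OF V q', of v] v(1) lt by auto
  \<comment> \<open>Extension by zero lets the relation be compared with all \<open>s\<close> dual
    vectors.\<close>
  let ?c = "\<lambda>i. if i \<le> s' then c i else 0"
  have "lin_comb n v ?c s = lin_comb n v ?c (Suc s') + lin_comb n (\<lambda>i. v (Suc s' + i)) (\<lambda>i. ?c (Suc s' + i)) (s - Suc s')"
    using lin_comb_split[of n v ?c "Suc s'" "s - Suc s'"] lt by simp
  also have "\<dots> = lin_comb n v ?c (Suc s')"
    using lin_comb_coeff_0[of "s - Suc s'" "\<lambda>i. ?c (Suc s' + i)" n] lin_comb_carrier[of n v ?c "Suc s'"] by simp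
  also have "\<dots> = lin_comb n v c (Suc s')" by (rule lin_comb_cong) auto
  finally have "lin_comb n v ?c s \<in> M" using c(2) sub by auto
  then have "vec s ?c = 0\<^sub>v s"
    using quotient_map_dual_lin_comb[OF V q v, of ?c] quotient_mapD(5)[OF q] by simp
  then have "?c i = 0" if "i < s" for i using vec_eq_0D[of s ?c i] that by simp
  then show False using c(1) lt by (metis le_less_trans)
qed

text \<open>The \<open>d + 1\<close> given vectors together with \<open>s\<close> preimages of unit
  vectors are \<open>s + d + 1\<close> vectors in \<open>V\<close>, so they are dependent modulo
  \<open>M'\<close>. Applying \<open>q\<close> annihilates the given ones and forces the
  coefficients of the preimages to vanish.\<close>

lemma quotient_map_relation:
  assumes V: "cx_subspace n V" and q: "quotient_map V s M q" and q': "quotient_map V (s + d) M' q'"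
    and sub: "M' \<subseteq> M" and x: "\<And>i. i \<le> d \<Longrightarrow> x i \<in> M"
  obtains c where "\<exists>i\<le>d. c i \<noteq> 0" "lin_comb n x c (Suc d) \<in> M'"
proof -
  note M = quotient_map_kernel_subspace[OF V q]
  have MV: "a \<in> V" if "a \<in> M" for a using that quotient_mapD(5)[OF q] by blast
  obtain v where v: "\<And>i. i < s \<Longrightarrow> v i \<in> V" "\<And>i. i < s \<Longrightarrow> q (v i) = unit_vec s i"
    using quotient_map_dual_basis[OF q] by blast
  let ?w = "\<lambda>i. if i < s then v i else x (i - s)"
  have "?w i \<in> V" if "i \<le> s + d" for i using v(1) x MV that by auto
  then obtain c where c: "\<exists>i\<le>s + d. c i \<noteq> 0" "lin_comb n ?w c (Suc (s + d)) \<in> M'"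
    using quotient_map_dependence[OF V q', of ?w] by blast
  let ?b = "lin_comb n x (\<lambda>i. c (s + i)) (Suc d)"
  have split: "lin_comb n ?w c (Suc (s + d)) = lin_comb n v c s + ?b"
  proof -
    have "lin_comb n ?w c (s + Suc d) = lin_comb n ?w c s + lin_comb n (\<lambda>i. ?w (s + i)) (\<lambda>i. c (s + i)) (Suc d)"
      by (rule lin_comb_split)
    also have "lin_comb n ?w c s = lin_comb n v c s" by (rule lin_comb_cong) auto
    also have "lin_comb n (\<lambda>i. ?w (s + i)) (\<lambda>i. c (s + i)) (Suc d) = ?b" by (rule lin_comb_cong) auto
    finally show ?thesis by simp
  qed
  have b: "?b \<in> M" by (rule lin_comb_closed[OF M]) (use x in auto)
  have lv: "lin_comb n v c s \<in> V" by (rule lin_comb_closed[OF V]) (use v in auto)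
  have "q (lin_comb n v c s + ?b) = 0\<^sub>v s" using c(2) sub split quotient_mapD(5)[OF q] by auto
  moreover have "q (lin_comb n v c s + ?b) = q (lin_comb n v c s) + q ?b"
    by (rule quotient_mapD(3)[OF q lv MV[OF b]])
  moreover have "q ?b = 0\<^sub>v s" using b quotient_mapD(5)[OF q] by blast
  ultimately have "vec s c = 0\<^sub>v s"
    using quotient_map_dual_lin_comb[OF V q v, of c] quotient_mapD(2)[OF q lv] by simp
  then have z: "c i = 0" if "i < s" for i using vec_eq_0D[of s c i] that by simp
  have "lin_comb n v c s = 0\<^sub>v n" by (rule lin_comb_coeff_0) (rule z)
  then have "?b \<in> M'" using c(2) split lin_comb_carrier[of n x] by simp
  have "\<exists>i\<le>d. c (s + i) \<noteq> 0"
  proof -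
    obtain i where i: "i \<le> s + d" "c i \<noteq> 0" using c(1) by blast
    then have "s \<le> i" using z by (meson not_le)
    then show ?thesis using i by (intro exI[of _ "i - s"]) simp
  qed
  then show ?thesis using \<open>?b \<in> M'\<close> by (rule that)
qed

lemma cx_subspace_cancel:
  assumes M: "cx_subspace n M" and a: "a \<in> carrier_vec n" and c: "c \<noteq> 0"
    and ca: "fls_const c \<cdot>\<^sub>v a \<in> M"
  shows "a \<in> M"
proof -
  have "fls_const (1 / c) \<cdot>\<^sub>v (fls_const c \<cdot>\<^sub>v a) = a"
    using a c by (intro eq_vecI) (simp_all add: mult.assoc[symmetric] fls_const_mult_const)
  then show ?thesis using cx_subspaceD(4)[OF M ca, of "1 / c"] by simp
qed

text \<open>The case \<open>d = 0\<close> of the preceding relation: a nonzero multiple of each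
  element of \<open>M\<close> lies in \<open>M'\<close>.\<close>

lemma quotient_map_same_kernel:
  assumes V: "cx_subspace n V" and q: "quotient_map V s M q" and q': "quotient_map V s M' q'"
    and sub: "M' \<subseteq> M"
  shows "M' = M"
proof
  show "M \<subseteq> M'"
  proof
    fix a assume a: "a \<in> M"
    have ac: "a \<in> carrier_vec n"
      using a cx_subspaceD(1)[OF quotient_map_kernel_subspace[OF V q]] by blast
    have q'0: "quotient_map V (s + 0) M' q'" using q' by simp
    obtain c where c: "\<exists>i\<le>0. c i \<noteq> 0" "lin_comb n (\<lambda>_. a) c (Suc 0) \<in> M'"
      by (rule quotient_map_relation[OF V q q'0 sub, of "\<lambda>_. a"]) (use a in auto)
    have "lin_comb n (\<lambda>_. a) c (Suc 0) = fls_const (c 0) \<cdot>\<^sub>v a"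
      using ac by (simp add: lin_comb_Suc lin_comb_0)
    then show "a \<in> M'"
      using cx_subspace_cancel[OF quotient_map_kernel_subspace[OF V q'] ac, of "c 0"] c by auto
  qed
qed (rule sub)

text \<open>The case \<open>d = 1\<close>: a relation between \<open>w\<close> and \<open>a\<close>
  modulo \<open>M'\<close> must involve \<open>a\<close>, as otherwise \<open>w\<close> would lie in
  \<open>M'\<close>. Thus \<open>M\<close> is spanned by \<open>M'\<close> and
  \<open>w\<close>.\<close>

lemma quotient_map_codim_one:
  assumes V: "cx_subspace n V" and q: "quotient_map V s M q" and q': "quotient_map V (Suc s) M' q'"
    and sub: "M' \<subseteq> M" and w: "w \<in> M" "w \<notin> M'" and a: "a \<in> M"
  obtains c where "a + fls_const c \<cdot>\<^sub>v w \<in> M'"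
proof -
  note M = quotient_map_kernel_subspace[OF V q] and M' = quotient_map_kernel_subspace[OF V q']
  have wc: "w \<in> carrier_vec n" and ac: "a \<in> carrier_vec n"
    using w a cx_subspaceD(1)[OF M] by blast+
  let ?x = "\<lambda>i::nat. if i = 0 then w else a"
  have q'1: "quotient_map V (s + 1) M' q'" using q' by simp
  obtain c where c: "\<exists>i\<le>1. c i \<noteq> 0" "lin_comb n ?x c (Suc 1) \<in> M'"
    by (rule quotient_map_relation[OF V q q'1 sub, of ?x]) (use w a in auto)
  have lc: "lin_comb n ?x c (Suc 1) = fls_const (c 0) \<cdot>\<^sub>v w + fls_const (c 1) \<cdot>\<^sub>v a"
    using wc ac by (simp add: lin_comb_Suc lin_comb_0)
  have c1: "c 1 \<noteq> 0"
  proof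
    assume c1: "c 1 = 0"
    then have "c 0 \<noteq> 0" using c(1) by (auto simp: le_Suc_eq)
    moreover have "fls_const (c 0) \<cdot>\<^sub>v w + fls_const (c 1) \<cdot>\<^sub>v a = fls_const (c 0) \<cdot>\<^sub>v w"
      using wc ac c1 by (intro eq_vecI) auto
    ultimately show False
      using cx_subspace_cancel[OF M' wc, of "c 0"] c(2) w(2) lc by simp
  qed
  have "fls_const (c 1) \<cdot>\<^sub>v (a + fls_const (c 0 / c 1) \<cdot>\<^sub>v w) = lin_comb n ?x c (Suc 1)"
    unfolding lc using wc ac c1
    by (intro eq_vecI) (simp_all add: distrib_left mult.assoc[symmetric] fls_const_mult_const add.commute)
  then have "a + fls_const (c 0 / c 1) \<cdot>\<^sub>v w \<in> M'"
    using c(2) c1 wc ac cx_subspace_cancel[OF M' _ c1, of "a + fls_const (c 0 / c 1) \<cdot>\<^sub>v w"] by simp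
  then show ?thesis by (rule that)
qed

text \<open>Additivity of codimension. The span of preimages of unit vectors is a complement of
  \<open>M\<close> in \<open>V\<close>; with \<open>h\<close> the projection onto \<open>M\<close>
  along it, the concatenation of \<open>q\<close> and \<open>p\<close> after \<open>h\<close> has
  kernel \<open>M'\<close>.\<close>

lemma quotient_map_compose:
  assumes V: "cx_subspace n V" and q: "quotient_map V s M q" and p: "quotient_map M r M' p"
  obtains q' where "quotient_map V (s + r) M' q'"
proof -
  note M = quotient_map_kernel_subspace[OF V q]
  have MV: "a \<in> V" if "a \<in> M" for a using that quotient_mapD(5)[OF q] by blast
  have qM: "q a = 0\<^sub>v s" if "a \<in> M" for a using that quotient_mapD(5)[OF q] by blast
  obtain v where v: "\<And>i. i < s \<Longrightarrow> v i \<in> V" "\<And>i. i < s \<Longrightarrow> q (v i) = unit_vec s i"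
    using quotient_map_dual_basis[OF q] by blast
  define h where "h a = a + fls_const (- 1) \<cdot>\<^sub>v lin_comb n v (\<lambda>i. q a $ i) s" for a
  have lv: "lin_comb n v c s \<in> V" for c by (rule lin_comb_closed[OF V]) (use v in auto)
  have hV: "h a \<in> V" if "a \<in> V" for a
    unfolding h_def using cx_subspaceD(3,4)[OF V] that lv by blast
  have hM: "h a \<in> M" if a: "a \<in> V" for a
  proof -
    have "q (h a) = q a + (- 1) \<cdot>\<^sub>v q (lin_comb n v (\<lambda>i. q a $ i) s)"
      unfolding h_def quotient_mapD(3)[OF q a cx_subspaceD(4)[OF V lv]] quotient_mapD(4)[OF q lv] ..
    also have "q (lin_comb n v (\<lambda>i. q a $ i) s) = vec s (\<lambda>i. q a $ i)"
      by (rule quotient_map_dual_lin_comb[OF V q v])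
    also have "q a + (- 1) \<cdot>\<^sub>v vec s (\<lambda>i. q a $ i) = 0\<^sub>v s"
      using quotient_mapD(2)[OF q a] by (intro eq_vecI) auto
    finally show ?thesis using quotient_mapD(5)[OF q] hV[OF a] by blast
  qed
  have hadd: "h (a + b) = h a + h b" if a: "a \<in> V" and b: "b \<in> V" for a b
  proof -
    have ac: "a \<in> carrier_vec n" and bc: "b \<in> carrier_vec n" using a b cx_subspaceD(1)[OF V] by blast+
    have qc: "q a \<in> carrier_vec s" "q b \<in> carrier_vec s" using quotient_mapD(2)[OF q] a b by blast+
    show ?thesis
      unfolding h_def quotient_mapD(3)[OF q a b]
      using ac bc qc by (intro eq_vecI)
        (simp_all add: lin_comb_def fls_plus_const[symmetric] distrib_right sum.distrib)
  qed
  have hsc: "h (fls_const c \<cdot>\<^sub>v a) = fls_const c \<cdot>\<^sub>v h a" if a: "a \<in> V" for a c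
  proof -
    have ac: "a \<in> carrier_vec n" using a cx_subspaceD(1)[OF V] by blast
    have qc: "q a \<in> carrier_vec s" using quotient_mapD(2)[OF q] a by blast
    show ?thesis
      unfolding h_def quotient_mapD(4)[OF q a]
      using ac qc by (intro eq_vecI)
        (simp_all add: lin_comb_def fls_const_mult_const[symmetric] distrib_left sum_distrib_left mult.assoc
          del: fls_const_mult_const)
  qed
  have hid: "h (lin_comb n v c s + a) = a" if a: "a \<in> M" for a c
  proof -
    have "q (lin_comb n v c s + a) = vec s c"
      using quotient_mapD(3)[OF q lv MV[OF a]] quotient_map_dual_lin_comb[OF V q v] qM[OF a] by simp
    then have "h (lin_comb n v c s + a) =
        (lin_comb n v c s + a) + fls_const (- 1) \<cdot>\<^sub>v lin_comb n v c s"
      unfolding h_def by (intro arg_cong2[where f = "(+)"] refl arg_cong2[where f = "(\<cdot>\<^sub>v)"] lin_comb_cong) auto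
    also have "\<dots> = a" using cx_subspaceD(1)[OF M a] lin_comb_carrier[of n v c s]
      by (intro eq_vecI) (auto simp: fls_const_uminus[symmetric])
    finally show ?thesis .
  qed
  define q' where "q' a = q a @\<^sub>v p (h a)" for a
  have "quotient_map V (s + r) M' q'"
    unfolding quotient_map_def
  proof (intro conjI ballI allI)
    show "q' ` V = carrier_vec (s + r)"
    proof
      show "q' ` V \<subseteq> carrier_vec (s + r)"
        unfolding q'_def using quotient_mapD(2)[OF q] quotient_mapD(2)[OF p] hM by auto
      show "carrier_vec (s + r) \<subseteq> q' ` V"
      proof
        fix u :: "complex vec" assume u: "u \<in> carrier_vec (s + r)"
        have "vec_last u r \<in> p ` M" unfolding quotient_mapD(1)[OF p] by simp
        then obtain b where b: "b \<in> M" "p b = vec_last u r" by force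
        let ?a = "lin_comb n v (\<lambda>i. u $ i) s + b"
        have aV: "?a \<in> V" using cx_subspaceD(3)[OF V lv MV[OF b(1)]] .
        have "q ?a = vec_first u s"
          using quotient_mapD(3)[OF q lv MV[OF b(1)]] quotient_map_dual_lin_comb[OF V q v] qM[OF b(1)]
          by (simp add: vec_first_def)
        moreover have "p (h ?a) = vec_last u r" using hid[OF b(1)] b(2) by simp
        ultimately have "u = q' ?a" unfolding q'_def using vec_first_last_append[OF u] by simp
        then show "u \<in> q' ` V" using aV by (rule image_eqI)
      qed
    qed
    show "q' (a + b) = q' a + q' b" if a: "a \<in> V" and b: "b \<in> V" for a b
      unfolding q'_def hadd[OF a b] quotient_mapD(3)[OF q a b] quotient_mapD(3)[OF p hM[OF a] hM[OF b]]
      by (rule append_vec_add[OF quotient_mapD(2)[OF q a] quotient_mapD(2)[OF q b]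
          quotient_mapD(2)[OF p hM[OF a]] quotient_mapD(2)[OF p hM[OF b]], symmetric])
    show "q' (fls_const c \<cdot>\<^sub>v a) = c \<cdot>\<^sub>v q' a" if a: "a \<in> V" for a c
      unfolding q'_def hsc[OF a] quotient_mapD(4)[OF q a] quotient_mapD(4)[OF p hM[OF a]]
      by (intro eq_vecI) auto
    show "{a \<in> V. q' a = 0\<^sub>v (s + r)} = M'"
    proof -
      have "q' a = 0\<^sub>v (s + r) \<longleftrightarrow> q a = 0\<^sub>v s \<and> p (h a) = 0\<^sub>v r" if a: "a \<in> V" for a
      proof -
        have "0\<^sub>v (s + r) = 0\<^sub>v s @\<^sub>v (0\<^sub>v r :: complex vec)" by (intro eq_vecI) auto
        then show ?thesis unfolding q'_def
          using append_vec_eq[OF quotient_mapD(2)[OF q a], of "0\<^sub>v s"] by simp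
      qed
      moreover have "h a = a" if "a \<in> M" for a
      proof -
        have "lin_comb n v (\<lambda>_. 0) s + a = a"
          using lin_comb_coeff_0[of s "\<lambda>_. 0" n v] cx_subspaceD(1)[OF M that] by simp
        then show ?thesis using hid[OF that, of "\<lambda>_. 0"] by simp
      qed
      ultimately show ?thesis using quotient_mapD(5)[OF q] quotient_mapD(5)[OF p] by auto
    qed
  qed
  then show ?thesis by (rule that)
qed

text \<open>A maximal independent family of the functionals already cuts out their common kernel.\<close>

lemma select_functionals:
  fixes \<phi> :: "'i \<Rightarrow> complex fls vec \<Rightarrow> complex"
  assumes V: "cx_subspace n V"
    and add: "\<And>i a b. i \<in> I \<Longrightarrow> a \<in> V \<Longrightarrow> b \<in> V \<Longrightarrow> \<phi> i (a + b) = \<phi> i a + \<phi> i b"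
    and sc: "\<And>i c a. i \<in> I \<Longrightarrow> a \<in> V \<Longrightarrow> \<phi> i (fls_const c \<cdot>\<^sub>v a) = c * \<phi> i a"
    and q0: "quotient_map V B M0 q0" and M0: "\<And>i a. i \<in> I \<Longrightarrow> a \<in> M0 \<Longrightarrow> \<phi> i a = 0"
  obtains s e where "\<And>r. r < s \<Longrightarrow> e r \<in> I"
    "quotient_map V s {a \<in> V. \<forall>i\<in>I. \<phi> i a = 0} (\<lambda>a. vec s (\<lambda>r. \<phi> (e r) a))"
proof -
  let ?q = "\<lambda>s e a. vec s (\<lambda>r::nat. \<phi> (e r) a)"
  define P where "P s \<longleftrightarrow> (\<exists>e. (\<forall>r<s. e r \<in> I) \<and> ?q s e ` V = carrier_vec s)" for s
  have qm: "quotient_map V s {a \<in> V. ?q s e a = 0\<^sub>v s} (?q s e)"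
    if "\<forall>r<s. e r \<in> I" "?q s e ` V = carrier_vec s" for s e
    unfolding quotient_map_def using that add sc by (auto intro!: eq_vecI)
  \<comment> \<open>Independent functionals from the family all vanish on \<open>M0\<close>, so
    there are at most \<open>B\<close> of them and a maximal number exists.\<close>
  have bound: "s \<le> B" if P: "P s" for s
  proof -
    obtain e where e: "\<forall>r<s. e r \<in> I" "?q s e ` V = carrier_vec s"
      using P unfolding P_def by blast
    have "M0 \<subseteq> {a \<in> V. ?q s e a = 0\<^sub>v s}"
      using M0 e(1) quotient_mapD(5)[OF q0] by (auto intro!: eq_vecI)
    then show ?thesis using quotient_map_le[OF V qm[OF e] q0] by blast
  qed
  have P0: "P 0"
    unfolding P_def
  proof (intro exI conjI)
    show "\<forall>r<0::nat. undefined r \<in> I" by simp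
    show "?q 0 undefined ` V = carrier_vec 0"
    proof
      show "carrier_vec 0 \<subseteq> ?q 0 undefined ` V"
      proof
        fix u :: "complex vec" assume "u \<in> carrier_vec 0"
        then have "u = ?q 0 undefined (0\<^sub>v n)" by (intro eq_vecI) auto
        then show "u \<in> ?q 0 undefined ` V" using cx_subspaceD(2)[OF V] by (rule image_eqI)
      qed
    qed auto
  qed
  define s where "s = Greatest P"
  have "P s" unfolding s_def by (rule GreatestI_nat[of P, OF P0 bound])
  have s: "s' \<le> s" if "P s'" for s' unfolding s_def by (rule Greatest_le_nat[of P, OF that bound])
  obtain e where e: "\<forall>r<s. e r \<in> I" "?q s e ` V = carrier_vec s"
    using \<open>P s\<close> unfolding P_def by blast
  have "{a \<in> V. ?q s e a = 0\<^sub>v s} = {a \<in> V. \<forall>i\<in>I. \<phi> i a = 0}"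
  proof
    show "{a \<in> V. \<forall>i\<in>I. \<phi> i a = 0} \<subseteq> {a \<in> V. ?q s e a = 0\<^sub>v s}"
      using e(1) by (auto intro!: eq_vecI)
    show "{a \<in> V. ?q s e a = 0\<^sub>v s} \<subseteq> {a \<in> V. \<forall>i\<in>I. \<phi> i a = 0}"
    proof (rule ccontr)
      assume "\<not> ?thesis"
      then obtain a i where a: "a \<in> V" "?q s e a = 0\<^sub>v s" "i \<in> I" "\<phi> i a \<noteq> 0" by blast
      have az: "\<phi> (e r) a = 0" if "r < s" for r
        using arg_cong[OF a(2), of "\<lambda>v. v $ r"] that by simp
      let ?e = "e(s := i)"
      have "?q (Suc s) ?e ` V = carrier_vec (Suc s)"
      proof
        show "carrier_vec (Suc s) \<subseteq> ?q (Suc s) ?e ` V"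
        proof
          fix u :: "complex vec" assume u: "u \<in> carrier_vec (Suc s)"
          have "vec s (\<lambda>r. u $ r) \<in> ?q s e ` V" unfolding e(2) by simp
          then obtain b where b: "b \<in> V" "?q s e b = vec s (\<lambda>r. u $ r)" by force
          have bz: "\<phi> (e r) b = u $ r" if "r < s" for r
            using arg_cong[OF b(2), of "\<lambda>v. v $ r"] that by simp
          \<comment> \<open>Since \<open>a\<close> is killed by the chosen functionals but not by
            \<open>\<phi> i\<close>, adding a multiple of it adjusts the new coordinate and leaves
            the old ones unchanged.\<close>
          define c where "c = (u $ s - \<phi> i b) / \<phi> i a"
          let ?a = "b + fls_const c \<cdot>\<^sub>v a"
          have aV: "?a \<in> V" "fls_const c \<cdot>\<^sub>v a \<in> V" using cx_subspaceD(3,4)[OF V] a b by blast+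
          have "u = ?q (Suc s) ?e ?a"
          proof (rule eq_vecI)
            fix r assume "r < dim_vec (?q (Suc s) ?e ?a)"
            then consider "r < s" | "r = s" by fastforce
            then show "u $ r = ?q (Suc s) ?e ?a $ r"
            proof cases
              case 1
              then show ?thesis
                using e(1) add[OF _ b(1) aV(2)] sc[OF _ a(1)] az bz by simp
            next
              case 2
              then show ?thesis
                using add[OF a(3) b(1) aV(2)] sc[OF a(3) a(1)] a(4) by (simp add: c_def)
            qed
          qed (use u in simp)
          then show "u \<in> ?q (Suc s) ?e ` V" using aV(1) by (rule image_eqI)
        qed
      qed auto
      moreover have "\<forall>r<Suc s. ?e r \<in> I" using e(1) a(3) by (simp add: less_Suc_eq)
      ultimately have "P (Suc s)" unfolding P_def by blast
      then show False using s by fastforce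
    qed
  qed
  then have "quotient_map V s {a \<in> V. \<forall>i\<in>I. \<phi> i a = 0} (?q s e)" using qm[OF e] by simp
  then show ?thesis using that e(1) by blast
qed

section \<open>Lattice flags\<close>

abbreviation GL_inv :: "nat \<Rightarrow> complex fls mat \<Rightarrow> complex fls mat" where
  "GL_inv n g \<equiv> inv\<^bsub>GL_K n\<^esub> g"

abbreviation Icoset :: "nat \<Rightarrow> complex fls mat \<Rightarrow> complex fls mat set" where
  "Icoset n g \<equiv> g <#\<^bsub>GL_K n\<^esub> Iwahori n"

section \<open>The general linear group over the Laurent series\<close>

lemma GL_K_group: "group (GL_K n)"
proof -
  interpret ring "ring_mat TYPE(complex fls) n ()" by (rule ring_mat)
  show ?thesis unfolding GL_K_def by (rule units_group)
qed

lemma GL_K_mult: "x \<otimes>\<^bsub>GL_K n\<^esub> y = x * y" and GL_K_one: "\<one>\<^bsub>GL_K n\<^esub> = 1\<^sub>m n"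
  by (simp_all add: GL_K_def units_of_def ring_mat_simps)

lemma GL_K_carrier: "g \<in> carrier (GL_K n) \<Longrightarrow> g \<in> carrier_mat n n"
  by (simp add: GL_K_def units_of_def Units_def ring_mat_simps)

lemma GL_K_inv:
  assumes g: "g \<in> carrier (GL_K n)"
  shows "GL_inv n g \<in> carrier (GL_K n)" "GL_inv n g \<in> carrier_mat n n"
    "GL_inv n g * g = 1\<^sub>m n" "g * GL_inv n g = 1\<^sub>m n"
proof -
  interpret group "GL_K n" by (rule GL_K_group)
  show "GL_inv n g \<in> carrier (GL_K n)" using g by simp
  then show "GL_inv n g \<in> carrier_mat n n" by (rule GL_K_carrier)
  show "GL_inv n g * g = 1\<^sub>m n" using l_inv[OF g] by (simp add: GL_K_mult GL_K_one)
  show "g * GL_inv n g = 1\<^sub>m n" using r_inv[OF g] by (simp add: GL_K_mult GL_K_one)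
qed

lemma GL_K_I:
  assumes A: "A \<in> carrier_mat n n" and B: "B \<in> carrier_mat n n" and AB: "A * B = 1\<^sub>m n"
  shows "A \<in> carrier (GL_K n)" "GL_inv n A = B"
proof -
  interpret group "GL_K n" by (rule GL_K_group)
  have BA: "B * A = 1\<^sub>m n" by (rule mat_mult_left_right_inverse[OF A B AB])
  show A': "A \<in> carrier (GL_K n)"
    using A B AB BA by (auto simp: GL_K_def units_of_def Units_def ring_mat_simps)
  have "B \<in> carrier (GL_K n)"
    using A B AB BA by (auto simp: GL_K_def units_of_def Units_def ring_mat_simps)
  then show "GL_inv n A = B"
    using inv_equality[of B A] A' BA by (simp add: GL_K_mult GL_K_one)
qed

lemma GL_K_inv_vec:
  assumes g: "g \<in> carrier (GL_K n)" and v: "v \<in> carrier_vec n"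
  shows "g *\<^sub>v (GL_inv n g *\<^sub>v v) = v" "GL_inv n g *\<^sub>v (g *\<^sub>v v) = v"
  using assoc_mult_mat_vec[OF GL_K_carrier[OF g] GL_K_inv(2)[OF g] v]
    assoc_mult_mat_vec[OF GL_K_inv(2)[OF g] GL_K_carrier[OF g] v] GL_K_inv[OF g] v by simp_all

lemma int_mat_one: "1\<^sub>m n \<in> int_mat n"
  by (rule int_matI) (simp_all add: int_ring_0 int_ring_1)

lemma mult_mat_index:
  assumes "X \<in> carrier_mat n n" "Z \<in> carrier_mat n n" "i < n" "j < n"
  shows "(X * Z) $$ (i, j) = (\<Sum>k<n. X $$ (i, k) * Z $$ (k, j))"
  using assms by (auto simp: scalar_prod_def atLeast0LessThan)

lemma int_mat_mult:
  assumes X: "X \<in> int_mat n" and Z: "Z \<in> int_mat n"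
  shows "X * Z \<in> int_mat n"
proof (rule int_matI)
  show "X * Z \<in> carrier_mat n n" using int_mat_carrier[OF X] int_mat_carrier[OF Z] by simp
  show "(X * Z) $$ (i, j) \<in> int_ring" if "i < n" "j < n" for i j
    unfolding mult_mat_index[OF int_mat_carrier[OF X] int_mat_carrier[OF Z] that]
    by (rule int_ring_sum) (simp add: int_ring_mult int_mat_index[OF X] int_mat_index[OF Z] that)
qed

lemma mult_mat_unit_vec:
  assumes X: "X \<in> carrier_mat n n" and i: "i < n" and j: "j < n"
  shows "(X *\<^sub>v unit_vec n j) $ i = (X $$ (i, j) :: complex fls)"
proof -
  have "(X *\<^sub>v unit_vec n j) $ i = (\<Sum>k<n. if k = j then X $$ (i, k) else 0)"
    unfolding mult_mat_vec_index[OF X unit_vec_carrier i] using j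
    by (intro sum.cong) (auto simp: unit_vec_def)
  then show ?thesis using j by simp
qed

subsection \<open>The anti-transpose\<close>

text \<open>The residue pairing \<open>(a, b) \<mapsto>\<close> coefficient of \<open>y^(n-1)\<close> in \<open>ab\<close> is perfect on \<open>O\<^sub>C\<close> and has the
  antidiagonal permutation matrix as its Gram matrix; the anti-transpose is the adjoint with respect to it.
  In particular \<open>Y\<close> is fixed, being multiplication by \<open>y\<close>.\<close>

definition anti_transpose :: "nat \<Rightarrow> complex fls mat \<Rightarrow> complex fls mat" where
  "anti_transpose n A = mat n n (\<lambda>(i, j). A $$ (n - Suc j, n - Suc i))"

lemma anti_transpose_carrier: "anti_transpose n A \<in> carrier_mat n n"
  by (simp add: anti_transpose_def)

lemma anti_transpose_index:
  "i < n \<Longrightarrow> j < n \<Longrightarrow> anti_transpose n A $$ (i, j) = A $$ (n - Suc j, n - Suc i)"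
  by (simp add: anti_transpose_def)

lemma anti_transpose_mult:
  assumes A: "A \<in> carrier_mat n n" and B: "B \<in> carrier_mat n n"
  shows "anti_transpose n (A * B) = anti_transpose n B * anti_transpose n A"
proof (rule eq_matI)
  fix i j assume "i < dim_row (anti_transpose n B * anti_transpose n A)"
    and "j < dim_col (anti_transpose n B * anti_transpose n A)"
  then have i: "i < n" and j: "j < n" by (simp_all add: anti_transpose_def)
  have "(anti_transpose n B * anti_transpose n A) $$ (i, j) =
      (\<Sum>k<n. B $$ (n - Suc k, n - Suc i) * A $$ (n - Suc j, n - Suc k))"
    unfolding mult_mat_index[OF anti_transpose_carrier anti_transpose_carrier i j] using i j
    by (intro sum.cong) (simp_all add: anti_transpose_index)
  also have "\<dots> = (\<Sum>k<n. B $$ (k, n - Suc i) * A $$ (n - Suc j, k))"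
    by (rule sum.nat_diff_reindex[where g = "\<lambda>k. B $$ (k, n - Suc i) * A $$ (n - Suc j, k)"])
  also have "\<dots> = (A * B) $$ (n - Suc j, n - Suc i)"
    using i j by (subst mult_mat_index[OF A B]) (simp_all add: mult.commute)
  finally show "anti_transpose n (A * B) $$ (i, j) = (anti_transpose n B * anti_transpose n A) $$ (i, j)"
    using i j by (simp add: anti_transpose_index)
qed (simp_all add: anti_transpose_def)

lemma anti_transpose_one: "anti_transpose n (1\<^sub>m n) = 1\<^sub>m n"
  by (rule eq_matI) (auto simp: anti_transpose_def)

lemma anti_transpose_invol: "A \<in> carrier_mat n n \<Longrightarrow> anti_transpose n (anti_transpose n A) = A"
  by (rule eq_matI) (auto simp: anti_transpose_def)

lemma anti_transpose_Y: "anti_transpose n (Y_mat m n) = Y_mat m n"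
  by (rule eq_matI) (auto simp: anti_transpose_def Y_mat_def)

lemma anti_transpose_int: "A \<in> int_mat n \<Longrightarrow> anti_transpose n A \<in> int_mat n"
  by (rule int_matI) (simp_all add: anti_transpose_carrier anti_transpose_index int_mat_index)

text \<open>Reflection in the antidiagonal sends \<open>(i, j)\<close> to
  \<open>(n - Suc j, n - Suc i)\<close> and so keeps the order of the two indices. The ordinary
  transpose would exchange lower and upper triangular matrices.\<close>

lemma anti_transpose_Iwahori_algebra: "A \<in> Iwahori_algebra n \<Longrightarrow> anti_transpose n A \<in> Iwahori_algebra n"
  unfolding Iwahori_algebra_def by (simp add: anti_transpose_int anti_transpose_index)

lemma anti_transpose_GL_K:
  assumes g: "g \<in> carrier (GL_K n)"
  shows "anti_transpose n g \<in> carrier (GL_K n)"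
    "GL_inv n (anti_transpose n g) = anti_transpose n (GL_inv n g)"
proof -
  have "anti_transpose n g * anti_transpose n (GL_inv n g) = 1\<^sub>m n"
    using anti_transpose_mult[OF GL_K_inv(2)[OF g] GL_K_carrier[OF g]] GL_K_inv(3)[OF g]
    by (simp add: anti_transpose_one)
  then show "anti_transpose n g \<in> carrier (GL_K n)"
    "GL_inv n (anti_transpose n g) = anti_transpose n (GL_inv n g)"
    using GL_K_I[OF anti_transpose_carrier anti_transpose_carrier] by blast+
qed

subsection \<open>The standard flag\<close>

text \<open>The periodic chain from C[[\<epsilon>]]^n at \<open>j = 0\<close> down to \<epsilon>
  C[[\<epsilon>]]^n at \<open>j = n\<close>. The vanishing coordinates are the first ones because
  \<open>Iwahori_algebra\<close> is lower triangular at \<epsilon> = 0.\<close>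

definition std_lattice :: "nat \<Rightarrow> nat \<Rightarrow> complex fls vec set" where
  "std_lattice n j = {v \<in> int_vec n. \<forall>i<n. i < j \<longrightarrow> fls_nth (v $ i) 0 = 0}"

text \<open>For invertible \<open>h\<close> this is the image of the standard flag under
  \<open>h\<close>. Testing membership with the inverse makes it a condition on coordinates.\<close>

definition lattice_flag :: "nat \<Rightarrow> complex fls mat \<Rightarrow> nat \<Rightarrow> complex fls vec set" where
  "lattice_flag n h j = {v \<in> carrier_vec n. GL_inv n h *\<^sub>v v \<in> std_lattice n j}"

lemma std_lattice_0: "std_lattice n 0 = int_vec n"
  by (simp add: std_lattice_def)

lemma std_lattice_int: "v \<in> std_lattice n j \<Longrightarrow> v \<in> int_vec n"
  by (simp add: std_lattice_def)

lemma std_lattice_subspace: "cx_subspace n (std_lattice n j)"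
  unfolding cx_subspace_def
  by (auto simp: std_lattice_def int_vec_carrier int_vec_0 int_vec_add int_vec_smult[OF int_ring_const] int_vec_dim)

lemma std_lattice_smult: "r \<in> int_ring \<Longrightarrow> v \<in> std_lattice n j \<Longrightarrow> r \<cdot>\<^sub>v v \<in> std_lattice n j"
proof -
  assume r: "r \<in> int_ring" and v: "v \<in> std_lattice n j"
  note vi = std_lattice_int[OF v]
  have "fls_nth ((r \<cdot>\<^sub>v v) $ i) 0 = 0" if "i < n" "i < j" for i
    using that v fls_nth_mult_int_0[OF r int_vec_index[OF vi that(1)]]
    by (simp add: int_vec_dim[OF vi] std_lattice_def)
  then show ?thesis using int_vec_smult[OF r vi] by (simp add: std_lattice_def)
qed

lemma std_lattice_quotient:
  assumes j: "j \<le> n"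
  shows "quotient_map (int_vec n) j (std_lattice n j) (\<lambda>v. vec j (\<lambda>i. fls_nth (v $ i) 0))"
  unfolding quotient_map_def
proof (intro conjI ballI allI)
  show "(\<lambda>v. vec j (\<lambda>i. fls_nth (v $ i) 0)) ` int_vec n = carrier_vec j"
  proof
    show "carrier_vec j \<subseteq> (\<lambda>v. vec j (\<lambda>i. fls_nth (v $ i) 0)) ` int_vec n"
    proof
      fix u :: "complex vec" assume u: "u \<in> carrier_vec j"
      let ?v = "vec n (\<lambda>i. fls_const (u $ i))"
      have "u = vec j (\<lambda>i. fls_nth (?v $ i) 0)" using u j by (intro eq_vecI) auto
      moreover have "?v \<in> int_vec n" by (rule int_vecI) (simp_all add: int_ring_const)
      ultimately show "u \<in> (\<lambda>v. vec j (\<lambda>i. fls_nth (v $ i) 0)) ` int_vec n" by (rule image_eqI)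
    qed
  qed auto
  show "vec j (\<lambda>i. fls_nth ((a + b) $ i) 0) = vec j (\<lambda>i. fls_nth (a $ i) 0) + vec j (\<lambda>i. fls_nth (b $ i) 0)"
    if "a \<in> int_vec n" "b \<in> int_vec n" for a b
    using that j by (intro eq_vecI) (simp_all add: int_vec_dim)
  show "vec j (\<lambda>i. fls_nth ((fls_const c \<cdot>\<^sub>v a) $ i) 0) = c \<cdot>\<^sub>v vec j (\<lambda>i. fls_nth (a $ i) 0)"
    if "a \<in> int_vec n" for a c
    using that j by (intro eq_vecI) (simp_all add: int_vec_dim)
  show "{a \<in> int_vec n. vec j (\<lambda>i. fls_nth (a $ i) 0) = 0\<^sub>v j} = std_lattice n j"
    using j by (auto simp: std_lattice_def dest: vec_eq_0D intro!: eq_vecI)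
qed

text \<open>In the constant term of a coordinate \<open>i < j\<close>, the summand at
  \<open>k\<close> vanishes because of \<open>v\<close> if \<open>k < j\<close>, and because of
  \<open>X\<close> if \<open>i < j \<le> k\<close>.\<close>

lemma Iwahori_algebra_std_lattice:
  assumes X: "X \<in> Iwahori_algebra n" and v: "v \<in> std_lattice n j"
  shows "X *\<^sub>v v \<in> std_lattice n j"
proof -
  have Xi: "X \<in> int_mat n" and X0: "\<And>i k. i < n \<Longrightarrow> k < n \<Longrightarrow> i < k \<Longrightarrow> fls_nth (X $$ (i, k)) 0 = 0"
    using X by (auto simp: Iwahori_algebra_def)
  have vi: "v \<in> int_vec n" and v0: "\<And>k. k < n \<Longrightarrow> k < j \<Longrightarrow> fls_nth (v $ k) 0 = 0"
    using v by (auto simp: std_lattice_def)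
  have "fls_nth ((X *\<^sub>v v) $ i) 0 = 0" if i: "i < n" "i < j" for i
  proof -
    have "fls_nth ((X *\<^sub>v v) $ i) 0 = (\<Sum>k<n. fls_nth (X $$ (i, k)) 0 * fls_nth (v $ k) 0)"
      unfolding mult_mat_vec_index[OF int_mat_carrier[OF Xi] int_vec_carrier[OF vi] i(1)] fls_nth_sum
      by (rule sum.cong) (simp_all add: fls_nth_mult_int_0 int_mat_index[OF Xi i(1)] int_vec_index[OF vi])
    also have "\<dots> = 0"
    proof (rule sum.neutral, rule ballI)
      fix k assume "k \<in> {..<n}"
      then show "fls_nth (X $$ (i, k)) 0 * fls_nth (v $ k) 0 = 0"
        using v0[of k] X0[of i k] i by (cases "k < j") auto
    qed
    finally show ?thesis .
  qed
  then show ?thesis using int_mat_mult_vec[OF Xi vi] by (simp add: std_lattice_def)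
qed

lemma unit_vec_std_lattice: "j < n \<Longrightarrow> unit_vec n j \<in> std_lattice n j"
  unfolding std_lattice_def
  by (auto simp: unit_vec_def int_ring_0 int_ring_1 intro!: int_vecI simp del: range_eqI)

text \<open>Converse of \<open>Iwahori_algebra_std_lattice\<close>, tested on the columns only: the
  Iwahori algebra consists of all matrices that preserve the standard flag.\<close>

lemma Iwahori_algebraI:
  assumes X: "X \<in> carrier_mat n n" and st: "\<And>j. j < n \<Longrightarrow> X *\<^sub>v unit_vec n j \<in> std_lattice n j"
  shows "X \<in> Iwahori_algebra n"
proof -
  have "X $$ (i, j) \<in> int_ring" if i: "i < n" and j: "j < n" for i j
    using int_vec_index[OF std_lattice_int[OF st[OF j]] i] mult_mat_unit_vec[OF X i j] by simp
  then have "X \<in> int_mat n" using X by (intro int_matI)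
  moreover have "fls_nth (X $$ (i, j)) 0 = 0" if i: "i < n" and j: "j < n" and "i < j" for i j
  proof -
    have "fls_nth ((X *\<^sub>v unit_vec n j) $ i) 0 = 0"
      using st[OF j] that by (simp add: std_lattice_def)
    then show ?thesis using mult_mat_unit_vec[OF X i j] by simp
  qed
  ultimately show ?thesis by (simp add: Iwahori_algebra_def)
qed

lemma Iwahori_algebra_carrier: "X \<in> Iwahori_algebra n \<Longrightarrow> X \<in> carrier_mat n n"
  by (simp add: Iwahori_algebra_def int_mat_def)

lemma Iwahori_algebra_mult:
  assumes X: "X \<in> Iwahori_algebra n" and Z: "Z \<in> Iwahori_algebra n"
  shows "X * Z \<in> Iwahori_algebra n"
proof (rule Iwahori_algebraI)
  note Xc = Iwahori_algebra_carrier[OF X] and Zc = Iwahori_algebra_carrier[OF Z]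
  show "X * Z \<in> carrier_mat n n" using Xc Zc by simp
  show "X * Z *\<^sub>v unit_vec n j \<in> std_lattice n j" if "j < n" for j
    unfolding assoc_mult_mat_vec[OF Xc Zc unit_vec_carrier]
    by (intro Iwahori_algebra_std_lattice X Z unit_vec_std_lattice that)
qed

lemma lattice_flag_iff:
  assumes h: "h \<in> carrier (GL_K n)" and v: "v \<in> carrier_vec n"
  shows "h *\<^sub>v v \<in> lattice_flag n h j \<longleftrightarrow> v \<in> std_lattice n j"
  unfolding lattice_flag_def
  using GL_K_inv_vec(2)[OF h v] mult_mat_vec_carrier[OF GL_K_carrier[OF h] v] by simp

text \<open>Transport of structure along \<open>h\<close>. The submodule \<open>N\<close> is
  arbitrary because the lemma serves both for the standard flag and for the lattice complementary to
  that of \<open>h\<close>.\<close>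

lemma lattice_flag_quotient:
  assumes h: "h \<in> carrier (GL_K n)" and q: "quotient_map (int_vec n) s N q"
  shows "quotient_map (lattice_flag n h 0) s {v \<in> carrier_vec n. GL_inv n h *\<^sub>v v \<in> N}
    (\<lambda>v. q (GL_inv n h *\<^sub>v v))"
proof -
  let ?h = "GL_inv n h"
  have fl: "v \<in> carrier_vec n" "?h *\<^sub>v v \<in> int_vec n" if "v \<in> lattice_flag n h 0" for v
    using that by (simp_all add: lattice_flag_def std_lattice_0)
  show ?thesis
    unfolding quotient_map_def
  proof (intro conjI ballI allI)
    show "(\<lambda>v. q (?h *\<^sub>v v)) ` lattice_flag n h 0 = carrier_vec s"
    proof
      show "carrier_vec s \<subseteq> (\<lambda>v. q (?h *\<^sub>v v)) ` lattice_flag n h 0"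
      proof
        fix u :: "complex vec" assume "u \<in> carrier_vec s"
        then obtain v where v: "v \<in> int_vec n" "u = q v"
          using quotient_mapD(1)[OF q] by (metis imageE)
        have "h *\<^sub>v v \<in> lattice_flag n h 0"
          using lattice_flag_iff[OF h int_vec_carrier[OF v(1)]] v(1) by (simp add: std_lattice_0)
        moreover have "u = q (?h *\<^sub>v (h *\<^sub>v v))"
          using GL_K_inv_vec(2)[OF h int_vec_carrier[OF v(1)]] v(2) by simp
        ultimately show "u \<in> (\<lambda>v. q (?h *\<^sub>v v)) ` lattice_flag n h 0" by blast
      qed
    qed (use quotient_mapD(2)[OF q] fl in blast)
    show "q (?h *\<^sub>v (a + b)) = q (?h *\<^sub>v a) + q (?h *\<^sub>v b)"
      if "a \<in> lattice_flag n h 0" "b \<in> lattice_flag n h 0" for a b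
      using quotient_mapD(3)[OF q] fl[OF that(1)] fl[OF that(2)]
        mult_add_distrib_mat_vec[OF GL_K_inv(2)[OF h]] by simp
    show "q (?h *\<^sub>v (fls_const c \<cdot>\<^sub>v a)) = c \<cdot>\<^sub>v q (?h *\<^sub>v a)" if "a \<in> lattice_flag n h 0" for a c
      using quotient_mapD(4)[OF q] fl[OF that] mult_mat_vec[OF GL_K_inv(2)[OF h]] by simp
    show "{a \<in> lattice_flag n h 0. q (?h *\<^sub>v a) = 0\<^sub>v s} = {v \<in> carrier_vec n. ?h *\<^sub>v v \<in> N}"
      using quotient_mapD(5)[OF q] by (auto simp: lattice_flag_def std_lattice_0)
  qed
qed

lemma lattice_flag_colength:
  assumes h: "h \<in> carrier (GL_K n)" and q: "quotient_map (int_vec n) k (lattice_flag n h 0) q"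
    and j: "j \<le> n"
  obtains q' where "quotient_map (int_vec n) (k + j) (lattice_flag n h j) q'"
  using quotient_map_compose[OF int_vec_subspace q lattice_flag_quotient[OF h std_lattice_quotient[OF j]]]
  unfolding lattice_flag_def[of n h j, symmetric] by blast

lemma Iwahori_subgroup: "subgroup (Iwahori n) (GL_K n)"
proof -
  interpret group "GL_K n" by (rule GL_K_group)
  show ?thesis
  proof (rule subgroupI)
    show "Iwahori n \<subseteq> carrier (GL_K n)" by (auto simp: Iwahori_def GL_O_def)
    have "\<one>\<^bsub>GL_K n\<^esub> \<in> Iwahori n"
      using int_mat_one[of n] by (auto simp: Iwahori_def GL_O_def Iwahori_algebra_def GL_K_one)
        (metis GL_K_one one_closed, metis GL_K_one inv_one)
    then show "Iwahori n \<noteq> {}" by blast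
    show "a \<otimes>\<^bsub>GL_K n\<^esub> b \<in> Iwahori n" if a: "a \<in> Iwahori n" and b: "b \<in> Iwahori n" for a b
    proof -
      have ac: "a \<in> carrier (GL_K n)" and bc: "b \<in> carrier (GL_K n)"
        using a b by (auto simp: Iwahori_def GL_O_def)
      have "GL_inv n (a \<otimes>\<^bsub>GL_K n\<^esub> b) = GL_inv n b * GL_inv n a"
        using inv_mult_group[OF ac bc] by (simp add: GL_K_mult)
      moreover have "a \<otimes>\<^bsub>GL_K n\<^esub> b \<in> carrier (GL_K n)" using ac bc by simp
      ultimately show ?thesis
        using a b by (simp add: Iwahori_def GL_O_def GL_K_mult int_mat_mult Iwahori_algebra_mult)
    qed
    show "GL_inv n a \<in> Iwahori n" if a: "a \<in> Iwahori n" for a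
    proof -
      have ac: "a \<in> carrier (GL_K n)" and ai: "a \<in> int_mat n" and ii: "GL_inv n a \<in> int_mat n"
        and aI: "a \<in> Iwahori_algebra n"
        using a by (auto simp: Iwahori_def GL_O_def)
      have int: "lattice_flag n a 0 = int_vec n"
      proof
        show "lattice_flag n a 0 \<subseteq> int_vec n"
          using int_mat_mult_vec[OF ai] GL_K_inv_vec(1)[OF ac]
          by (fastforce simp: lattice_flag_def std_lattice_0)
        show "int_vec n \<subseteq> lattice_flag n a 0"
          using int_mat_mult_vec[OF ii] by (auto simp: lattice_flag_def std_lattice_0 int_vec_carrier)
      qed
      \<comment> \<open>The image of the j-th standard lattice under \<open>a\<close> lies in it and
        has the same codimension j, so the two agree; this is what lets the inverse preserve the
        standard flag.\<close>
      have eq: "lattice_flag n a j = std_lattice n j" if j: "j \<le> n" for j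
      proof (rule quotient_map_same_kernel[OF int_vec_subspace std_lattice_quotient[OF j]])
        show "quotient_map (int_vec n) j (lattice_flag n a j)
            (\<lambda>v. vec j (\<lambda>i. fls_nth ((GL_inv n a *\<^sub>v v) $ i) 0))"
          using lattice_flag_quotient[OF ac std_lattice_quotient[OF j]]
          unfolding int lattice_flag_def[of n a j, symmetric] .
        show "lattice_flag n a j \<subseteq> std_lattice n j"
        proof
          fix v assume v: "v \<in> lattice_flag n a j"
          then have "a *\<^sub>v (GL_inv n a *\<^sub>v v) \<in> std_lattice n j"
            by (intro Iwahori_algebra_std_lattice[OF aI]) (simp add: lattice_flag_def)
          then show "v \<in> std_lattice n j" using GL_K_inv_vec(1)[OF ac] v by (simp add: lattice_flag_def)
        qed
      qed
      have "GL_inv n a \<in> Iwahori_algebra n"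
      proof (rule Iwahori_algebraI)
        show "GL_inv n a \<in> carrier_mat n n" by (rule GL_K_inv(2)[OF ac])
        show "GL_inv n a *\<^sub>v unit_vec n j \<in> std_lattice n j" if "j < n" for j
        proof -
          have "unit_vec n j \<in> lattice_flag n a j"
            using unit_vec_std_lattice[OF that] eq[of j] that by simp
          then show ?thesis by (simp add: lattice_flag_def)
        qed
      qed
      then show ?thesis using ac ai ii by (simp add: Iwahori_def GL_O_def)
    qed
  qed
qed

section \<open>Pole orders and coefficients of products\<close>

text \<open>The range of summation is given by lower bounds \<open>a\<close>, \<open>b\<close>
  instead of the subdegrees. In a family the subdegrees jump, whereas with uniform bounds the
  coefficient of a product is one fixed polynomial expression.\<close>

lemma fls_mult_nth_conv:
  fixes x y :: "complex fls"
  assumes x: "\<And>i. i < a \<Longrightarrow> fls_nth x i = 0" and y: "\<And>i. i < b \<Longrightarrow> fls_nth y i = 0"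
  shows "fls_nth (x * y) l = (\<Sum>i = a..l - b. fls_nth x i * fls_nth y (l - i))"
proof -
  let ?t = "\<lambda>i. fls_nth x i * fls_nth y (l - i)"
  let ?U = "{min a (fls_subdegree x)..max (l - b) (l - fls_subdegree y)}"
  have "fls_nth (x * y) l = sum ?t {fls_subdegree x..l - fls_subdegree y}"
    by (rule fls_times_nth(2))
  also have "\<dots> = sum ?t ?U"
  proof (rule sum.mono_neutral_left)
    show "\<forall>i\<in>?U - {fls_subdegree x..l - fls_subdegree y}. ?t i = 0"
    proof
      fix i assume "i \<in> ?U - {fls_subdegree x..l - fls_subdegree y}"
      then have "i < fls_subdegree x \<or> l - i < fls_subdegree y" by auto
      then show "?t i = 0" by auto
    qed
  qed auto
  also have "\<dots> = sum ?t {a..l - b}"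
  proof (rule sum.mono_neutral_right)
    show "\<forall>i\<in>?U - {a..l - b}. ?t i = 0"
    proof
      fix i assume "i \<in> ?U - {a..l - b}"
      then have "i < a \<or> l - i < b" by auto
      then show "?t i = 0" using x[of i] y[of "l - i"] by auto
    qed
  qed auto
  finally show ?thesis .
qed

lemma fls_mult_nth_vanish:
  fixes x y :: "complex fls"
  assumes "\<And>i. i < a \<Longrightarrow> fls_nth x i = 0" "\<And>i. i < b \<Longrightarrow> fls_nth y i = 0" "l < a + b"
  shows "fls_nth (x * y) l = 0"
  using fls_mult_nth_conv[of a x b y l, OF assms(1,2)] assms(3) by simp

lemma fls_X_power_mult_nth: "fls_nth (fls_X ^ d * (x :: complex fls)) l = fls_nth x (l - int d)"
  by (simp add: fls_X_power_times_conv_shift)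

definition power_lattice :: "nat \<Rightarrow> nat \<Rightarrow> complex fls vec set" where
  "power_lattice n d = {v \<in> int_vec n. \<forall>i<n. \<forall>l<int d. fls_nth (v $ i) l = 0}"

text \<open>The coordinate with index \<open>i * d + l\<close> is the coefficient of \<epsilon>^l in
  the i-th entry, for \<open>l < d\<close>.\<close>

lemma power_lattice_quotient:
  "quotient_map (int_vec n) (n * d) (power_lattice n d)
     (\<lambda>v. vec (n * d) (\<lambda>r. fls_nth (v $ (r div d)) (int (r mod d))))"
proof -
  let ?q = "\<lambda>v. vec (n * d) (\<lambda>r. fls_nth (v $ (r div d)) (int (r mod d)))"
  have rd: "r div d < n" if "r < n * d" for r using that by (simp add: less_mult_imp_div_less)
  show ?thesis
    unfolding quotient_map_def
  proof (intro conjI ballI allI)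
    show "?q ` int_vec n = carrier_vec (n * d)"
    proof
      show "carrier_vec (n * d) \<subseteq> ?q ` int_vec n"
      proof
        fix u :: "complex vec" assume u: "u \<in> carrier_vec (n * d)"
        let ?v = "vec n (\<lambda>i. fps_to_fls (Abs_fps (\<lambda>l. u $ (i * d + l))))"
        have "u = ?q ?v" using u rd by (intro eq_vecI) auto
        moreover have "?v \<in> int_vec n" by (rule int_vecI) simp_all
        ultimately show "u \<in> ?q ` int_vec n" by (rule image_eqI)
      qed
    qed auto
    show "?q (a + b) = ?q a + ?q b" if "a \<in> int_vec n" "b \<in> int_vec n" for a b
      using that rd by (intro eq_vecI) (simp_all add: int_vec_dim)
    show "?q (fls_const c \<cdot>\<^sub>v a) = c \<cdot>\<^sub>v ?q a" if "a \<in> int_vec n" for a c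
      using that rd by (intro eq_vecI) (simp_all add: int_vec_dim)
    show "{a \<in> int_vec n. ?q a = 0\<^sub>v (n * d)} = power_lattice n d"
    proof (intro equalityI subsetI)
      fix a assume "a \<in> {a \<in> int_vec n. ?q a = 0\<^sub>v (n * d)}"
      then have a: "a \<in> int_vec n" and z: "?q a = 0\<^sub>v (n * d)" by simp_all
      have "fls_nth (a $ i) l = 0" if i: "i < n" and l: "l < int d" for i l
      proof (cases "l < 0")
        case True
        then show ?thesis using int_vec_index[OF a i] by (simp add: int_ring_iff)
      next
        case False
        then have l': "nat l < d" "int (nat l) = l" using l by simp_all
        have "i * d + nat l < Suc i * d" using l' by simp
        also have "\<dots> \<le> n * d" using i by (intro mult_right_mono) auto
        finally have "i * d + nat l < n * d" .
        from vec_eq_0D[OF z this] show ?thesis using l' by simp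
      qed
      then show "a \<in> power_lattice n d" using a by (simp add: power_lattice_def)
    next
      fix a assume "a \<in> power_lattice n d"
      then have a: "a \<in> int_vec n" and z: "\<And>i l. i < n \<Longrightarrow> l < int d \<Longrightarrow> fls_nth (a $ i) l = 0"
        by (simp_all add: power_lattice_def)
      have "?q a = 0\<^sub>v (n * d)"
      proof (rule eq_vecI)
        fix r assume "r < dim_vec (0\<^sub>v (n * d))"
        then have r: "r < n * d" by simp
        then have "d > 0" by (cases d) auto
        then show "?q a $ r = 0\<^sub>v (n * d) $ r" using z[OF rd[OF r], of "int (r mod d)"] r by simp
      qed simp
      then show "a \<in> {a \<in> int_vec n. ?q a = 0\<^sub>v (n * d)}" using a by simp
    qed
  qed
qed

lemma power_lattice_iff:
  "v \<in> power_lattice n d \<longleftrightarrow> (\<exists>w\<in>int_vec n. v = fls_X ^ d \<cdot>\<^sub>v w)"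
proof
  assume v: "v \<in> power_lattice n d"
  then have vi: "v \<in> int_vec n" and z: "\<And>i l. i < n \<Longrightarrow> l < int d \<Longrightarrow> fls_nth (v $ i) l = 0"
    by (simp_all add: power_lattice_def)
  let ?w = "vec n (\<lambda>i. fls_shift (int d) (v $ i))"
  have "?w \<in> int_vec n" by (rule int_vecI) (simp_all add: int_ring_iff z)
  moreover have "v = fls_X ^ d \<cdot>\<^sub>v ?w"
    using int_vec_dim[OF vi] by (intro eq_vecI) (auto simp: fls_X_power_times_conv_shift)
  ultimately show "\<exists>w\<in>int_vec n. v = fls_X ^ d \<cdot>\<^sub>v w" by blast
next
  assume "\<exists>w\<in>int_vec n. v = fls_X ^ d \<cdot>\<^sub>v w"
  then obtain w where w: "w \<in> int_vec n" "v = fls_X ^ d \<cdot>\<^sub>v w" by blast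
  have "fls_nth (w $ i) l = 0" if "i < n" "l < 0" for i l
    using int_vec_index[OF w(1) that(1)] that(2) by (simp add: int_ring_iff)
  then show "v \<in> power_lattice n d"
    using w int_vec_smult[OF int_ring_X_power w(1)]
    by (simp add: power_lattice_def int_vec_dim[OF w(1)] fls_X_power_mult_nth)
qed

definition poles_bounded :: "nat \<Rightarrow> nat \<Rightarrow> complex fls mat \<Rightarrow> bool" where
  "poles_bounded n d X \<longleftrightarrow> (\<forall>i<n. \<forall>j<n. \<forall>l < - int d. fls_nth (X $$ (i, j)) l = 0)"

lemma poles_bounded_exists: "\<exists>d. poles_bounded n d X"
proof -
  let ?s = "\<lambda>i j. nat (- fls_subdegree (X $$ (i, j)))"
  \<comment> \<open>Only some common bound is wanted, and the sum of all pole orders dominates each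
    of them.\<close>
  let ?d = "\<Sum>i<n. \<Sum>j<n. ?s i j"
  have "fls_nth (X $$ (i, j)) l = 0" if "i < n" "j < n" "l < - int ?d" for i j l
  proof -
    have "?s i j \<le> (\<Sum>j<n. ?s i j)" by (rule member_le_sum) (use that in auto)
    also have "\<dots> \<le> ?d" by (rule member_le_sum[of i _ "\<lambda>i. \<Sum>j<n. ?s i j"]) (use that in auto)
    finally have "l < fls_subdegree (X $$ (i, j))" using that(3) by linarith
    then show ?thesis by simp
  qed
  then show ?thesis unfolding poles_bounded_def by blast
qed

lemma poles_bounded_mult_vec:
  assumes X: "X \<in> carrier_mat n n" and d: "poles_bounded n d X" and v: "v \<in> power_lattice n (d + e)"
  shows "X *\<^sub>v v \<in> power_lattice n e"
proof -
  have vi: "v \<in> int_vec n" and z: "\<And>i l. i < n \<Longrightarrow> l < int (d + e) \<Longrightarrow> fls_nth (v $ i) l = 0"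
    using v by (simp_all add: power_lattice_def)
  have z': "fls_nth ((X *\<^sub>v v) $ i) l = 0" if i: "i < n" and l: "l < int e" for i l
  proof -
    have "fls_nth (X $$ (i, j) * v $ j) l = 0" if j: "j < n" for j
      by (rule fls_mult_nth_vanish[of "- int d" _ "int (d + e)"])
        (use d i j l z in \<open>auto simp: poles_bounded_def\<close>)
    then show ?thesis
      unfolding mult_mat_vec_index[OF X int_vec_carrier[OF vi] i] fls_nth_sum by simp
  qed
  have "X *\<^sub>v v \<in> int_vec n"
    by (rule int_vecI) (use X z' in \<open>auto simp: int_ring_iff simp del: range_eqI\<close>)
  then show ?thesis using z' by (simp add: power_lattice_def)
qed

lemma lattice_flag_int:
  assumes h: "h \<in> carrier (GL_K n)" and hi: "h \<in> int_mat n"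
  shows "lattice_flag n h j \<subseteq> int_vec n"
proof
  fix v assume "v \<in> lattice_flag n h j"
  then have v: "v \<in> carrier_vec n" "GL_inv n h *\<^sub>v v \<in> int_vec n"
    by (auto simp: lattice_flag_def std_lattice_def)
  then show "v \<in> int_vec n" using int_mat_mult_vec[OF hi v(2)] GL_K_inv_vec(1)[OF h v(1)] by simp
qed

text \<open>Positions of the coefficients whose vanishing describes \<open>std_lattice n j\<close>:
  all principal parts, and for the first \<open>j\<close> entries also the constant terms. The set
  is infinite if \<open>n > 0\<close>.\<close>

definition flag_functionals :: "nat \<Rightarrow> nat \<Rightarrow> (nat \<times> int) set" where
  "flag_functionals n j = {(i, l). i < n \<and> l < (if i < j then 1 else 0)}"

lemma std_lattice_iff_functionals:
  assumes v: "v \<in> carrier_vec n"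
  shows "v \<in> std_lattice n j \<longleftrightarrow> (\<forall>(i, l)\<in>flag_functionals n j. fls_nth (v $ i) l = 0)"
proof
  assume v: "v \<in> std_lattice n j"
  have "fls_nth (v $ i) l = 0" if i: "i < n" and l: "l < (if i < j then 1 else 0)" for i l
  proof (cases "l < 0")
    case True
    then show ?thesis using int_vec_index[OF std_lattice_int[OF v] i] by (simp add: int_ring_iff)
  next
    case False
    then have "l = 0" "i < j" using l by (auto split: if_splits)
    then show ?thesis using v i by (simp add: std_lattice_def)
  qed
  then show "\<forall>(i, l)\<in>flag_functionals n j. fls_nth (v $ i) l = 0" by (auto simp: flag_functionals_def)
next
  assume z: "\<forall>(i, l)\<in>flag_functionals n j. fls_nth (v $ i) l = 0"
  then have z': "fls_nth (v $ i) l = 0" if "i < n" "l < (if i < j then 1 else 0)" for i l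
    using that by (auto simp: flag_functionals_def)
  have "v \<in> int_vec n"
    using v z' by (intro int_vecI) (auto simp: int_ring_iff simp del: range_eqI)
  then show "v \<in> std_lattice n j" using z' by (simp add: std_lattice_def)
qed

text \<open>The poles of the inverse of \<open>h\<close> are bounded, so all these functionals
  vanish on a fixed multiple \<epsilon>^e C[[\<epsilon>]]^n of finite codimension; finitely many of
  them then suffice. In particular the lattice has finite colength.\<close>

lemma lattice_flag_select:
  assumes h: "h \<in> carrier (GL_K n)" and sub: "lattice_flag n h j \<subseteq> int_vec n"
  obtains s e where "\<And>r. r < s \<Longrightarrow> e r \<in> flag_functionals n j"
    "quotient_map (int_vec n) s (lattice_flag n h j)
      (\<lambda>v. vec s (\<lambda>r. fls_nth ((GL_inv n h *\<^sub>v v) $ fst (e r)) (snd (e r))))"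
proof -
  let ?h = "GL_inv n h"
  let ?\<phi> = "\<lambda>p v. fls_nth ((?h *\<^sub>v v) $ fst p) (snd p)"
  note hc = GL_K_inv(2)[OF h]
  obtain d where d: "poles_bounded n d ?h" using poles_bounded_exists by blast
  have add: "?\<phi> p (a + b) = ?\<phi> p a + ?\<phi> p b"
    if "p \<in> flag_functionals n j" "a \<in> int_vec n" "b \<in> int_vec n" for p a b
    using mult_add_distrib_mat_vec[OF hc int_vec_carrier[OF that(2)] int_vec_carrier[OF that(3)]]
      that(1) hc by (auto simp: flag_functionals_def)
  have sc: "?\<phi> p (fls_const c \<cdot>\<^sub>v a) = c * ?\<phi> p a"
    if "p \<in> flag_functionals n j" "a \<in> int_vec n" for p c a
    using mult_mat_vec[OF hc int_vec_carrier[OF that(2)]] that(1) hc by (auto simp: flag_functionals_def)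
  \<comment> \<open>One power more than the pole order \<open>d\<close> is needed, since some of the
    functionals read constant terms.\<close>
  have M0: "?\<phi> p a = 0" if "p \<in> flag_functionals n j" "a \<in> power_lattice n (d + 1)" for p a
    using poles_bounded_mult_vec[OF hc d that(2)] that(1)
    by (auto simp: power_lattice_def flag_functionals_def split: if_splits)
  obtain s e where e: "\<And>r. r < s \<Longrightarrow> e r \<in> flag_functionals n j"
    "quotient_map (int_vec n) s {a \<in> int_vec n. \<forall>p\<in>flag_functionals n j. ?\<phi> p a = 0}
      (\<lambda>v. vec s (\<lambda>r. ?\<phi> (e r) v))"
    by (rule select_functionals[where \<phi> = ?\<phi> and I = "flag_functionals n j",
          OF int_vec_subspace _ _ power_lattice_quotient[of n "d + 1"]])
      (use add sc M0 in blast)+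
  have "{a \<in> int_vec n. \<forall>p\<in>flag_functionals n j. ?\<phi> p a = 0} = lattice_flag n h j"
  proof -
    have "?h *\<^sub>v a \<in> std_lattice n j \<longleftrightarrow> (\<forall>p\<in>flag_functionals n j. ?\<phi> p a = 0)"
      if "a \<in> carrier_vec n" for a
      using std_lattice_iff_functionals[OF mult_mat_vec_carrier[OF hc that], of j] by auto
    then show ?thesis using sub int_vec_carrier by (fastforce simp: lattice_flag_def)
  qed
  then show ?thesis using e by (intro that[of s e]) simp_all
qed

text \<open>Meaningful as soon as some quotient map exists; \<open>quotient_map_le\<close>, used in
  both directions, then makes the value unique.\<close>

definition colength :: "nat \<Rightarrow> complex fls vec set \<Rightarrow> nat" where
  "colength n M = (THE s. \<exists>q. quotient_map (int_vec n) s M q)"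

lemma colength_eq: "quotient_map (int_vec n) s M q \<Longrightarrow> colength n M = s"
  unfolding colength_def
  by (rule the_equality) (auto intro: antisym quotient_map_le[OF int_vec_subspace _ _ subset_refl])

lemma lattice_flag_antimono: "i \<le> j \<Longrightarrow> lattice_flag n h j \<subseteq> lattice_flag n h i"
  by (auto simp: lattice_flag_def std_lattice_def)

lemma std_lattice_n: "std_lattice n n = power_lattice n 1"
proof -
  have "v \<in> power_lattice n 1" if v: "v \<in> std_lattice n n" for v
  proof -
    have "fls_nth (v $ i) l = 0" if "i < n" "l < int 1" for i l
    proof (cases "l = 0")
      case False
      then have "l < 0" using that by linarith
      then show ?thesis using int_vec_index[OF std_lattice_int[OF v] that(1)] by (simp add: int_ring_iff)
    qed (use v that in \<open>simp add: std_lattice_def\<close>)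
    then show ?thesis using std_lattice_int[OF v] by (simp add: power_lattice_def)
  qed
  moreover have "power_lattice n 1 \<subseteq> std_lattice n n"
    by (auto simp: std_lattice_def power_lattice_def)
  ultimately show ?thesis by blast
qed

text \<open>An integral vector with vanishing constant terms is divisible by \<epsilon>. This
  periodicity corresponds to the last condition on a flag of ideals, closing it up by multiplication
  with x.\<close>

lemma lattice_flag_n:
  assumes h: "h \<in> carrier (GL_K n)"
  shows "lattice_flag n h n = (\<lambda>v. fls_X \<cdot>\<^sub>v v) ` lattice_flag n h 0"
proof
  note hc = GL_K_inv(2)[OF h]
  show "(\<lambda>v. fls_X \<cdot>\<^sub>v v) ` lattice_flag n h 0 \<subseteq> lattice_flag n h n"
    using mult_mat_vec[OF hc] power_lattice_iff[of _ n 1]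
    by (auto simp: lattice_flag_def std_lattice_n std_lattice_0)
  show "lattice_flag n h n \<subseteq> (\<lambda>v. fls_X \<cdot>\<^sub>v v) ` lattice_flag n h 0"
  proof
    fix v assume v: "v \<in> lattice_flag n h n"
    then have vc: "v \<in> carrier_vec n" by (simp add: lattice_flag_def)
    obtain w where w: "w \<in> int_vec n" "GL_inv n h *\<^sub>v v = fls_X \<cdot>\<^sub>v w"
      using v power_lattice_iff[of _ n 1] by (auto simp: lattice_flag_def std_lattice_n)
    have "v = h *\<^sub>v (fls_X \<cdot>\<^sub>v w)" using GL_K_inv_vec(1)[OF h vc] w(2) by simp
    also have "\<dots> = fls_X \<cdot>\<^sub>v (h *\<^sub>v w)" by (rule mult_mat_vec[OF GL_K_carrier[OF h] int_vec_carrier[OF w(1)]])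
    finally have "v = fls_X \<cdot>\<^sub>v (h *\<^sub>v w)" .
    moreover have "h *\<^sub>v w \<in> lattice_flag n h 0"
      using lattice_flag_iff[OF h int_vec_carrier[OF w(1)]] w(1) by (simp add: std_lattice_0)
    ultimately show "v \<in> (\<lambda>v. fls_X \<cdot>\<^sub>v v) ` lattice_flag n h 0" by blast
  qed
qed

text \<open>The flag of \<open>h\<close> then consists of Y-stable sublattices of C[[\<epsilon>]]^n,
  which correspond to ideals of O_C.\<close>

definition admissible :: "nat \<Rightarrow> nat \<Rightarrow> complex fls mat \<Rightarrow> bool" where
  "admissible m n h \<longleftrightarrow> h \<in> carrier (GL_K n) \<and> h \<in> int_mat n \<and>
     GL_inv n h * Y_mat m n * h \<in> Iwahori_algebra n"

lemma conj_mult_vec: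
  assumes g: "g \<in> carrier (GL_K n)" and Z: "Z \<in> carrier_mat n n" and v: "v \<in> carrier_vec n"
  shows "GL_inv n g *\<^sub>v (Z *\<^sub>v v) = (GL_inv n g * Z * g) *\<^sub>v (GL_inv n g *\<^sub>v v)"
proof -
  note gc = GL_K_carrier[OF g] and ic = GL_K_inv(2)[OF g]
  have "(GL_inv n g * Z * g) *\<^sub>v (GL_inv n g *\<^sub>v v) = (GL_inv n g * Z) *\<^sub>v (g *\<^sub>v (GL_inv n g *\<^sub>v v))"
    by (rule assoc_mult_mat_vec[OF mult_carrier_mat[OF ic Z] gc mult_mat_vec_carrier[OF ic v]])
  also have "\<dots> = GL_inv n g *\<^sub>v (Z *\<^sub>v v)"
    unfolding GL_K_inv_vec(1)[OF g v] by (rule assoc_mult_mat_vec[OF ic Z v])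
  finally show ?thesis ..
qed

lemma admissible_Y_submodule:
  assumes a: "admissible m n h"
  shows "Y_submodule m n (lattice_flag n h j)"
proof -
  have h: "h \<in> carrier (GL_K n)" and hi: "h \<in> int_mat n"
    and Y: "GL_inv n h * Y_mat m n * h \<in> Iwahori_algebra n"
    using a by (auto simp: admissible_def)
  note hc = GL_K_inv(2)[OF h]
  have z: "GL_inv n h *\<^sub>v 0\<^sub>v n = 0\<^sub>v n"
    by (intro eq_vecI) (use hc in \<open>auto simp: scalar_prod_def intro!: sum.neutral\<close>)
  show ?thesis
    unfolding Y_submodule_def
  proof (intro conjI ballI)
    show "lattice_flag n h j \<subseteq> int_vec n" by (rule lattice_flag_int[OF h hi])
    show "0\<^sub>v n \<in> lattice_flag n h j"
      using cx_subspaceD(2)[OF std_lattice_subspace] z by (simp add: lattice_flag_def)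
    show "v + w \<in> lattice_flag n h j" if "v \<in> lattice_flag n h j" "w \<in> lattice_flag n h j" for v w
      using that cx_subspaceD(3)[OF std_lattice_subspace] mult_add_distrib_mat_vec[OF hc]
      by (simp add: lattice_flag_def)
    show "r \<cdot>\<^sub>v v \<in> lattice_flag n h j" if "r \<in> int_ring" "v \<in> lattice_flag n h j" for r v
      using that(2) std_lattice_smult[OF that(1)] mult_mat_vec[OF hc] by (simp add: lattice_flag_def)
    show "Y_mat m n *\<^sub>v v \<in> lattice_flag n h j" if v: "v \<in> lattice_flag n h j" for v
    proof -
      have vc: "v \<in> carrier_vec n" using v by (simp add: lattice_flag_def)
      then show ?thesis
        using v Iwahori_algebra_std_lattice[OF Y] conj_mult_vec[OF h Y_mat_carrier vc, of m]
          mult_mat_vec_carrier[OF Y_mat_carrier vc, of m]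
        by (simp add: lattice_flag_def)
    qed
  qed
qed

section \<open>Points of the two spaces\<close>

lemma mult_mat_cols_closed:
  assumes c: "c \<in> carrier_vec n" and w: "\<And>i. i < n \<Longrightarrow> w i \<in> carrier_vec n"
    and M0: "0\<^sub>v n \<in> M" and Madd: "\<And>a b. a \<in> M \<Longrightarrow> b \<in> M \<Longrightarrow> a + b \<in> M"
    and summand: "\<And>i. i < n \<Longrightarrow> (c $ i :: complex fls) \<cdot>\<^sub>v w i \<in> M"
  shows "mat n n (\<lambda>(r, j). w j $ r) *\<^sub>v c \<in> M"
proof -
  have "vec n (\<lambda>r. \<Sum>i<k. w i $ r * c $ i) \<in> M" if "k \<le> n" for k
    using that
  proof (induction k)
    case 0
    have "vec n (\<lambda>r. \<Sum>i<0::nat. w i $ r * c $ i) = 0\<^sub>v n" by (intro eq_vecI) auto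
    then show ?case using M0 by simp
  next
    case (Suc k)
    have "vec n (\<lambda>r. \<Sum>i<Suc k. w i $ r * c $ i) = vec n (\<lambda>r. \<Sum>i<k. w i $ r * c $ i) + c $ k \<cdot>\<^sub>v w k"
      using w[of k] Suc.prems by (intro eq_vecI) (auto simp: mult.commute)
    then show ?case using Madd[OF Suc.IH summand[of k]] Suc.prems by simp
  qed
  from this[of n] have "vec n (\<lambda>r. \<Sum>i<n. w i $ r * c $ i) \<in> M" by simp
  also have "vec n (\<lambda>r. \<Sum>i<n. w i $ r * c $ i) = mat n n (\<lambda>(r, j). w j $ r) *\<^sub>v c"
    using c by (intro eq_vecI) (auto simp: scalar_prod_def atLeast0LessThan)
  finally show ?thesis .
qed

text \<open>Nakayama: vectors picked from the successive differences of a flag of lattices form an adapted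
  basis of the flag.\<close>

lemma adapted_basis:
  assumes n: "n > 0"
    and M: "\<And>j. j \<le> n \<Longrightarrow> Y_submodule m n (M j)"
    and q: "\<And>j. j \<le> n \<Longrightarrow> quotient_map (int_vec n) (k + j) (M j) (q j)"
    and dec: "\<And>j. j < n \<Longrightarrow> M (Suc j) \<subseteq> M j"
    and Mn: "M n = (\<lambda>v. fls_X \<cdot>\<^sub>v v) ` M 0"
    and w: "\<And>j. j < n \<Longrightarrow> w j \<in> M j" "\<And>j. j < n \<Longrightarrow> w j \<notin> M (Suc j)"
  defines "h \<equiv> mat n n (\<lambda>(r, j). w j $ r)"
  shows "admissible m n h" "\<And>j. j \<le> n \<Longrightarrow> lattice_flag n h j = M j"
proof -
  have Mi: "M j \<subseteq> int_vec n" and M0: "0\<^sub>v n \<in> M j"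
    and Ma: "\<And>a b. a \<in> M j \<Longrightarrow> b \<in> M j \<Longrightarrow> a + b \<in> M j"
    and Ms: "\<And>r a. r \<in> int_ring \<Longrightarrow> a \<in> M j \<Longrightarrow> r \<cdot>\<^sub>v a \<in> M j"
    and MY: "\<And>a. a \<in> M j \<Longrightarrow> Y_mat m n *\<^sub>v a \<in> M j" if "j \<le> n" for j
    using M[OF that] unfolding Y_submodule_def by blast+
  have Msub: "cx_subspace n (M j)" if "j \<le> n" for j
    by (rule quotient_map_kernel_subspace[OF int_vec_subspace q[OF that]])
  have mono: "M j \<subseteq> M i" if "i \<le> j" "j \<le> n" for i j
    using that(1) that(2)
  proof (induction j rule: dec_induct)
    case (step j)
    then show ?case using dec[of j] by auto
  qed simp
  have wi: "w j \<in> int_vec n" if "j < n" for j using w(1)[OF that] Mi[of j] that by auto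
  have wc: "w j \<in> carrier_vec n" if "j < n" for j by (rule int_vec_carrier[OF wi[OF that]])
  have hc: "h \<in> carrier_mat n n" by (simp add: h_def)
  have hu: "h *\<^sub>v unit_vec n j = w j" if "j < n" for j
  proof (rule eq_vecI)
    fix i assume "i < dim_vec (w j)"
    then have "i < n" using wc[OF that] by simp
    then show "(h *\<^sub>v unit_vec n j) $ i = w j $ i"
      using mult_mat_unit_vec[OF hc _ that, of i] that by (simp add: h_def)
  qed (use hc wc[OF that] in simp)
  \<comment> \<open>A coefficient in a position \<open>i < j\<close> is divisible by \<epsilon>, and
    \<epsilon> times any member of \<open>M 0\<close> lies in \<open>M n\<close>, which is contained
    in \<open>M j\<close>. For \<open>i \<ge> j\<close> already \<open>w i\<close> lies in
    \<open>M j\<close>.\<close>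
  have hM: "h *\<^sub>v c \<in> M j" if c: "c \<in> std_lattice n j" and j: "j \<le> n" for c j
    unfolding h_def
  proof (rule mult_mat_cols_closed)
    show "c \<in> carrier_vec n" by (rule int_vec_carrier[OF std_lattice_int[OF c]])
    show "c $ i \<cdot>\<^sub>v w i \<in> M j" if i: "i < n" for i
    proof (cases "i < j")
      case True
      have ci: "c $ i \<in> int_ring" by (rule int_vec_index[OF std_lattice_int[OF c] i])
      have "fls_nth (c $ i) l = 0" if "l < 1" for l
        using ci c i True that unfolding int_ring_iff std_lattice_def
        by (cases "l = 0") auto
      then have "fls_shift 1 (c $ i) \<in> int_ring" by (simp add: int_ring_iff)
      moreover have "c $ i = fls_X * fls_shift 1 (c $ i)" by (simp add: fls_X_times_conv_shift)
      ultimately obtain c' where c': "c' \<in> int_ring" "c $ i = fls_X * c'" by blast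
      have "w i \<in> M 0" using w(1)[OF i] mono[of 0 i] i by auto
      then have "fls_X \<cdot>\<^sub>v (c' \<cdot>\<^sub>v w i) \<in> M n" using Ms[of 0, OF _ c'(1)] Mn by blast
      then show ?thesis using mono[OF j] c'(2) by (auto simp: smult_smult_assoc)
    next
      case False
      then have "w i \<in> M j" using w(1)[OF i] mono[of j i] i by auto
      then show ?thesis using Ms[OF j int_vec_index[OF std_lattice_int[OF c] i]] by blast
    qed
  qed (use wc M0[OF j] Ma[OF j] in auto)
  \<comment> \<open>The first nonzero constant term of \<open>c\<close> locates \<open>h c\<close>
    exactly in the flag: without the term at \<open>i\<close> the vector would fall into
    \<open>M (Suc i)\<close>, so \<open>h c\<close> in \<open>M (Suc i)\<close> would put a nonzero
    multiple of \<open>w i\<close> there.\<close>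
  have lead: "h *\<^sub>v c \<notin> M (Suc i)"
    if c: "c \<in> std_lattice n i" and i: "i < n" and ne: "fls_nth (c $ i) 0 \<noteq> 0" for c i
  proof
    assume hcM: "h *\<^sub>v c \<in> M (Suc i)"
    have Si: "Suc i \<le> n" using i by simp
    let ?g = "fls_nth (c $ i) 0"
    let ?c = "c + fls_const (- ?g) \<cdot>\<^sub>v unit_vec n i"
    note ci = std_lattice_int[OF c]
    have u: "unit_vec n i \<in> std_lattice n i" by (rule unit_vec_std_lattice[OF i])
    have "?c \<in> std_lattice n i"
      using cx_subspaceD(3,4)[OF std_lattice_subspace] c u by blast
    moreover have "fls_nth (?c $ i) 0 = 0"
      using int_vec_dim[OF ci] i by simp
    ultimately have "?c \<in> std_lattice n (Suc i)"
      by (auto simp: std_lattice_def less_Suc_eq)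
    then have 1: "h *\<^sub>v ?c \<in> M (Suc i)" using hM i by simp
    have "h *\<^sub>v ?c = h *\<^sub>v c + fls_const (- ?g) \<cdot>\<^sub>v w i"
      using mult_add_distrib_mat_vec[OF hc int_vec_carrier[OF ci], of "fls_const (- ?g) \<cdot>\<^sub>v unit_vec n i"]
        mult_mat_vec[OF hc unit_vec_carrier, of "fls_const (- ?g)" i] hu[OF i] by simp
    then have "fls_const (- ?g) \<cdot>\<^sub>v w i = h *\<^sub>v ?c + fls_const (- 1) \<cdot>\<^sub>v (h *\<^sub>v c)"
      using wc[OF i] hc by (intro eq_vecI) auto
    also have "\<dots> \<in> M (Suc i)"
      by (rule cx_subspaceD(3)[OF Msub[OF Si] 1 cx_subspaceD(4)[OF Msub[OF Si] hcM]])
    finally have 2: "fls_const (- ?g) \<cdot>\<^sub>v w i \<in> M (Suc i)" .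
    have "w i \<in> M (Suc i)" by (rule cx_subspace_cancel[OF Msub[OF Si] wc[OF i] _ 2]) (use ne in simp)
    then show False using w(2)[OF i] by blast
  qed
  have first: "\<exists>i<j. c \<in> std_lattice n i \<and> fls_nth (c $ i) 0 \<noteq> 0"
    if c: "c \<in> int_vec n" and nc: "c \<notin> std_lattice n j" and j: "j \<le> n" for c j
  proof -
    let ?P = "\<lambda>i. i < j \<and> fls_nth (c $ i) 0 \<noteq> 0"
    have "\<exists>i. ?P i" using c nc by (auto simp: std_lattice_def)
    then obtain i where i: "?P i" "\<And>i'. i' < i \<Longrightarrow> \<not> ?P i'"
      using exists_least_iff[of ?P] by blast
    then have "fls_nth (c $ i') 0 = 0" if "i' < i" for i' using that by fastforce
    then have "c \<in> std_lattice n i" using c by (simp add: std_lattice_def)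
    then show ?thesis using i(1) by blast
  qed
  have "det h \<noteq> 0"
  proof
    assume "det h = 0"
    then obtain c where c: "c \<in> carrier_vec n" "c \<noteq> 0\<^sub>v n" "h *\<^sub>v c = 0\<^sub>v n"
      using det_0_iff_vec_prod_zero[OF hc] by blast
    let ?S = "{i. i < n \<and> c $ i \<noteq> 0}"
    have ne: "?S \<noteq> {}"
    proof
      assume "?S = {}"
      then have "c = 0\<^sub>v n" using c(1) by (intro eq_vecI) auto
      then show False using c(2) by simp
    qed
    \<comment> \<open>A kernel vector is rescaled by a power of \<epsilon> to be integral with some
      nonzero constant term; then \<open>lead\<close> shows that its image cannot be zero.\<close>
    define e where "e = Min ((\<lambda>i. fls_subdegree (c $ i)) ` ?S)"
    have "e \<in> (\<lambda>i. fls_subdegree (c $ i)) ` ?S" unfolding e_def by (rule Min_in) (use ne in auto)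
    then obtain i0 where i0: "i0 < n" "c $ i0 \<noteq> 0" "fls_subdegree (c $ i0) = e" by auto
    have e: "e \<le> fls_subdegree (c $ i)" if "i < n" "c $ i \<noteq> 0" for i
      unfolding e_def by (rule Min_le) (use that in auto)
    let ?c = "fls_X_intpow (- e) \<cdot>\<^sub>v c"
    have nth: "fls_nth (?c $ i) l = fls_nth (c $ i) (l + e)" if "i < n" for i l
      using that c(1) fls_X_intpow_times_conv_shift(1)[of "- e" "c $ i"] by simp
    have ci: "?c \<in> int_vec n"
    proof (rule int_vecI)
      show "?c $ i \<in> int_ring" if "i < n" for i
        unfolding int_ring_iff
      proof (intro allI impI)
        fix l :: int assume "l < 0"
        then show "fls_nth (?c $ i) l = 0"
          unfolding nth[OF that] using e[OF that] by (cases "c $ i = 0") auto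
      qed
    qed (use c in simp)
    have "fls_nth (?c $ i0) 0 \<noteq> 0" unfolding nth[OF i0(1)]
      using nth_fls_subdegree_nonzero[OF i0(2)] i0(3) by simp
    then have "?c \<notin> std_lattice n n" using i0(1) by (auto simp: std_lattice_def)
    from first[OF ci this] obtain i where i: "i < n" "?c \<in> std_lattice n i" "fls_nth (?c $ i) 0 \<noteq> 0" by auto
    have "h *\<^sub>v ?c = 0\<^sub>v n" unfolding mult_mat_vec[OF hc c(1)] c(3) by (intro eq_vecI) simp_all
    then have "h *\<^sub>v ?c \<in> M (Suc i)" using M0 i(1) by simp
    then show False using lead[OF i(2,1,3)] by blast
  qed
  then have h: "h \<in> carrier (GL_K n)"
    using det_non_zero_imp_unit[OF hc, of "()"] by (simp add: GL_K_def units_of_def)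
  \<comment> \<open>Each passage from \<open>M j\<close> to \<open>M (Suc j)\<close> has codimension
    one and is generated by \<open>w j\<close>, so one scalar multiple of \<open>w j\<close>
    corrects the remainder.\<close>
  have step: "\<exists>c\<in>int_vec n. a + fls_const (- 1) \<cdot>\<^sub>v (h *\<^sub>v c) \<in> M j" if a: "a \<in> M 0" and "j \<le> n" for a j
    using that(2)
  proof (induction j)
    case 0
    have "h *\<^sub>v 0\<^sub>v n = 0\<^sub>v n"
      by (intro eq_vecI) (use hc in \<open>auto simp: scalar_prod_def intro!: sum.neutral\<close>)
    moreover have "a \<in> carrier_vec n" using a Mi[of 0] int_vec_carrier by auto
    ultimately have "a + fls_const (- 1) \<cdot>\<^sub>v (h *\<^sub>v 0\<^sub>v n) = a" by (intro eq_vecI) auto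
    then show ?case using a int_vec_0 by metis
  next
    case (Suc j)
    then obtain c where c: "c \<in> int_vec n" "a + fls_const (- 1) \<cdot>\<^sub>v (h *\<^sub>v c) \<in> M j" by auto
    have j: "j < n" "j \<le> n" "Suc j \<le> n" using Suc.prems by auto
    have qS: "quotient_map (int_vec n) (Suc (k + j)) (M (Suc j)) (q (Suc j))" using q[OF j(3)] by simp
    obtain g where g: "a + fls_const (- 1) \<cdot>\<^sub>v (h *\<^sub>v c) + fls_const g \<cdot>\<^sub>v w j \<in> M (Suc j)"
      by (rule quotient_map_codim_one[OF int_vec_subspace q[OF j(2)] qS dec[OF j(1)] w(1)[OF j(1)] w(2)[OF j(1)] c(2)])
    let ?c = "c + fls_const (- g) \<cdot>\<^sub>v unit_vec n j"
    have uc: "fls_const (- g) \<cdot>\<^sub>v unit_vec n j \<in> int_vec n"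
      by (rule int_vec_smult[OF int_ring_const std_lattice_int[OF unit_vec_std_lattice[OF j(1)]]])
    have "h *\<^sub>v ?c = h *\<^sub>v c + fls_const (- g) \<cdot>\<^sub>v w j"
      using mult_add_distrib_mat_vec[OF hc int_vec_carrier[OF c(1)] int_vec_carrier[OF uc]]
        mult_mat_vec[OF hc unit_vec_carrier, of "fls_const (- g)" j] hu[OF j(1)] by simp
    then have "a + fls_const (- 1) \<cdot>\<^sub>v (h *\<^sub>v ?c) = a + fls_const (- 1) \<cdot>\<^sub>v (h *\<^sub>v c) + fls_const g \<cdot>\<^sub>v w j"
      using a Mi[of 0] wc[OF j(1)] hc by (intro eq_vecI) (auto simp: int_vec_dim)
    then show ?case using g int_vec_add[OF c(1) uc] by metis
  qed
  \<comment> \<open>After a full round of \<open>n\<close> corrections the remainder lies in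
    \<open>M n\<close>, that is, it is \<epsilon> times an element of \<open>M 0\<close>, and the
    procedure can be repeated.\<close>
  have approx: "\<exists>c\<in>int_vec n. \<exists>b\<in>M 0. a = h *\<^sub>v c + fls_X ^ d \<cdot>\<^sub>v b" if "a \<in> M 0" for a d
  proof (induction d)
    case 0
    have "h *\<^sub>v 0\<^sub>v n = 0\<^sub>v n"
      by (intro eq_vecI) (use hc in \<open>auto simp: scalar_prod_def intro!: sum.neutral\<close>)
    moreover have "a \<in> carrier_vec n" using that Mi[of 0] int_vec_carrier by auto
    ultimately have "a = h *\<^sub>v 0\<^sub>v n + fls_X ^ 0 \<cdot>\<^sub>v a" by simp
    then show ?case using that int_vec_0 by blast
  next
    case (Suc d)
    then obtain c b where c: "c \<in> int_vec n" and b: "b \<in> M 0" and a: "a = h *\<^sub>v c + fls_X ^ d \<cdot>\<^sub>v b" by blast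
    obtain c' where c': "c' \<in> int_vec n" "b + fls_const (- 1) \<cdot>\<^sub>v (h *\<^sub>v c') \<in> M n" using step[OF b, of n] by blast
    then obtain b' where b': "b' \<in> M 0" "b + fls_const (- 1) \<cdot>\<^sub>v (h *\<^sub>v c') = fls_X \<cdot>\<^sub>v b'" using Mn by auto
    have bc: "b \<in> carrier_vec n" "b' \<in> carrier_vec n" using b b'(1) Mi[of 0] int_vec_carrier by auto
    have "b = h *\<^sub>v c' + (b + fls_const (- 1) \<cdot>\<^sub>v (h *\<^sub>v c'))" using hc bc by (intro eq_vecI) auto
    then have b_eq: "b = h *\<^sub>v c' + fls_X \<cdot>\<^sub>v b'" unfolding b'(2) .
    have dc: "fls_X ^ d \<cdot>\<^sub>v c' \<in> int_vec n" by (rule int_vec_smult[OF int_ring_X_power c'(1)])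
    have "h *\<^sub>v (c + fls_X ^ d \<cdot>\<^sub>v c') = h *\<^sub>v c + fls_X ^ d \<cdot>\<^sub>v (h *\<^sub>v c')"
      using mult_add_distrib_mat_vec[OF hc int_vec_carrier[OF c] int_vec_carrier[OF dc]]
        mult_mat_vec[OF hc int_vec_carrier[OF c'(1)]] by simp
    then have "a = h *\<^sub>v (c + fls_X ^ d \<cdot>\<^sub>v c') + fls_X ^ Suc d \<cdot>\<^sub>v b'"
      unfolding a b_eq using hc bc by (intro eq_vecI) (auto simp: algebra_simps)
    then show ?case using int_vec_add[OF c dc] b'(1) by blast
  qed
  have inv_int: "GL_inv n h *\<^sub>v a \<in> int_vec n" if a: "a \<in> M 0" for a
  proof -
    note ic = GL_K_inv(2)[OF h]
    \<comment> \<open>No limit is taken: the remainder of order \<open>d\<close> is already made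
      integral by the inverse of \<open>h\<close>, whose poles have order at most
      \<open>d\<close>.\<close>
    obtain d where d: "poles_bounded n d (GL_inv n h)" using poles_bounded_exists by blast
    obtain c b where c: "c \<in> int_vec n" and b: "b \<in> M 0" and a: "a = h *\<^sub>v c + fls_X ^ d \<cdot>\<^sub>v b"
      using approx[OF a] by blast
    have bi: "b \<in> int_vec n" using b Mi[of 0] by auto
    have "fls_X ^ d \<cdot>\<^sub>v b \<in> power_lattice n (d + 0)" using power_lattice_iff bi by auto
    from poles_bounded_mult_vec[OF ic d this]
    have "GL_inv n h *\<^sub>v (fls_X ^ d \<cdot>\<^sub>v b) \<in> int_vec n" by (simp add: power_lattice_def)
    moreover have "GL_inv n h *\<^sub>v a = c + GL_inv n h *\<^sub>v (fls_X ^ d \<cdot>\<^sub>v b)"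
      unfolding a using mult_add_distrib_mat_vec[OF ic mult_mat_vec_carrier[OF hc int_vec_carrier[OF c]]]
        int_vec_carrier[OF bi] GL_K_inv_vec(2)[OF h int_vec_carrier[OF c]] by simp
    ultimately show ?thesis using int_vec_add[OF c] by simp
  qed
  show flag: "lattice_flag n h j = M j" if j: "j \<le> n" for j
  proof
    show "lattice_flag n h j \<subseteq> M j"
    proof
      fix v assume "v \<in> lattice_flag n h j"
      then have "v \<in> carrier_vec n" "GL_inv n h *\<^sub>v v \<in> std_lattice n j" by (auto simp: lattice_flag_def)
      then show "v \<in> M j" using hM[OF _ j] GL_K_inv_vec(1)[OF h] by metis
    qed
    show "M j \<subseteq> lattice_flag n h j"
    proof
      fix v assume v: "v \<in> M j"
      have vc: "v \<in> carrier_vec n" using v Mi[OF j] int_vec_carrier by blast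
      have ci: "GL_inv n h *\<^sub>v v \<in> int_vec n" using inv_int v mono[of 0 j] j by auto
      have "GL_inv n h *\<^sub>v v \<in> std_lattice n j"
      proof (rule ccontr)
        assume "GL_inv n h *\<^sub>v v \<notin> std_lattice n j"
        from first[OF ci this j] obtain i where i: "i < j" "GL_inv n h *\<^sub>v v \<in> std_lattice n i"
          "fls_nth ((GL_inv n h *\<^sub>v v) $ i) 0 \<noteq> 0" by auto
        \<comment> \<open>A nonzero constant term at some \<open>i < j\<close> would keep
          \<open>v\<close> out of \<open>M (Suc i)\<close>, which contains
          \<open>M j\<close>.\<close>
        have "h *\<^sub>v (GL_inv n h *\<^sub>v v) \<notin> M (Suc i)" by (rule lead[OF i(2) _ i(3)]) (use i j in simp)
        then show False using GL_K_inv_vec(1)[OF h vc] v mono[of "Suc i" j] i(1) j by auto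
      qed
      then show "v \<in> lattice_flag n h j" using vc by (simp add: lattice_flag_def)
    qed
  qed
  show "admissible m n h"
    unfolding admissible_def
  proof (intro conjI h)
    show "h \<in> int_mat n"
    proof (rule int_matI[OF hc])
      fix i j assume "i < n" "j < n"
      then show "h $$ (i, j) \<in> int_ring" using int_vec_index[OF wi, of j i] by (simp add: h_def)
    qed
    show "GL_inv n h * Y_mat m n * h \<in> Iwahori_algebra n"
    proof (rule Iwahori_algebraI)
      note ic = GL_K_inv(2)[OF h]
      show "GL_inv n h * Y_mat m n * h \<in> carrier_mat n n" using ic Y_mat_carrier[of m n] hc by simp
      fix j assume j: "j < n"
      have "GL_inv n h * Y_mat m n * h *\<^sub>v unit_vec n j = GL_inv n h *\<^sub>v (Y_mat m n *\<^sub>v w j)"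
        using assoc_mult_mat_vec[OF mult_carrier_mat[OF ic Y_mat_carrier] hc unit_vec_carrier, of m j]
          assoc_mult_mat_vec[OF ic Y_mat_carrier wc[OF j]] hu[OF j] by simp
      moreover have "Y_mat m n *\<^sub>v w j \<in> lattice_flag n h j"
        using MY[of j] w(1)[OF j] flag[of j] j by simp
      ultimately show "GL_inv n h * Y_mat m n * h *\<^sub>v unit_vec n j \<in> std_lattice n j"
        by (simp add: lattice_flag_def)
    qed
  qed
qed

section \<open>Duality on cosets and the Springer condition\<close>

definition dual_mat :: "nat \<Rightarrow> complex fls mat \<Rightarrow> complex fls mat" where
  "dual_mat n g = anti_transpose n (GL_inv n g)"

lemma dual_mat:
  assumes g: "g \<in> carrier (GL_K n)"
  shows "dual_mat n g \<in> carrier (GL_K n)" "GL_inv n (dual_mat n g) = anti_transpose n g"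
    "dual_mat n (dual_mat n g) = g"
proof -
  interpret group "GL_K n" by (rule GL_K_group)
  note i = GL_K_inv(1)[OF g]
  show "dual_mat n g \<in> carrier (GL_K n)" unfolding dual_mat_def by (rule anti_transpose_GL_K(1)[OF i])
  show inv: "GL_inv n (dual_mat n g) = anti_transpose n g"
    unfolding dual_mat_def anti_transpose_GL_K(2)[OF i] using inv_inv[OF g] by simp
  show "dual_mat n (dual_mat n g) = g"
    unfolding dual_mat_def[of n "dual_mat n g"] inv by (rule anti_transpose_invol[OF GL_K_carrier[OF g]])
qed

lemma anti_transpose_Iwahori:
  assumes X: "X \<in> Iwahori n"
  shows "anti_transpose n X \<in> Iwahori n"
  using X anti_transpose_GL_K[of X n]
  by (simp add: Iwahori_def GL_O_def anti_transpose_int anti_transpose_Iwahori_algebra)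

lemma Iwahori_coset_eq_iff:
  assumes g: "g \<in> carrier (GL_K n)" and g': "g' \<in> carrier (GL_K n)"
  shows "Icoset n g = Icoset n g' \<longleftrightarrow> GL_inv n g * g' \<in> Iwahori n"
proof -
  interpret group "GL_K n" by (rule GL_K_group)
  interpret I: subgroup "Iwahori n" "GL_K n" by (rule Iwahori_subgroup)
  show ?thesis
    using lcos_self[OF g' Iwahori_subgroup] I.lcos_module_imp[OF GL_K_group g, of g']
      I.lcos_module_rev[OF GL_K_group g g'] l_repr_independence[OF _ g Iwahori_subgroup, of g']
    by (auto simp: GL_K_mult)
qed

text \<open>The Iwahori subgroup is the stabilizer of the standard flag, so a flag determines its
  representative up to right multiplication by that subgroup.\<close>

lemma lattice_flag_eq_iff:
  assumes h: "h \<in> carrier (GL_K n)" and h': "h' \<in> carrier (GL_K n)"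
  shows "(\<forall>j\<le>n. lattice_flag n h j = lattice_flag n h' j) \<longleftrightarrow> GL_inv n h * h' \<in> Iwahori n"
proof -
  interpret group "GL_K n" by (rule GL_K_group)
  let ?i = "\<lambda>g. GL_inv n g"
  have alg: "?i h * h' \<in> Iwahori_algebra n"
    if fl: "\<forall>j\<le>n. lattice_flag n h j = lattice_flag n h' j"
      and h: "h \<in> carrier (GL_K n)" and h': "h' \<in> carrier (GL_K n)" for h h'
  proof (rule Iwahori_algebraI)
    note c = GL_K_inv(2)[OF h] GL_K_carrier[OF h']
    show "?i h * h' \<in> carrier_mat n n" using c by simp
    fix j assume j: "j < n"
    have "h' *\<^sub>v unit_vec n j \<in> lattice_flag n h' j"
      using lattice_flag_iff[OF h' unit_vec_carrier] unit_vec_std_lattice[OF j] by blast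
    then have "h' *\<^sub>v unit_vec n j \<in> lattice_flag n h j" using fl j by simp
    then have "?i h *\<^sub>v (h' *\<^sub>v unit_vec n j) \<in> std_lattice n j" by (simp add: lattice_flag_def)
    then show "?i h * h' *\<^sub>v unit_vec n j \<in> std_lattice n j"
      using assoc_mult_mat_vec[OF c unit_vec_carrier] by simp
  qed
  have inv: "?i (?i h * h') = ?i h' * h"
    using inv_mult_group[of "?i h" h'] h h' by (simp add: GL_K_mult)
  have cl: "?i h * h' \<in> carrier (GL_K n)"
    using m_closed[of "?i h" h'] h h' by (simp add: GL_K_mult)
  show ?thesis
  proof
    assume fl: "\<forall>j\<le>n. lattice_flag n h j = lattice_flag n h' j"
    then have fl': "\<forall>j\<le>n. lattice_flag n h' j = lattice_flag n h j" by simp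
    \<comment> \<open>Membership in \<open>GL_O\<close> requires integrality of the matrix and of
      its inverse, hence the comparison of the flags in both directions.\<close>
    show "?i h * h' \<in> Iwahori n"
      using alg[OF fl h h'] alg[OF fl' h' h] cl inv
      by (simp add: Iwahori_def GL_O_def Iwahori_algebra_def)
  next
    assume X: "?i h * h' \<in> Iwahori n"
    then have X': "?i h' * h \<in> Iwahori n"
      using subgroup.m_inv_closed[OF Iwahori_subgroup X] inv by simp
    have sub: "lattice_flag n a j \<subseteq> lattice_flag n b j"
      if Z: "?i b * a \<in> Iwahori n" and a: "a \<in> carrier (GL_K n)" and b: "b \<in> carrier (GL_K n)" for a b j
    proof
      fix v assume v: "v \<in> lattice_flag n a j"
      then have vc: "v \<in> carrier_vec n" and st: "?i a *\<^sub>v v \<in> std_lattice n j"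
        by (simp_all add: lattice_flag_def)
      have "?i b *\<^sub>v v = ?i b *\<^sub>v (a *\<^sub>v (?i a *\<^sub>v v))" using GL_K_inv_vec(1)[OF a vc] by simp
      also have "\<dots> = (?i b * a) *\<^sub>v (?i a *\<^sub>v v)"
        by (rule assoc_mult_mat_vec[OF GL_K_inv(2)[OF b] GL_K_carrier[OF a]
              mult_mat_vec_carrier[OF GL_K_inv(2)[OF a] vc], symmetric])
      also have "\<dots> \<in> std_lattice n j"
        by (rule Iwahori_algebra_std_lattice[OF _ st]) (use Z in \<open>simp add: Iwahori_def\<close>)
      finally show "v \<in> lattice_flag n b j" using vc by (simp add: lattice_flag_def)
    qed
    show "\<forall>j\<le>n. lattice_flag n h j = lattice_flag n h' j"
      using sub[OF X h' h] sub[OF X' h h'] by blast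
  qed
qed

text \<open>Inversion and anti-transposition both reverse products and preserve the Iwahori
  subgroup, so their composite carries left cosets to left cosets. The quotient of the two dual
  representatives is the anti-transpose of the original one, with \<open>g\<close> and
  \<open>g'\<close> exchanged.\<close>

lemma coset_eq_iff_dual_flag_eq:
  assumes g: "g \<in> carrier (GL_K n)" and g': "g' \<in> carrier (GL_K n)"
  shows "Icoset n g = Icoset n g' \<longleftrightarrow>
    (\<forall>j\<le>n. lattice_flag n (dual_mat n g) j = lattice_flag n (dual_mat n g') j)"
proof -
  let ?X = "GL_inv n g * g'"
  have Xc: "?X \<in> carrier_mat n n" using GL_K_inv(2)[OF g] GL_K_carrier[OF g'] by simp
  have "GL_inv n (dual_mat n g') * dual_mat n g = anti_transpose n ?X"
    unfolding dual_mat(2)[OF g'] dual_mat_def[of n g]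
    using anti_transpose_mult[OF GL_K_inv(2)[OF g] GL_K_carrier[OF g']] by simp
  moreover have "anti_transpose n ?X \<in> Iwahori n \<longleftrightarrow> ?X \<in> Iwahori n"
    using anti_transpose_Iwahori[of ?X n] anti_transpose_Iwahori[of "anti_transpose n ?X" n]
      anti_transpose_invol[OF Xc] by auto
  ultimately show ?thesis
    using Iwahori_coset_eq_iff[OF g g'] lattice_flag_eq_iff[OF dual_mat(1)[OF g'] dual_mat(1)[OF g]]
    by auto
qed

text \<open>Multiplication by y is self-adjoint for the residue pairing, so dualizing turns the
  Y-stability of a flag into that of the dual flag.\<close>

lemma dual_conj:
  assumes g: "g \<in> carrier (GL_K n)"
  shows "GL_inv n (dual_mat n g) * Y_mat m n * dual_mat n g =
    anti_transpose n (GL_inv n g * Y_mat m n * g)"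
proof -
  note c = GL_K_inv(2)[OF g] Y_mat_carrier[of m n] GL_K_carrier[OF g]
  have "anti_transpose n (GL_inv n g * Y_mat m n * g) =
      anti_transpose n g * (Y_mat m n * anti_transpose n (GL_inv n g))"
    unfolding anti_transpose_mult[OF mult_carrier_mat[OF c(1,2)] c(3)] anti_transpose_mult[OF c(1,2)]
      anti_transpose_Y ..
  also have "\<dots> = anti_transpose n g * Y_mat m n * anti_transpose n (GL_inv n g)"
    by (rule assoc_mult_mat[symmetric, OF anti_transpose_carrier c(2) anti_transpose_carrier])
  finally show ?thesis unfolding dual_mat(2)[OF g] by (simp add: dual_mat_def)
qed

text \<open>\<open>Spr\<close> asks for some suitable representative of the coset, while here
  \<open>g\<close> is arbitrary. The forward direction therefore proves the claim for that
  representative and transfers it to \<open>g\<close> through the common flag.\<close>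

lemma Spr_iff_admissible:
  assumes n: "n > 0" and g: "g \<in> carrier (GL_K n)"
  shows "Icoset n g \<in> Spr m n \<longleftrightarrow> admissible m n (dual_mat n g)"
proof
  assume "Icoset n g \<in> Spr m n"
  then obtain g0 where g0: "g0 \<in> carrier (GL_K n)"
    and eq: "Icoset n g = Icoset n g0"
    and b: "GL_inv n g0 *\<^sub>v unit_vec n 0 \<in> int_vec n"
    and Y: "GL_inv n g0 * Y_mat m n * g0 \<in> Iwahori_algebra n"
    by (auto simp: Spr_def)
  have Yi: "GL_inv n g0 * Y_mat m n * g0 \<in> int_mat n" using Y by (simp add: Iwahori_algebra_def)
  \<comment> \<open>Since b_(i+1) = Y b_i, integrality of the first column of the inverse propagates
    to all columns by the conjugated action of Y.\<close>
  have col: "GL_inv n g0 *\<^sub>v unit_vec n i \<in> int_vec n" if "i < n" for i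
    using that
  proof (induction i)
    case (Suc i)
    have "unit_vec n (Suc i) = Y_mat m n *\<^sub>v unit_vec n i"
    proof (rule eq_vecI)
      fix j assume "j < dim_vec (Y_mat m n *\<^sub>v unit_vec n i)"
      then have "j < n" by (simp add: Y_mat_def)
      then show "unit_vec n (Suc i) $ j = (Y_mat m n *\<^sub>v unit_vec n i) $ j"
        using Suc.prems by (auto simp: Y_mat_mult_vec unit_vec_def)
    qed (simp add: Y_mat_def)
    then show ?case
      using conj_mult_vec[OF g0 Y_mat_carrier unit_vec_carrier, of m i] int_mat_mult_vec[OF Yi] Suc by simp
  qed (use b in simp)
  have "GL_inv n g0 \<in> int_mat n"
  proof (rule int_matI[OF GL_K_inv(2)[OF g0]])
    fix i j assume "i < n" "j < n"
    then show "(GL_inv n g0) $$ (i, j) \<in> int_ring"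
      using int_vec_index[OF col, of j i] mult_mat_unit_vec[OF GL_K_inv(2)[OF g0], of i j] by simp
  qed
  then have d0: "dual_mat n g0 \<in> int_mat n" unfolding dual_mat_def by (rule anti_transpose_int)
  have adm: "admissible m n (dual_mat n g0)"
    unfolding admissible_def dual_conj[OF g0]
    using d0 dual_mat(1)[OF g0] anti_transpose_Iwahori_algebra[OF Y] by blast
  \<comment> \<open>Admissibility can be recovered from the flag alone: the columns of the dual
    matrix lie in its members, and these are integral and Y-stable.\<close>
  have fl: "lattice_flag n (dual_mat n g) j = lattice_flag n (dual_mat n g0) j" if "j \<le> n" for j
    using coset_eq_iff_dual_flag_eq[OF g g0] eq that by blast
  let ?h = "dual_mat n g"
  have h: "?h \<in> carrier (GL_K n)" by (rule dual_mat(1)[OF g])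
  have sub: "Y_submodule m n (lattice_flag n ?h j)" if "j \<le> n" for j
    using admissible_Y_submodule[OF adm] fl[OF that] by simp
  have hu: "?h *\<^sub>v unit_vec n j \<in> lattice_flag n ?h j" if "j < n" for j
    using lattice_flag_iff[OF h unit_vec_carrier] unit_vec_std_lattice[OF that] by blast
  have hi: "?h \<in> int_mat n"
  proof (rule int_matI[OF GL_K_carrier[OF h]])
    fix i j assume ij: "i < n" "j < n"
    then have "?h *\<^sub>v unit_vec n j \<in> int_vec n" using hu[of j] sub[of j] by (auto simp: Y_submodule_def)
    then show "?h $$ (i, j) \<in> int_ring"
      using int_vec_index[OF _ ij(1)] mult_mat_unit_vec[OF GL_K_carrier[OF h] ij] by metis
  qed
  have "GL_inv n ?h * Y_mat m n * ?h \<in> Iwahori_algebra n"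
  proof (rule Iwahori_algebraI)
    note c = GL_K_inv(2)[OF h] Y_mat_carrier[of m n] GL_K_carrier[OF h]
    show "GL_inv n ?h * Y_mat m n * ?h \<in> carrier_mat n n" using c by simp
    fix j assume j: "j < n"
    have "Y_mat m n *\<^sub>v (?h *\<^sub>v unit_vec n j) \<in> lattice_flag n ?h j"
      using hu[OF j] sub[of j] j by (auto simp: Y_submodule_def)
    then have "GL_inv n ?h *\<^sub>v (Y_mat m n *\<^sub>v (?h *\<^sub>v unit_vec n j)) \<in> std_lattice n j"
      by (simp add: lattice_flag_def)
    then show "GL_inv n ?h * Y_mat m n * ?h *\<^sub>v unit_vec n j \<in> std_lattice n j"
      unfolding assoc_mult_mat_vec[OF mult_carrier_mat[OF c(1,2)] c(3) unit_vec_carrier]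
        assoc_mult_mat_vec[OF c(1,2) mult_mat_vec_carrier[OF c(3) unit_vec_carrier]] .
  qed
  then show "admissible m n ?h" using h hi by (simp add: admissible_def)
next
  assume a: "admissible m n (dual_mat n g)"
  have di: "dual_mat n g \<in> int_mat n"
    and dY: "GL_inv n (dual_mat n g) * Y_mat m n * dual_mat n g \<in> Iwahori_algebra n"
    using a by (simp_all add: admissible_def)
  have "GL_inv n g \<in> int_mat n"
    using anti_transpose_int[OF di] anti_transpose_invol[OF GL_K_inv(2)[OF g]] by (simp add: dual_mat_def)
  then have "GL_inv n g *\<^sub>v unit_vec n 0 \<in> int_vec n"
    using int_mat_mult_vec std_lattice_int[OF unit_vec_std_lattice[OF n]] by blast
  moreover have "GL_inv n g * Y_mat m n * g \<in> Iwahori_algebra n"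
    using anti_transpose_Iwahori_algebra[OF dY] unfolding dual_conj[OF g]
    using anti_transpose_invol[of "GL_inv n g * Y_mat m n * g" n]
      GL_K_inv(2)[OF g] Y_mat_carrier[of m n] GL_K_carrier[OF g] by simp
  moreover have "Icoset n g \<in> Fl n" using g by (auto simp: Fl_def LCOSETS_def)
  ultimately show "Icoset n g \<in> Spr m n" using g by (auto simp: Spr_def)
qed

section \<open>Transport between lattices and ideals\<close>

lemma quotient_map_cong:
  assumes V: "cx_subspace n V" and eq: "\<And>v. v \<in> V \<Longrightarrow> q v = q' v"
  shows "quotient_map V s M q \<longleftrightarrow> quotient_map V s M q'"
proof -
  have "q ` V = q' ` V" using eq by (intro image_cong) auto
  moreover have "{a \<in> V. q a = 0\<^sub>v s} = {a \<in> V. q' a = 0\<^sub>v s}" using eq by auto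
  ultimately show ?thesis
    unfolding quotient_map_def using eq cx_subspaceD(3,4)[OF V] by (simp cong: ball_cong)
qed

lemma OC_quotient_map_iff:
  assumes m: "m > 0" and M: "M \<subseteq> int_vec n"
  shows "OC_quotient_map m n s (vec_to_OC m n ` M) q \<longleftrightarrow> quotient_map (int_vec n) s M (\<lambda>v. q (vec_to_OC m n v))"
proof -
  let ?s = "vec_to_OC m n"
  have inj: "inj_on ?s (int_vec n)" and im: "carrier (OC m n) = ?s ` int_vec n"
    using bij_vec_to_OC[OF m, of n] by (auto simp: bij_betw_def)
  have "{a \<in> ?s ` int_vec n. q a = 0\<^sub>v s} = ?s ` {v \<in> int_vec n. q (?s v) = 0\<^sub>v s}" by auto
  then have "{a \<in> ?s ` int_vec n. q a = 0\<^sub>v s} = ?s ` M \<longleftrightarrow> {v \<in> int_vec n. q (?s v) = 0\<^sub>v s} = M"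
    using inj_on_image_eq_iff[OF inj _ M, of "{v \<in> int_vec n. q (?s v) = 0\<^sub>v s}"] by auto
  then show ?thesis
    unfolding OC_quotient_map_def quotient_map_def im
    by (simp add: image_image vec_to_OC_add vec_to_OC_const)
qed

lemma has_colength_image_iff:
  assumes m: "m > 0" and n: "n > 0" and M: "Y_submodule m n M"
  shows "has_colength m n (vec_to_OC m n ` M) s \<longleftrightarrow> (\<exists>q. quotient_map (int_vec n) s M q)"
proof -
  have Mi: "M \<subseteq> int_vec n" using M by (simp add: Y_submodule_def)
  have inj: "inj_on (vec_to_OC m n) (int_vec n)" using bij_vec_to_OC[OF m, of n] by (simp add: bij_betw_def)
  have "(\<exists>q. OC_quotient_map m n s (vec_to_OC m n ` M) q) \<longleftrightarrow> (\<exists>q. quotient_map (int_vec n) s M q)"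
  proof
    assume "\<exists>q. quotient_map (int_vec n) s M q"
    then obtain q where q: "quotient_map (int_vec n) s M q" by blast
    let ?q = "\<lambda>a. q (the_inv_into (int_vec n) (vec_to_OC m n) a)"
    have "quotient_map (int_vec n) s M (\<lambda>v. ?q (vec_to_OC m n v))"
      using q quotient_map_cong[OF int_vec_subspace, of n q "\<lambda>v. ?q (vec_to_OC m n v)" s M]
      by (simp add: the_inv_into_f_f[OF inj])
    then show "\<exists>q. OC_quotient_map m n s (vec_to_OC m n ` M) q"
      using OC_quotient_map_iff[OF m Mi, of s ?q] by blast
  qed (use OC_quotient_map_iff[OF m Mi] in blast)
  then show ?thesis using has_colength_iff[OF Y_submodule_imp_ideal[OF m n M]] by simp
qed

text \<open>Ideals are indexed by colength, lattices by their position in the flag, hence the shift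
  by \<open>k\<close>. The restriction matches the extensional functions in
  \<open>PHilb\<close>.\<close>

definition flag_point ::
    "nat \<Rightarrow> nat \<Rightarrow> complex fls mat \<Rightarrow> nat \<times> (nat \<Rightarrow> complex fps fps set set)" where
  "flag_point m n h = (let k = colength n (lattice_flag n h 0) in
     (k, restrict (\<lambda>s. vec_to_OC m n ` lattice_flag n h (s - k)) {k..k + n}))"

lemma flag_point_cong:
  assumes "\<And>j. j \<le> n \<Longrightarrow> lattice_flag n h j = lattice_flag n h' j"
  shows "flag_point m n h = flag_point m n h'"
  using assms by (auto simp: flag_point_def Let_def fun_eq_iff restrict_def)

lemma lattice_flag_0_quotient:
  assumes h: "h \<in> carrier (GL_K n)" "h \<in> int_mat n"
  obtains q where "quotient_map (int_vec n) (colength n (lattice_flag n h 0)) (lattice_flag n h 0) q"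
proof -
  obtain s e where "quotient_map (int_vec n) s (lattice_flag n h 0)
      (\<lambda>v. vec s (\<lambda>r. fls_nth ((GL_inv n h *\<^sub>v v) $ fst (e r)) (snd (e r))))"
    by (rule lattice_flag_select[OF h(1) lattice_flag_int[OF h, of 0]])
  then show ?thesis using that colength_eq by simp
qed

lemma vec_to_OC_l_coset:
  assumes "M \<subseteq> int_vec n"
  shows "OC_class m n xx <#\<^bsub>OC m n\<^esub> vec_to_OC m n ` M = vec_to_OC m n ` (\<lambda>v. fls_X \<cdot>\<^sub>v v) ` M"
proof -
  have "OC_class m n xx <#\<^bsub>OC m n\<^esub> vec_to_OC m n ` M =
      (\<lambda>v. OC_class m n xx \<otimes>\<^bsub>OC m n\<^esub> vec_to_OC m n v) ` M"
    unfolding l_coset_def by blast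
  also have "\<dots> = (\<lambda>v. vec_to_OC m n (fls_X \<cdot>\<^sub>v v)) ` M"
    by (rule image_cong) (use assms vec_to_OC_X in auto)
  finally show ?thesis by (simp add: image_image)
qed

lemma flag_point_in:
  assumes m: "m > 0" and n: "n > 0" and a: "admissible m n h"
  shows "flag_point m n h \<in> (SIGMA k:UNIV. PHilb m n k)"
proof -
  let ?k = "colength n (lattice_flag n h 0)"
  let ?J = "restrict (\<lambda>s. vec_to_OC m n ` lattice_flag n h (s - ?k)) {?k..?k + n}"
  have h: "h \<in> carrier (GL_K n)" using a by (simp add: admissible_def)
  obtain q where q: "quotient_map (int_vec n) ?k (lattice_flag n h 0) q"
    by (rule lattice_flag_0_quotient[OF h]) (use a in \<open>simp add: admissible_def\<close>)
  have "?J \<in> PHilb m n ?k"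
    unfolding PHilb_def
  proof (intro CollectI conjI ballI)
    show "?J \<in> extensional {?k..?k + n}" by simp
    fix s assume s: "s \<in> {?k..?k + n}"
    show "ideal (?J s) (OC m n)"
      using Y_submodule_imp_ideal[OF m n admissible_Y_submodule[OF a]] s by simp
    obtain q' where "quotient_map (int_vec n) (?k + (s - ?k)) (lattice_flag n h (s - ?k)) q'"
      by (rule lattice_flag_colength[OF h q, of "s - ?k"]) (use s in auto)
    then have "has_colength m n (vec_to_OC m n ` lattice_flag n h (s - ?k)) s"
      using has_colength_image_iff[OF m n admissible_Y_submodule[OF a]] s by auto
    then show "has_colength m n (?J s) s" using s by simp
  next
    fix s assume s: "s \<in> {?k..<?k + n}"
    then show "?J (Suc s) \<subseteq> ?J s"
      using image_mono[OF lattice_flag_antimono[of "s - ?k" "Suc s - ?k" n h], of "vec_to_OC m n"] by auto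
  next
    have "vec_to_OC m n ` lattice_flag n h n = OC_class m n xx <#\<^bsub>OC m n\<^esub> vec_to_OC m n ` lattice_flag n h 0"
      unfolding lattice_flag_n[OF h]
      by (rule vec_to_OC_l_coset[symmetric, OF lattice_flag_int[OF h]]) (use a in \<open>simp add: admissible_def\<close>)
    then show "?J (?k + n) = OC_class m n xx <#\<^bsub>OC m n\<^esub> ?J ?k" by simp
  qed
  then show ?thesis by (simp add: flag_point_def Let_def)
qed

lemma flag_point_inj:
  assumes m: "m > 0" and a: "admissible m n h" "admissible m n h'"
    and eq: "flag_point m n h = flag_point m n h'" and j: "j \<le> n"
  shows "lattice_flag n h j = lattice_flag n h' j"
proof -
  let ?k = "colength n (lattice_flag n h 0)"
  have k: "colength n (lattice_flag n h' 0) = ?k"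
    using arg_cong[OF eq, of fst] by (simp add: flag_point_def Let_def)
  have "snd (flag_point m n h) (?k + j) = snd (flag_point m n h') (?k + j)" using eq by simp
  then have im: "vec_to_OC m n ` lattice_flag n h j = vec_to_OC m n ` lattice_flag n h' j"
    using j by (simp add: flag_point_def Let_def k)
  have "inj_on (vec_to_OC m n) (int_vec n)" using bij_vec_to_OC[OF m, of n] by (simp add: bij_betw_def)
  then show ?thesis
    using inj_on_image_eq_iff[of "vec_to_OC m n" "int_vec n"] im lattice_flag_int[of h n j]
      lattice_flag_int[of h' n j] a by (auto simp: admissible_def)
qed

definition ideal_lattice ::
    "nat \<Rightarrow> nat \<Rightarrow> complex fps fps set set \<Rightarrow> complex fls vec set" where
  "ideal_lattice m n J = {v \<in> int_vec n. vec_to_OC m n v \<in> J}"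

text \<open>Provides the data that \<open>adapted_basis\<close> asks for. The inclusions are strict
  because successive members have different codimensions.\<close>

lemma PHilb_lattices:
  assumes m: "m > 0" and n: "n > 0" and J: "J \<in> PHilb m n k"
  defines "M \<equiv> \<lambda>j. ideal_lattice m n (J (k + j))"
  shows "\<And>j. j \<le> n \<Longrightarrow> Y_submodule m n (M j)"
    "\<And>j. j \<le> n \<Longrightarrow> vec_to_OC m n ` M j = J (k + j)"
    "\<And>j. j \<le> n \<Longrightarrow> \<exists>q. quotient_map (int_vec n) (k + j) (M j) q"
    "\<And>j. j < n \<Longrightarrow> M (Suc j) \<subseteq> M j"
    "M n = (\<lambda>v. fls_X \<cdot>\<^sub>v v) ` M 0"
    "\<And>j. j < n \<Longrightarrow> \<exists>w. w \<in> M j \<and> w \<notin> M (Suc j)"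
proof -
  let ?s = "vec_to_OC m n"
  have inj: "inj_on ?s (int_vec n)" and im: "carrier (OC m n) = ?s ` int_vec n"
    using bij_vec_to_OC[OF m, of n] by (auto simp: bij_betw_def)
  have Jid: "ideal (J (k + j)) (OC m n)" and Jc: "has_colength m n (J (k + j)) (k + j)" if "j \<le> n" for j
    using J that by (auto simp: PHilb_def)
  show Y: "Y_submodule m n (M j)" if "j \<le> n" for j
    unfolding M_def ideal_lattice_def by (rule ideal_imp_Y_submodule[OF m n Jid[OF that]])
  show sM: "?s ` M j = J (k + j)" if "j \<le> n" for j
  proof -
    interpret ideal "J (k + j)" "OC m n" by (rule Jid[OF that])
    have "J (k + j) \<subseteq> ?s ` int_vec n" using a_subset im by simp
    then show ?thesis unfolding M_def ideal_lattice_def by blast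
  qed
  show q: "\<exists>q. quotient_map (int_vec n) (k + j) (M j) q" if "j \<le> n" for j
    using Jc[OF that] has_colength_image_iff[OF m n Y[OF that]] sM[OF that] by simp
  show dec: "M (Suc j) \<subseteq> M j" if "j < n" for j
  proof -
    have "J (Suc (k + j)) \<subseteq> J (k + j)" using J that by (auto simp: PHilb_def)
    then show ?thesis by (auto simp: M_def ideal_lattice_def)
  qed
  show "M n = (\<lambda>v. fls_X \<cdot>\<^sub>v v) ` M 0"
  proof -
    have M0i: "M 0 \<subseteq> int_vec n" by (auto simp: M_def ideal_lattice_def)
    have "J (k + n) = OC_class m n xx <#\<^bsub>OC m n\<^esub> J k" using J by (simp add: PHilb_def)
    also have "\<dots> = ?s ` (\<lambda>v. fls_X \<cdot>\<^sub>v v) ` M 0"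
      using vec_to_OC_l_coset[OF M0i, of m] sM[of 0] by simp
    finally have "?s ` M n = ?s ` (\<lambda>v. fls_X \<cdot>\<^sub>v v) ` M 0" using sM[of n] by simp
    moreover have "M n \<subseteq> int_vec n" by (auto simp: M_def ideal_lattice_def)
    moreover have "(\<lambda>v. fls_X \<cdot>\<^sub>v v) ` M 0 \<subseteq> int_vec n" using M0i int_vec_smult[OF int_ring_X] by auto
    ultimately show ?thesis
      using inj_on_image_eq_iff[OF inj, of "M n" "(\<lambda>v. fls_X \<cdot>\<^sub>v v) ` M 0"] by simp
  qed
  show "\<exists>w. w \<in> M j \<and> w \<notin> M (Suc j)" if j: "j < n" for j
  proof (rule ccontr)
    assume "\<not> ?thesis"
    then have "M j = M (Suc j)" using dec[OF j] by blast
    moreover obtain q1 where q1: "quotient_map (int_vec n) (k + j) (M j) q1" using q[of j] j by auto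
    moreover obtain q2 where q2: "quotient_map (int_vec n) (k + Suc j) (M (Suc j)) q2"
      using q[of "Suc j"] j by auto
    ultimately have "k + Suc j \<le> k + j" using quotient_map_le[OF int_vec_subspace q2 q1] by simp
    then show False by simp
  qed
qed

lemma flag_point_eqI:
  assumes m: "m > 0" and n: "n > 0" and J: "J \<in> PHilb m n k"
    and fl: "\<And>j. j \<le> n \<Longrightarrow> lattice_flag n h j = ideal_lattice m n (J (k + j))"
  shows "flag_point m n h = (k, J)"
proof -
  note L = PHilb_lattices[OF m n J]
  have k: "colength n (lattice_flag n h 0) = k" using L(3)[of 0] fl[of 0] colength_eq by auto
  have "restrict (\<lambda>s. vec_to_OC m n ` lattice_flag n h (s - k)) {k..k + n} = J"
  proof (rule extensionalityI)
    show "J \<in> extensional {k..k + n}" using J by (simp add: PHilb_def)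
    fix s assume "s \<in> {k..k + n}"
    then have "s - k \<le> n" "k + (s - k) = s" "s \<in> {k..k + n}" by auto
    then show "restrict (\<lambda>s. vec_to_OC m n ` lattice_flag n h (s - k)) {k..k + n} s = J s"
      using L(2)[of "s - k"] fl[of "s - k"] by simp
  qed simp
  then show ?thesis by (simp add: flag_point_def Let_def k)
qed

lemma flag_point_surj:
  assumes m: "m > 0" and n: "n > 0" and J: "J \<in> PHilb m n k"
  obtains h where "admissible m n h" "flag_point m n h = (k, J)"
proof -
  note L = PHilb_lattices[OF m n J]
  obtain q where q: "\<And>j. j \<le> n \<Longrightarrow> quotient_map (int_vec n) (k + j) (ideal_lattice m n (J (k + j))) (q j)"
    using L(3) by metis
  obtain w where w: "\<And>j. j < n \<Longrightarrow> w j \<in> ideal_lattice m n (J (k + j))"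
    "\<And>j. j < n \<Longrightarrow> w j \<notin> ideal_lattice m n (J (k + Suc j))"
    using L(6) by metis
  note ab = adapted_basis[of n m "\<lambda>j. ideal_lattice m n (J (k + j))" k q w, OF n L(1) q L(4,5) w]
  show ?thesis using that[OF ab(1) flag_point_eqI[OF m n J ab(2)]] by simp
qed

section \<open>The bijection on points\<close>

definition Spr_to_PHilb ::
    "nat \<Rightarrow> nat \<Rightarrow> complex fls mat set \<Rightarrow> nat \<times> (nat \<Rightarrow> complex fps fps set set)" where
  "Spr_to_PHilb m n P = flag_point m n
     (dual_mat n (SOME g. g \<in> carrier (GL_K n) \<and> P = Icoset n g))"

lemma Spr_to_PHilb_eq:
  assumes g: "g \<in> carrier (GL_K n)"
  shows "Spr_to_PHilb m n (Icoset n g) = flag_point m n (dual_mat n g)"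
proof -
  let ?P = "\<lambda>g'. g' \<in> carrier (GL_K n) \<and> Icoset n g = Icoset n g'"
  have P: "?P (Eps ?P)" by (rule someI[of ?P g]) (use g in simp)
  then have "lattice_flag n (dual_mat n (Eps ?P)) j = lattice_flag n (dual_mat n g) j" if "j \<le> n" for j
    using coset_eq_iff_dual_flag_eq[OF g, of "Eps ?P"] that by simp
  then show ?thesis unfolding Spr_to_PHilb_def by (rule flag_point_cong)
qed

lemma bij_Spr_to_PHilb:
  assumes m: "m > 0" and n: "n > 0"
  shows "bij_betw (Spr_to_PHilb m n) (Spr m n) (SIGMA k:UNIV. PHilb m n k)"
proof -
  have rep: "\<exists>g\<in>carrier (GL_K n). P = Icoset n g \<and> admissible m n (dual_mat n g)"
    if "P \<in> Spr m n" for P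
    using that Spr_iff_admissible[OF n] by (auto simp: Spr_def)
  show ?thesis
  proof (rule bij_betw_imageI)
    show "inj_on (Spr_to_PHilb m n) (Spr m n)"
    proof (rule inj_onI)
      fix P Q assume "P \<in> Spr m n" "Q \<in> Spr m n" and eq: "Spr_to_PHilb m n P = Spr_to_PHilb m n Q"
      then obtain g g' where g: "g \<in> carrier (GL_K n)" "P = Icoset n g" "admissible m n (dual_mat n g)"
        and g': "g' \<in> carrier (GL_K n)" "Q = Icoset n g'" "admissible m n (dual_mat n g')"
        using rep by metis
      have "flag_point m n (dual_mat n g) = flag_point m n (dual_mat n g')"
        using eq Spr_to_PHilb_eq[OF g(1)] Spr_to_PHilb_eq[OF g'(1)] g(2) g'(2) by simp
      then show "P = Q"
        using coset_eq_iff_dual_flag_eq[OF g(1) g'(1)] flag_point_inj[OF m g(3) g'(3)] g(2) g'(2) by blast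
    qed
    show "Spr_to_PHilb m n ` Spr m n = (SIGMA k:UNIV. PHilb m n k)"
    proof
      show "Spr_to_PHilb m n ` Spr m n \<subseteq> (SIGMA k:UNIV. PHilb m n k)"
      proof
        fix x assume "x \<in> Spr_to_PHilb m n ` Spr m n"
        then obtain P where P: "P \<in> Spr m n" "x = Spr_to_PHilb m n P" by blast
        obtain g where g: "g \<in> carrier (GL_K n)" "P = Icoset n g" "admissible m n (dual_mat n g)"
          using rep[OF P(1)] by blast
        show "x \<in> (SIGMA k:UNIV. PHilb m n k)"
          unfolding P(2) g(2) Spr_to_PHilb_eq[OF g(1)] by (rule flag_point_in[OF m n g(3)])
      qed
      show "(SIGMA k:UNIV. PHilb m n k) \<subseteq> Spr_to_PHilb m n ` Spr m n"
      proof
        fix x assume "x \<in> (SIGMA k:UNIV. PHilb m n k)"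
        then obtain k J where x: "x = (k, J)" and J: "J \<in> PHilb m n k" by auto
        obtain h where h: "admissible m n h" "flag_point m n h = (k, J)" using flag_point_surj[OF m n J] by blast
        have hG: "h \<in> carrier (GL_K n)" using h(1) by (simp add: admissible_def)
        let ?g = "dual_mat n h"
        have "Icoset n ?g \<in> Spr m n"
          using Spr_iff_admissible[OF n dual_mat(1)[OF hG]] h(1) dual_mat(3)[OF hG] by simp
        moreover have "Spr_to_PHilb m n (Icoset n ?g) = x"
          using Spr_to_PHilb_eq[OF dual_mat(1)[OF hG]] dual_mat(3)[OF hG] h(2) x by simp
        ultimately show "x \<in> Spr_to_PHilb m n ` Spr m n" by blast
      qed
    qed
  qed
qed

section \<open>Regular families\<close>

lemma poly_fun_power: "f \<in> poly_fun N \<Longrightarrow> (\<lambda>t. f t ^ r) \<in> poly_fun N"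
proof (induction r)
  case 0
  then show ?case using poly_fun.const[of 1 N] by simp
next
  case (Suc r)
  then show ?case using poly_fun.mult[of f N "\<lambda>t. f t ^ r"] by simp
qed

lemma basic_open_mult: "basic_open T (\<lambda>t. f t * g t) \<subseteq> basic_open T f"
  by (auto simp: basic_open_def)

lemma regular_fun_cong:
  assumes "\<And>t. t \<in> basic_open T f \<Longrightarrow> \<phi> t = \<psi> t"
  shows "regular_fun N T f \<phi> \<longleftrightarrow> regular_fun N T f \<psi>"
  using assms by (simp add: regular_fun_def)

lemma regular_funI:
  "a \<in> poly_fun N \<Longrightarrow> (\<And>t. t \<in> basic_open T f \<Longrightarrow> \<phi> t = a t / f t ^ r) \<Longrightarrow> regular_fun N T f \<phi>"
  unfolding regular_fun_def by (intro bexI[of _ a] exI[of _ r]) auto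

lemma regular_fun_const: "regular_fun N T f (\<lambda>_. c)"
  by (rule regular_funI[OF poly_fun.const[of c N], of _ _ _ 0]) simp

lemma regular_fun_add:
  assumes f: "f \<in> poly_fun N" and "regular_fun N T f \<phi>" "regular_fun N T f \<psi>"
  shows "regular_fun N T f (\<lambda>t. \<phi> t + \<psi> t)"
proof -
  obtain a r where a: "a \<in> poly_fun N" "\<And>t. t \<in> basic_open T f \<Longrightarrow> \<phi> t = a t / f t ^ r"
    using assms(2) unfolding regular_fun_def by blast
  obtain b s where b: "b \<in> poly_fun N" "\<And>t. t \<in> basic_open T f \<Longrightarrow> \<psi> t = b t / f t ^ s"
    using assms(3) unfolding regular_fun_def by blast
  let ?c = "\<lambda>t. a t * f t ^ s + b t * f t ^ r"
  have c: "?c \<in> poly_fun N" by (intro poly_fun.add poly_fun.mult a b poly_fun_power f)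
  have "\<phi> t + \<psi> t = ?c t / f t ^ (r + s)" if "t \<in> basic_open T f" for t
  proof -
    have "f t \<noteq> 0" using that by (simp add: basic_open_def)
    then show ?thesis unfolding a(2)[OF that] b(2)[OF that] by (simp add: power_add field_simps)
  qed
  then show ?thesis by (rule regular_funI[OF c])
qed

lemma regular_fun_mult:
  assumes "regular_fun N T f \<phi>" "regular_fun N T f \<psi>"
  shows "regular_fun N T f (\<lambda>t. \<phi> t * \<psi> t)"
proof -
  obtain a r where a: "a \<in> poly_fun N" "\<And>t. t \<in> basic_open T f \<Longrightarrow> \<phi> t = a t / f t ^ r"
    using assms(1) unfolding regular_fun_def by blast
  obtain b s where b: "b \<in> poly_fun N" "\<And>t. t \<in> basic_open T f \<Longrightarrow> \<psi> t = b t / f t ^ s"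
    using assms(2) unfolding regular_fun_def by blast
  have c: "(\<lambda>t. a t * b t) \<in> poly_fun N" by (intro poly_fun.mult a b)
  have "\<phi> t * \<psi> t = a t * b t / f t ^ (r + s)" if "t \<in> basic_open T f" for t
    unfolding a(2)[OF that] b(2)[OF that] by (simp add: power_add)
  then show ?thesis by (rule regular_funI[OF c])
qed

lemma regular_fun_sum:
  assumes f: "f \<in> poly_fun N" and "\<And>i. i \<in> A \<Longrightarrow> regular_fun N T f (\<phi> i)"
  shows "regular_fun N T f (\<lambda>t. \<Sum>i\<in>A. \<phi> i t)"
  using assms(2)
  by (induction A rule: infinite_finite_induct) (simp_all add: regular_fun_const regular_fun_add[OF f])

lemma regular_fun_prod:
  assumes "\<And>i. i \<in> A \<Longrightarrow> regular_fun N T f (\<phi> i)"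
  shows "regular_fun N T f (\<lambda>t. \<Prod>i\<in>A. \<phi> i t)"
  using assms
  by (induction A rule: infinite_finite_induct) (simp_all add: regular_fun_const regular_fun_mult)

lemma regular_fun_uminus: "regular_fun N T f \<phi> \<Longrightarrow> regular_fun N T f (\<lambda>t. - \<phi> t)"
  using regular_fun_mult[OF regular_fun_const[of N T f "- 1"], of \<phi>] by simp

lemma regular_fun_restrict:
  assumes g: "g \<in> poly_fun N" and "regular_fun N T f \<phi>"
  shows "regular_fun N T (\<lambda>t. f t * g t) \<phi>"
proof -
  obtain a r where a: "a \<in> poly_fun N" "\<And>t. t \<in> basic_open T f \<Longrightarrow> \<phi> t = a t / f t ^ r"
    using assms(2) unfolding regular_fun_def by blast
  have c: "(\<lambda>t. a t * g t ^ r) \<in> poly_fun N" by (intro poly_fun.mult a poly_fun_power g)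
  have "\<phi> t = a t * g t ^ r / (f t * g t) ^ r" if t: "t \<in> basic_open T (\<lambda>t. f t * g t)" for t
  proof -
    have "f t \<noteq> 0" "g t \<noteq> 0" using t by (auto simp: basic_open_def)
    then show ?thesis using a(2)[of t] t basic_open_mult[of T f g] by (auto simp: power_mult_distrib)
  qed
  then show ?thesis by (rule regular_funI[OF c])
qed

text \<open>On the locus where the numerator \<open>a\<close> is nonzero, the inverse of
  \<open>a / f ^ r\<close> is \<open>f ^ Suc r / (f * a)\<close>. The extra factor \<open>f\<close>
  is there because denominators on the smaller set are powers of \<open>f * a\<close>.\<close>

lemma regular_fun_inverse:
  assumes f: "f \<in> poly_fun N" and \<phi>: "regular_fun N T f \<phi>" and p: "p \<in> basic_open T f" "\<phi> p \<noteq> 0"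
  obtains g where "g \<in> poly_fun N" "g p \<noteq> 0"
    "\<And>t. t \<in> basic_open T (\<lambda>t. f t * g t) \<Longrightarrow> \<phi> t \<noteq> 0"
    "regular_fun N T (\<lambda>t. f t * g t) (\<lambda>t. 1 / \<phi> t)"
proof -
  obtain a r where a: "a \<in> poly_fun N" "\<And>t. t \<in> basic_open T f \<Longrightarrow> \<phi> t = a t / f t ^ r"
    using \<phi> unfolding regular_fun_def by blast
  have ne: "f t \<noteq> 0" "a t \<noteq> 0" "\<phi> t = a t / f t ^ r" if t: "t \<in> basic_open T (\<lambda>t. f t * a t)" for t
    using t a(2)[of t] basic_open_mult[of T f a] by (auto simp: basic_open_def)
  have c: "(\<lambda>t. f t ^ Suc r) \<in> poly_fun N" by (rule poly_fun_power[OF f])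
  have "1 / \<phi> t = f t ^ Suc r / (f t * a t) ^ 1" if "t \<in> basic_open T (\<lambda>t. f t * a t)" for t
    unfolding ne(3)[OF that] using ne(1,2)[OF that] by simp
  then have "regular_fun N T (\<lambda>t. f t * a t) (\<lambda>t. 1 / \<phi> t)" by (rule regular_funI[OF c])
  moreover have "\<phi> t \<noteq> 0" if "t \<in> basic_open T (\<lambda>t. f t * a t)" for t
    unfolding ne(3)[OF that] using ne(1,2)[OF that] by simp
  moreover have "a p \<noteq> 0" using p a(2)[OF p(1)] by auto
  ultimately show ?thesis using that a(1) by blast
qed

lemma regular_fun_det:
  assumes f: "f \<in> poly_fun N" and a: "\<And>i j. i < s \<Longrightarrow> j < s \<Longrightarrow> regular_fun N T f (a i j)"
  shows "regular_fun N T f (\<lambda>t. det (mat s s (\<lambda>(i, j). a i j t)))"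
proof -
  have "det (mat s s (\<lambda>(i, j). a i j t)) =
      (\<Sum>p\<in>{p. p permutes {0..<s}}. signof p * (\<Prod>i = 0..<s. a i (p i) t))" for t
  proof -
    have "det (mat s s (\<lambda>(i, j). a i j t)) = (\<Sum>p\<in>{p. p permutes {0..<s}}.
        signof p * (\<Prod>i = 0..<s. mat s s (\<lambda>(i, j). a i j t) $$ (i, p i)))"
      by (rule det_def') simp
    also have "\<dots> = (\<Sum>p\<in>{p. p permutes {0..<s}}. signof p * (\<Prod>i = 0..<s. a i (p i) t))"
      by (intro sum.cong arg_cong2[where f = "(*)"] refl prod.cong) (auto dest: permutes_in_image)
    finally show ?thesis .
  qed
  then show ?thesis
    by (auto intro!: regular_fun_sum[OF f] regular_fun_mult regular_fun_const regular_fun_prod a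
        dest: permutes_in_image)
qed

text \<open>By Cramer's rule the solution consists of determinants of regular functions times the
  regular inverse of the main determinant.\<close>

lemma regular_fun_solve:
  assumes f: "f \<in> poly_fun N" and a: "\<And>i j. i < s \<Longrightarrow> j < s \<Longrightarrow> regular_fun N T f (a i j)"
    and b: "\<And>i. i < s \<Longrightarrow> regular_fun N T f (b i)"
    and ne: "\<And>t. t \<in> basic_open T f \<Longrightarrow> det (mat s s (\<lambda>(i, j). a i j t)) \<noteq> 0"
    and inv: "regular_fun N T f (\<lambda>t. 1 / det (mat s s (\<lambda>(i, j). a i j t)))"
  obtains c where "\<And>i. i < s \<Longrightarrow> regular_fun N T f (c i)"
    "\<And>t r. t \<in> basic_open T f \<Longrightarrow> r < s \<Longrightarrow> (\<Sum>i<s. c i t * a r i t) = b r t"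
proof -
  let ?A = "\<lambda>t. mat s s (\<lambda>(i, j). a i j t)"
  let ?B = "\<lambda>k t. mat s s (\<lambda>(i, j). if j = k then b i t else a i j t)"
  define c where "c k t = det (?B k t) * (1 / det (?A t))" for k t
  have "regular_fun N T f (c k)" if "k < s" for k
  proof -
    have "regular_fun N T f (\<lambda>t. det (mat s s (\<lambda>(i, j). (if j = k then b i else a i j) t)))"
      by (rule regular_fun_det[OF f]) (use a b in auto)
    moreover have "(\<lambda>t. det (mat s s (\<lambda>(i, j). (if j = k then b i else a i j) t))) = (\<lambda>t. det (?B k t))"
      by (intro ext arg_cong[where f = det] cong_mat) auto
    ultimately have "regular_fun N T f (\<lambda>t. det (?B k t))" by simp
    then show ?thesis unfolding c_def[abs_def] by (rule regular_fun_mult[OF _ inv])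
  qed
  moreover have "(\<Sum>i<s. c i t * a r i t) = b r t" if t: "t \<in> basic_open T f" and r: "r < s" for t r
  proof -
    have A: "?A t \<in> carrier_mat s s" by simp
    obtain X where X: "X \<in> carrier_mat s s" "?A t * X = 1\<^sub>m s"
      using det_non_zero_imp_unit[OF A ne[OF t], of "()"] by (auto simp: Units_def ring_mat_simps)
    let ?x = "X *\<^sub>v vec s (\<lambda>i. b i t)"
    have x: "?x \<in> carrier_vec s" using X(1) by simp
    have Ax: "?A t *\<^sub>v ?x = vec s (\<lambda>i. b i t)"
      using assoc_mult_mat_vec[OF A X(1), of "vec s (\<lambda>i. b i t)"] X(2) by simp
    have "c k t = ?x $ k" if k: "k < s" for k
    proof -
      have "det (replace_col (?A t) (?A t *\<^sub>v ?x) k) = ?x $ k * det (?A t)"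
        by (rule cramer_lemma_mat[OF A x k])
      moreover have "replace_col (?A t) (?A t *\<^sub>v ?x) k = ?B k t"
        unfolding Ax replace_col_def by (intro eq_matI) auto
      ultimately show ?thesis using ne[OF t] by (simp add: c_def)
    qed
    then have "(\<Sum>i<s. c i t * a r i t) = (\<Sum>i<s. ?A t $$ (r, i) * ?x $ i)"
      using r by (intro sum.cong) (auto simp: mult.commute)
    also have "\<dots> = (?A t *\<^sub>v ?x) $ r" by (rule mult_mat_vec_index[OF A x r, symmetric])
    also have "\<dots> = b r t" unfolding Ax using r by simp
    finally show ?thesis .
  qed
  ultimately show ?thesis by (rule that)
qed

text \<open>A finite intersection of basic open sets is the basic open set of the product;
  \<open>mono\<close> says that the properties survive shrinking.\<close>

lemma locally_finite_conj:
  assumes f: "f \<in> poly_fun N" "f p \<noteq> 0"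
    and mono: "\<And>j f g. P j f \<Longrightarrow> g \<in> poly_fun N \<Longrightarrow> P j (\<lambda>t. f t * g t)"
    and loc: "\<And>j. j < k \<Longrightarrow> \<exists>g\<in>poly_fun N. g p \<noteq> 0 \<and> P j (\<lambda>t. f t * g t)"
  shows "\<exists>g\<in>poly_fun N. g p \<noteq> 0 \<and> (\<forall>j<k. P (j::nat) (\<lambda>t. f t * g t))"
  using loc
proof (induction k)
  case 0
  then show ?case by (intro bexI[OF _ poly_fun.const[of 1 N]]) simp
next
  case (Suc k)
  obtain g where g: "g \<in> poly_fun N" "g p \<noteq> 0" "\<forall>j<k. P j (\<lambda>t. f t * g t)" using Suc by auto
  obtain g' where g': "g' \<in> poly_fun N" "g' p \<noteq> 0" "P k (\<lambda>t. f t * g' t)" using Suc.prems by auto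
  have "P j (\<lambda>t. f t * (g t * g' t))" if "j < Suc k" for j
  proof (cases "j < k")
    case True
    then show ?thesis using mono[OF _ g'(1), of j "\<lambda>t. f t * g t"] g(3) by (simp add: mult.assoc)
  next
    case False
    then have "j = k" using that by simp
    moreover have "(\<lambda>t. f t * g' t * g t) = (\<lambda>t. f t * (g t * g' t))" by (simp add: ac_simps)
    ultimately show ?thesis using mono[OF g'(3) g(1)] by simp
  qed
  then show ?case using poly_fun.mult[OF g(1) g'(1)] g(2) g'(2) by (intro bexI[of _ "\<lambda>t. g t * g' t"]) auto
qed

section \<open>Regular families of matrices\<close>

lemma regular_mat_family_restrict:
  assumes g: "g \<in> poly_fun N" and X: "regular_mat_family n N T f X"
  shows "regular_mat_family n N T (\<lambda>t. f t * g t) X"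
  unfolding regular_mat_family_def
proof (intro allI impI conjI)
  fix i j assume ij: "i < n" "j < n"
  show "regular_fun N T (\<lambda>t. f t * g t) (\<lambda>t. fls_nth (X t $$ (i, j)) l)" for l
    using X ij regular_fun_restrict[OF g] by (simp add: regular_mat_family_def)
  obtain d where "\<forall>t\<in>basic_open T f. \<forall>l<d. fls_nth (X t $$ (i, j)) l = 0"
    using X ij unfolding regular_mat_family_def by blast
  then show "\<exists>d. \<forall>t\<in>basic_open T (\<lambda>t. f t * g t). \<forall>l<d. fls_nth (X t $$ (i, j)) l = 0"
    using basic_open_mult[of T f g] by blast
qed

lemma regular_mat_family_anti_transpose:
  assumes "regular_mat_family n N T f X"
  shows "regular_mat_family n N T f (\<lambda>t. anti_transpose n (X t))"
  using assms unfolding regular_mat_family_def by (simp add: anti_transpose_index)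

lemma regular_mat_family_cong:
  assumes eq: "\<And>t. t \<in> basic_open T f \<Longrightarrow> X t = Z t" and X: "regular_mat_family n N T f X"
  shows "regular_mat_family n N T f Z"
  unfolding regular_mat_family_def
proof (intro allI impI conjI)
  fix i j assume ij: "i < n" "j < n"
  show "regular_fun N T f (\<lambda>t. fls_nth (Z t $$ (i, j)) l)" for l
  proof -
    have "regular_fun N T f (\<lambda>t. fls_nth (X t $$ (i, j)) l)"
      using X ij unfolding regular_mat_family_def by blast
    then show ?thesis by (subst regular_fun_cong[of T f _ "\<lambda>t. fls_nth (X t $$ (i, j)) l"]) (use eq in auto)
  qed
  show "\<exists>d. \<forall>t\<in>basic_open T f. \<forall>l<d. fls_nth (Z t $$ (i, j)) l = 0"
    using X ij eq unfolding regular_mat_family_def by fastforce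
qed

lemma regular_mat_family_poles:
  assumes X: "regular_mat_family n N T f X"
  obtains d where "\<And>t. t \<in> basic_open T f \<Longrightarrow> poles_bounded n d (X t)"
proof -
  have "\<exists>d. \<forall>t\<in>basic_open T f. \<forall>l<d. fls_nth (X t $$ (i, j)) l = 0" if "i < n" "j < n" for i j
    using X that unfolding regular_mat_family_def by blast
  then obtain d where d: "\<And>i j t l. i < n \<Longrightarrow> j < n \<Longrightarrow> t \<in> basic_open T f \<Longrightarrow> l < d i j \<Longrightarrow>
      fls_nth (X t $$ (i, j)) l = 0" by metis
  let ?D = "\<Sum>i<n. \<Sum>j<n. nat (- d i j)"
  have "poles_bounded n ?D (X t)" if t: "t \<in> basic_open T f" for t
    unfolding poles_bounded_def
  proof (intro allI impI)
    fix i j l assume ij: "i < n" "j < n" "l < - int ?D"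
    have "nat (- d i j) \<le> (\<Sum>j<n. nat (- d i j))" by (rule member_le_sum) (use ij in auto)
    also have "\<dots> \<le> ?D" by (rule member_le_sum[of i _ "\<lambda>i. \<Sum>j<n. nat (- d i j)"]) (use ij in auto)
    finally have "l < d i j" using ij(3) by linarith
    then show "fls_nth (X t $$ (i, j)) l = 0" by (rule d[OF ij(1,2) t])
  qed
  then show ?thesis using that by blast
qed

text \<open>Thanks to the uniform pole bound, the coefficient is the same finite sum of coefficients
  of \<open>X t\<close> at every parameter.\<close>

lemma regular_mat_family_mult_vec:
  assumes f: "f \<in> poly_fun N" and X: "regular_mat_family n N T f X"
    and Xc: "\<And>t. t \<in> basic_open T f \<Longrightarrow> X t \<in> carrier_mat n n"
    and v: "v \<in> int_vec n" and i: "i < n"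
  shows "regular_fun N T f (\<lambda>t. fls_nth ((X t *\<^sub>v v) $ i) l)"
proof -
  obtain d where d: "\<And>t. t \<in> basic_open T f \<Longrightarrow> poles_bounded n d (X t)"
    using regular_mat_family_poles[OF X] by blast
  have "fls_nth ((X t *\<^sub>v v) $ i) l =
      (\<Sum>j<n. \<Sum>e = - int d..l - 0. fls_nth (X t $$ (i, j)) e * fls_nth (v $ j) (l - e))"
    if t: "t \<in> basic_open T f" for t
    unfolding mult_mat_vec_index[OF Xc[OF t] int_vec_carrier[OF v] i] fls_nth_sum
  proof (rule sum.cong[OF refl])
    fix j assume "j \<in> {..<n}"
    then have j: "j < n" by simp
    show "fls_nth (X t $$ (i, j) * v $ j) l =
        (\<Sum>e = - int d..l - 0. fls_nth (X t $$ (i, j)) e * fls_nth (v $ j) (l - e))"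
      by (rule fls_mult_nth_conv)
        (use d[OF t] i j int_vec_index[OF v j] in \<open>auto simp: poles_bounded_def int_ring_iff simp del: range_eqI\<close>)
  qed
  moreover have "regular_fun N T f (\<lambda>t. \<Sum>j<n. \<Sum>e = - int d..l - 0.
      fls_nth (X t $$ (i, j)) e * fls_nth (v $ j) (l - e))"
    using X i by (intro regular_fun_sum[OF f] regular_fun_mult regular_fun_const)
      (auto simp: regular_mat_family_def)
  ultimately show ?thesis by (subst regular_fun_cong) auto
qed

lemma functional_lin_comb:
  assumes V: "cx_subspace n V"
    and add: "\<And>a b. a \<in> V \<Longrightarrow> b \<in> V \<Longrightarrow> \<phi> (a + b) = \<phi> a + \<phi> b"
    and sc: "\<And>c a. a \<in> V \<Longrightarrow> \<phi> (fls_const c \<cdot>\<^sub>v a) = c * \<phi> a"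
    and w: "\<And>i. i < k \<Longrightarrow> w i \<in> V"
  shows "\<phi> (lin_comb n w c k) = (\<Sum>i<k. c i * \<phi> (w i) :: complex)"
  using w
proof (induction k)
  case 0
  have "fls_const 0 \<cdot>\<^sub>v 0\<^sub>v n = (0\<^sub>v n :: complex fls vec)" by (intro eq_vecI) simp_all
  then have "\<phi> (0\<^sub>v n) = 0" using sc[OF cx_subspaceD(2)[OF V], of 0] by simp
  then show ?case by (simp add: lin_comb_0)
next
  case (Suc k)
  have wk: "w k \<in> V" and lc: "lin_comb n w c k \<in> V" using lin_comb_closed[OF V, of k w c] Suc.prems by auto
  show ?case
    unfolding lin_comb_Suc[of w k n c, OF cx_subspaceD(1)[OF V wk]]
      add[OF lc cx_subspaceD(4)[OF V wk]] sc[OF wk]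
    using Suc by simp
qed

subsection \<open>From families of lattices to families of quotients\<close>

lemma flag_functional_linear:
  assumes h: "h \<in> carrier (GL_K n)" and e: "e \<in> flag_functionals n j"
  shows "a \<in> int_vec n \<Longrightarrow> b \<in> int_vec n \<Longrightarrow>
      fls_nth ((GL_inv n h *\<^sub>v (a + b)) $ fst e) (snd e) =
      fls_nth ((GL_inv n h *\<^sub>v a) $ fst e) (snd e) + fls_nth ((GL_inv n h *\<^sub>v b) $ fst e) (snd e)"
    "a \<in> int_vec n \<Longrightarrow> fls_nth ((GL_inv n h *\<^sub>v (fls_const c \<cdot>\<^sub>v a)) $ fst e) (snd e) =
      c * fls_nth ((GL_inv n h *\<^sub>v a) $ fst e) (snd e)"
  using mult_add_distrib_mat_vec[OF GL_K_inv(2)[OF h] int_vec_carrier int_vec_carrier, of a b]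
    mult_mat_vec[OF GL_K_inv(2)[OF h] int_vec_carrier, of a] e GL_K_inv(2)[OF h]
  by (auto simp: flag_functionals_def)

text \<open>Functionals and dual vectors are chosen at \<open>p\<close>, where their matrix of
  values is the identity. Its determinant stays nonzero on a neighbourhood, and there the same
  functionals remain independent. They vanish on the lattice at \<open>t\<close> but may cut out a
  larger space \<open>K\<close>, as long as the colength is not known to be constant.\<close>

lemma local_quotients:
  assumes f: "f \<in> poly_fun N" and p: "p \<in> basic_open T f"
    and h: "\<And>t. t \<in> basic_open T f \<Longrightarrow> h t \<in> carrier (GL_K n)"
    and hi: "\<And>t. t \<in> basic_open T f \<Longrightarrow> h t \<in> int_mat n"
    and reg: "regular_mat_family n N T f (\<lambda>t. GL_inv n (h t))"
  obtains s e g where "g \<in> poly_fun N" "g p \<noteq> 0" "\<And>r. r < s \<Longrightarrow> e r \<in> flag_functionals n j"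
    "quotient_map (int_vec n) s (lattice_flag n (h p) j)
      (\<lambda>v. vec s (\<lambda>r. fls_nth ((GL_inv n (h p) *\<^sub>v v) $ fst (e r)) (snd (e r))))"
    "\<And>t. t \<in> basic_open T (\<lambda>t. f t * g t) \<Longrightarrow> \<exists>K. lattice_flag n (h t) j \<subseteq> K \<and>
      quotient_map (int_vec n) s K
        (\<lambda>v. vec s (\<lambda>r. fls_nth ((GL_inv n (h t) *\<^sub>v v) $ fst (e r)) (snd (e r))))"
proof -
  let ?\<phi> = "\<lambda>t e v. fls_nth ((GL_inv n (h t) *\<^sub>v v) $ fst e) (snd e)"
  obtain s e where e: "\<And>r. r < s \<Longrightarrow> e r \<in> flag_functionals n j"
    and q: "quotient_map (int_vec n) s (lattice_flag n (h p) j) (\<lambda>v. vec s (\<lambda>r. ?\<phi> p (e r) v))"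
    by (rule lattice_flag_select[OF h[OF p] lattice_flag_int[OF h[OF p] hi[OF p], of j]], rule that)
  obtain v where v: "\<And>i. i < s \<Longrightarrow> v i \<in> int_vec n"
    "\<And>i. i < s \<Longrightarrow> vec s (\<lambda>r. ?\<phi> p (e r) (v i)) = unit_vec s i"
    using quotient_map_dual_basis[OF q] by blast
  let ?a = "\<lambda>r i t. ?\<phi> t (e r) (v i)"
  let ?D = "\<lambda>t. det (mat s s (\<lambda>(r, i). ?a r i t))"
  have ra: "regular_fun N T f (?a r i)" if "r < s" "i < s" for r i
    using regular_mat_family_mult_vec[OF f reg GL_K_inv(2)[OF h] v(1)[OF that(2)]] e[OF that(1)]
    by (auto simp: flag_functionals_def)
  have rD: "regular_fun N T f ?D" by (rule regular_fun_det[OF f ra])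
  have "mat s s (\<lambda>(r, i). ?a r i p) = 1\<^sub>m s"
  proof (rule eq_matI)
    fix r i assume "r < dim_row (1\<^sub>m s)" "i < dim_col (1\<^sub>m s)"
    then have r: "r < s" and i: "i < s" by auto
    show "mat s s (\<lambda>(r, i). ?a r i p) $$ (r, i) = 1\<^sub>m s $$ (r, i)"
      using arg_cong[OF v(2)[OF i], of "\<lambda>x. x $ r"] r i by (simp add: unit_vec_def)
  qed auto
  then have "?D p \<noteq> 0" by simp
  then obtain g where g: "g \<in> poly_fun N" "g p \<noteq> 0" "\<And>t. t \<in> basic_open T (\<lambda>t. f t * g t) \<Longrightarrow> ?D t \<noteq> 0"
    using regular_fun_inverse[OF f rD p] by blast
  show ?thesis
  proof (rule that[OF g(1,2) e q])
    fix t assume t: "t \<in> basic_open T (\<lambda>t. f t * g t)"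
    then have tf: "t \<in> basic_open T f" using basic_open_mult[of T f g] by blast
    let ?q = "\<lambda>v. vec s (\<lambda>r. ?\<phi> t (e r) v)"
    let ?K = "{a \<in> int_vec n. ?q a = 0\<^sub>v s}"
    note lin = flag_functional_linear[OF h[OF tf] e]
    have "?q ` int_vec n = carrier_vec s"
    proof
      show "carrier_vec s \<subseteq> ?q ` int_vec n"
      proof
        fix u :: "complex vec" assume u: "u \<in> carrier_vec s"
        let ?A = "mat s s (\<lambda>(r, i). ?a r i t)"
        have A: "?A \<in> carrier_mat s s" by simp
        obtain X where X: "X \<in> carrier_mat s s" "?A * X = 1\<^sub>m s"
          using det_non_zero_imp_unit[OF A g(3)[OF t], of "()"] by (auto simp: Units_def ring_mat_simps)
        let ?x = "X *\<^sub>v u"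
        have x: "?x \<in> carrier_vec s" using X(1) u by simp
        have Ax: "?A *\<^sub>v ?x = u" using assoc_mult_mat_vec[OF A X(1) u] X(2) u by simp
        let ?b = "lin_comb n v (\<lambda>i. ?x $ i) s"
        have "u = ?q ?b"
        proof (rule eq_vecI)
          fix r assume "r < dim_vec (?q ?b)"
          then have r: "r < s" by simp
          have "?\<phi> t (e r) ?b = (\<Sum>i<s. ?x $ i * ?a r i t)"
            by (rule functional_lin_comb[OF int_vec_subspace lin(1)[OF r] lin(2)[OF r] v(1)])
          also have "\<dots> = (?A *\<^sub>v ?x) $ r"
            unfolding mult_mat_vec_index[OF A x r] using r by (intro sum.cong) (auto simp: mult.commute)
          finally show "u $ r = ?q ?b $ r" using Ax r by simp
        qed (use u in simp)
        then show "u \<in> ?q ` int_vec n"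
          by (rule image_eqI) (rule lin_comb_closed[OF int_vec_subspace v(1)])
      qed
    qed auto
    then have "quotient_map (int_vec n) s ?K ?q"
      unfolding quotient_map_def using lin by (auto intro!: eq_vecI)
    moreover have "lattice_flag n (h t) j \<subseteq> ?K"
    proof
      fix a assume a: "a \<in> lattice_flag n (h t) j"
      have ai: "a \<in> int_vec n" using a lattice_flag_int[OF h[OF tf] hi[OF tf], of j] by blast
      have st: "GL_inv n (h t) *\<^sub>v a \<in> std_lattice n j" using a by (simp add: lattice_flag_def)
      then have "?\<phi> t p' a = 0" if "p' \<in> flag_functionals n j" for p'
        using std_lattice_iff_functionals[OF int_vec_carrier[OF std_lattice_int[OF st]]] that by auto
      then have "?q a = 0\<^sub>v s" using e by (intro eq_vecI) auto
      then show "a \<in> ?K" using ai by simp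
    qed
    ultimately show "\<exists>K. lattice_flag n (h t) j \<subseteq> K \<and> quotient_map (int_vec n) s K ?q" by blast
  qed
qed

text \<open>The lattice of \<open>h\<close> contains \<epsilon>^d C[[\<epsilon>]]^n, and
  \<open>h^-1\<close> carries the subquotient to C[[\<epsilon>]]^n modulo the lattice of
  \<open>h'\<close>. So the two colengths add up to the codimension \<open>n * d\<close>.\<close>

lemma colength_complement:
  assumes h: "h \<in> carrier (GL_K n)" and hi: "h \<in> int_mat n" and d: "poles_bounded n d (GL_inv n h)"
  defines "h' \<equiv> fls_X ^ d \<cdot>\<^sub>m GL_inv n h"
  shows "h' \<in> carrier (GL_K n)" "h' \<in> int_mat n"
    "GL_inv n h' = inverse (fls_X ^ d) \<cdot>\<^sub>m h"
    "colength n (lattice_flag n h 0) + colength n (lattice_flag n h' 0) = n * d"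
proof -
  note hc = GL_K_carrier[OF h] and ic = GL_K_inv(2)[OF h]
  have X: "fls_X ^ d \<noteq> (0 :: complex fls)" by simp
  have h'c: "h' \<in> carrier_mat n n" unfolding h'_def using ic by simp
  have kc: "inverse (fls_X ^ d) \<cdot>\<^sub>m h \<in> carrier_mat n n" using hc by simp
  have "h' * (inverse (fls_X ^ d) \<cdot>\<^sub>m h) = fls_X ^ d \<cdot>\<^sub>m (GL_inv n h * (inverse (fls_X ^ d) \<cdot>\<^sub>m h))"
    unfolding h'_def by (rule mult_smult_assoc_mat[OF ic kc])
  also have "GL_inv n h * (inverse (fls_X ^ d) \<cdot>\<^sub>m h) = inverse (fls_X ^ d) \<cdot>\<^sub>m (GL_inv n h * h)"
    by (rule mult_smult_distrib[OF ic hc])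
  also have "GL_inv n h * h = 1\<^sub>m n" by (rule GL_K_inv(3)[OF h])
  also have "fls_X ^ d \<cdot>\<^sub>m (inverse (fls_X ^ d) \<cdot>\<^sub>m 1\<^sub>m n) = (1\<^sub>m n :: complex fls mat)"
    using X by (intro eq_matI) auto
  finally have one: "h' * (inverse (fls_X ^ d) \<cdot>\<^sub>m h) = 1\<^sub>m n" .
  show h': "h' \<in> carrier (GL_K n)" and inv': "GL_inv n h' = inverse (fls_X ^ d) \<cdot>\<^sub>m h"
    using GL_K_I[OF h'c kc one] by blast+
  show h'i: "h' \<in> int_mat n"
  proof (rule int_matI[OF h'c])
    fix i j assume ij: "i < n" "j < n"
    show "h' $$ (i, j) \<in> int_ring"
      unfolding int_ring_iff h'_def using ic ij d
      by (auto simp: fls_X_power_mult_nth poles_bounded_def)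
  qed
  obtain q where q: "quotient_map (int_vec n) (colength n (lattice_flag n h 0)) (lattice_flag n h 0) q"
    by (rule lattice_flag_0_quotient[OF h hi])
  obtain q' where q': "quotient_map (int_vec n) (colength n (lattice_flag n h' 0)) (lattice_flag n h' 0) q'"
    by (rule lattice_flag_0_quotient[OF h' h'i])
  have pl: "{v \<in> carrier_vec n. GL_inv n h *\<^sub>v v \<in> lattice_flag n h' 0} = power_lattice n d"
  proof -
    have eq: "GL_inv n h' *\<^sub>v (GL_inv n h *\<^sub>v v) = inverse (fls_X ^ d) \<cdot>\<^sub>v v"
      if v: "v \<in> carrier_vec n" for v
    proof -
      have "GL_inv n h' *\<^sub>v (GL_inv n h *\<^sub>v v) = inverse (fls_X ^ d) \<cdot>\<^sub>v (h *\<^sub>v (GL_inv n h *\<^sub>v v))"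
        unfolding inv' by (intro eq_vecI)
          (use hc ic v in \<open>auto simp: scalar_prod_def sum_distrib_left mult.assoc intro!: sum.cong\<close>)
      then show ?thesis using GL_K_inv_vec(1)[OF h v] by simp
    qed
    have int: "v \<in> power_lattice n d \<longleftrightarrow> inverse (fls_X ^ d) \<cdot>\<^sub>v v \<in> int_vec n" if v: "v \<in> carrier_vec n" for v
    proof -
      have "v = fls_X ^ d \<cdot>\<^sub>v (inverse (fls_X ^ d) \<cdot>\<^sub>v v)" using X v by (intro eq_vecI) auto
      moreover have "inverse (fls_X ^ d) \<cdot>\<^sub>v (fls_X ^ d \<cdot>\<^sub>v w) = w" if "w \<in> int_vec n" for w
        using X int_vec_dim[OF that] by (intro eq_vecI) auto
      ultimately show ?thesis unfolding power_lattice_iff by metis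
    qed
    have "GL_inv n h *\<^sub>v v \<in> lattice_flag n h' 0 \<longleftrightarrow> v \<in> power_lattice n d" if v: "v \<in> carrier_vec n" for v
      using eq[OF v] int[OF v] mult_mat_vec_carrier[OF ic v] by (simp add: lattice_flag_def std_lattice_0)
    moreover have "v \<in> carrier_vec n" if "v \<in> power_lattice n d" for v
      using that by (simp add: power_lattice_def int_vec_carrier)
    ultimately show ?thesis by blast
  qed
  obtain q'' where "quotient_map (int_vec n)
      (colength n (lattice_flag n h 0) + colength n (lattice_flag n h' 0)) (power_lattice n d) q''"
    by (rule quotient_map_compose[OF int_vec_subspace q lattice_flag_quotient[OF h q', unfolded pl]])
  from colength_eq[OF this] colength_eq[OF power_lattice_quotient[of n d]]
  show "colength n (lattice_flag n h 0) + colength n (lattice_flag n h' 0) = n * d" by simp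
qed

lemma regular_mat_family_smult:
  assumes X: "regular_mat_family n N T f X"
    and Xc: "\<And>t. t \<in> basic_open T f \<Longrightarrow> X t \<in> carrier_mat n n"
    and x: "\<And>y l. fls_nth (x * y) l = fls_nth y (l + e)"
  shows "regular_mat_family n N T f (\<lambda>t. x \<cdot>\<^sub>m X t)"
  unfolding regular_mat_family_def
proof (intro allI impI conjI)
  fix i j assume ij: "i < n" "j < n"
  have eq: "fls_nth ((x \<cdot>\<^sub>m X t) $$ (i, j)) l = fls_nth (X t $$ (i, j)) (l + e)" if "t \<in> basic_open T f" for t l
    using Xc[OF that] ij x by simp
  show "regular_fun N T f (\<lambda>t. fls_nth ((x \<cdot>\<^sub>m X t) $$ (i, j)) l)" for l
  proof -
    have "regular_fun N T f (\<lambda>t. fls_nth (X t $$ (i, j)) (l + e))"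
      using X ij unfolding regular_mat_family_def by blast
    then show ?thesis
      by (subst regular_fun_cong[of T f _ "\<lambda>t. fls_nth (X t $$ (i, j)) (l + e)"]) (use eq in auto)
  qed
  obtain d where d: "\<forall>t\<in>basic_open T f. \<forall>l<d. fls_nth (X t $$ (i, j)) l = 0"
    using X ij unfolding regular_mat_family_def by blast
  show "\<exists>d. \<forall>t\<in>basic_open T f. \<forall>l<d. fls_nth ((x \<cdot>\<^sub>m X t) $$ (i, j)) l = 0"
    by (intro exI[of _ "d - e"]) (use d eq in auto)
qed

lemma fls_X_power_inverse_mult_nth:
  "fls_nth (inverse (fls_X ^ d) * (x :: complex fls)) l = fls_nth x (l + int d)"
proof -
  have "fls_nth x (l + int d) = fls_nth (fls_X ^ d * (inverse (fls_X ^ d) * x)) (l + int d)"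
    by (simp add: mult.assoc[symmetric])
  also have "\<dots> = fls_nth (inverse (fls_X ^ d) * x) l" unfolding fls_X_power_mult_nth by simp
  finally show ?thesis ..
qed

text \<open>Near \<open>p\<close> the lattice at \<open>t\<close> is contained in a space whose
  codimension equals the colength at \<open>p\<close>.\<close>

lemma colength_lower_semicontinuous:
  assumes f: "f \<in> poly_fun N" and p: "p \<in> basic_open T f"
    and h: "\<And>t. t \<in> basic_open T f \<Longrightarrow> h t \<in> carrier (GL_K n)"
    and hi: "\<And>t. t \<in> basic_open T f \<Longrightarrow> h t \<in> int_mat n"
    and reg: "regular_mat_family n N T f (\<lambda>t. GL_inv n (h t))"
  obtains g where "g \<in> poly_fun N" "g p \<noteq> 0"
    "\<And>t. t \<in> basic_open T (\<lambda>t. f t * g t) \<Longrightarrow>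
      colength n (lattice_flag n (h p) 0) \<le> colength n (lattice_flag n (h t) 0)"
proof -
  obtain s e g where g: "g \<in> poly_fun N" "g p \<noteq> 0"
    and q: "quotient_map (int_vec n) s (lattice_flag n (h p) 0)
      (\<lambda>v. vec s (\<lambda>r. fls_nth ((GL_inv n (h p) *\<^sub>v v) $ fst (e r)) (snd (e r))))"
    and K: "\<And>t. t \<in> basic_open T (\<lambda>t. f t * g t) \<Longrightarrow> \<exists>K. lattice_flag n (h t) 0 \<subseteq> K \<and>
      quotient_map (int_vec n) s K
        (\<lambda>v. vec s (\<lambda>r. fls_nth ((GL_inv n (h t) *\<^sub>v v) $ fst (e r)) (snd (e r))))"
    by (rule local_quotients[where j = 0 and h = h, OF f p h hi reg], assumption, assumption, rule that)
  have "colength n (lattice_flag n (h p) 0) \<le> colength n (lattice_flag n (h t) 0)"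
    if t: "t \<in> basic_open T (\<lambda>t. f t * g t)" for t
  proof -
    have tf: "t \<in> basic_open T f" using t basic_open_mult[of T f g] by blast
    obtain K q' where K: "lattice_flag n (h t) 0 \<subseteq> K" "quotient_map (int_vec n) s K q'" using K[OF t] by blast
    obtain q'' where q'': "quotient_map (int_vec n) (colength n (lattice_flag n (h t) 0)) (lattice_flag n (h t) 0) q''"
      by (rule lattice_flag_0_quotient[OF h[OF tf] hi[OF tf]])
    show ?thesis unfolding colength_eq[OF q] by (rule quotient_map_le[OF int_vec_subspace K(2) q'' K(1)])
  qed
  then show ?thesis using that g by blast
qed

text \<open>The complementary lattice \<open>\<epsilon>^d h^-1 \<complex>[[\<epsilon>]]^n\<close> turns lower into upper semicontinuity.\<close>

lemma colength_locally_constant: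
  assumes f: "f \<in> poly_fun N" and p: "p \<in> basic_open T f"
    and h: "\<And>t. t \<in> basic_open T f \<Longrightarrow> h t \<in> carrier (GL_K n)"
    and hi: "\<And>t. t \<in> basic_open T f \<Longrightarrow> h t \<in> int_mat n"
    and reg: "regular_mat_family n N T f h" "regular_mat_family n N T f (\<lambda>t. GL_inv n (h t))"
  obtains g where "g \<in> poly_fun N" "g p \<noteq> 0"
    "\<And>t. t \<in> basic_open T (\<lambda>t. f t * g t) \<Longrightarrow>
      colength n (lattice_flag n (h t) 0) = colength n (lattice_flag n (h p) 0)"
proof -
  obtain d where d: "\<And>t. t \<in> basic_open T f \<Longrightarrow> poles_bounded n d (GL_inv n (h t))"
    using regular_mat_family_poles[OF reg(2)] by blast
  let ?k = "\<lambda>t. fls_X ^ d \<cdot>\<^sub>m GL_inv n (h t)"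
  note cc = colength_complement[OF h hi d]
  have "regular_mat_family n N T f (\<lambda>t. inverse (fls_X ^ d) \<cdot>\<^sub>m h t)"
    by (rule regular_mat_family_smult[OF reg(1) GL_K_carrier[OF h] fls_X_power_inverse_mult_nth])
  then have regk: "regular_mat_family n N T f (\<lambda>t. GL_inv n (?k t))"
    by (rule regular_mat_family_cong[rotated]) (use cc(3) in simp)
  obtain g where g: "g \<in> poly_fun N" "g p \<noteq> 0"
    "\<And>t. t \<in> basic_open T (\<lambda>t. f t * g t) \<Longrightarrow>
      colength n (lattice_flag n (h p) 0) \<le> colength n (lattice_flag n (h t) 0)"
    using colength_lower_semicontinuous[where h = h, OF f p h hi reg(2)] by blast
  obtain g' where g': "g' \<in> poly_fun N" "g' p \<noteq> 0"
    "\<And>t. t \<in> basic_open T (\<lambda>t. f t * g' t) \<Longrightarrow>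
      colength n (lattice_flag n (?k p) 0) \<le> colength n (lattice_flag n (?k t) 0)"
    using colength_lower_semicontinuous[where h = ?k, OF f p cc(1,2) regk] by blast
  show ?thesis
  proof (rule that[of "\<lambda>t. g t * g' t"])
    show "(\<lambda>t. g t * g' t) \<in> poly_fun N" "g p * g' p \<noteq> 0" using g g' by (auto intro: poly_fun.mult)
    fix t assume "t \<in> basic_open T (\<lambda>t. f t * (g t * g' t))"
    then have t: "t \<in> basic_open T f" "t \<in> basic_open T (\<lambda>t. f t * g t)" "t \<in> basic_open T (\<lambda>t. f t * g' t)"
      by (auto simp: basic_open_def)
    \<comment> \<open>Both colengths are at least their values at \<open>p\<close>, while their sum
      is \<open>n * d\<close> at \<open>t\<close> and at \<open>p\<close>; hence both are equal to
      these values.\<close>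
    show "colength n (lattice_flag n (h t) 0) = colength n (lattice_flag n (h p) 0)"
      using g(3)[OF t(2)] g'(3)[OF t(3)] cc(4)[OF t(1) t(1) t(1)] cc(4)[OF p p p] by linarith
  qed
qed

lemma trivializes_quotient_iff:
  "trivializes_quotient m n s N T f J q \<longleftrightarrow>
    (\<forall>t\<in>basic_open T f. OC_quotient_map m n s (J t) (q t)) \<and>
    (\<forall>a\<in>carrier (OC m n). \<forall>i<s. regular_fun N T f (\<lambda>t. q t a $ i))"
  unfolding trivializes_quotient_def OC_quotient_map_def ..

lemma trivializes_quotient_restrict:
  assumes "trivializes_quotient m n s N T f J q" "g \<in> poly_fun N"
  shows "trivializes_quotient m n s N T (\<lambda>t. f t * g t) J q"
  using assms regular_fun_restrict[OF assms(2)] basic_open_mult[of T f g]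
  unfolding trivializes_quotient_iff by blast

lemma trivializes_quotient_cong:
  assumes "\<And>t. t \<in> basic_open T f \<Longrightarrow> J t = J' t"
  shows "trivializes_quotient m n s N T f J q \<longleftrightarrow> trivializes_quotient m n s N T f J' q"
  using assms unfolding trivializes_quotient_iff by simp

text \<open>Once the colength is constant, the inclusion from \<open>local_quotients\<close> is an
  equality by comparing codimensions, so the functionals chosen at \<open>p\<close> trivialize the
  quotients nearby.\<close>

lemma lattice_family_trivializes:
  assumes m: "m > 0" and f: "f \<in> poly_fun N" and p: "p \<in> basic_open T f" and j: "j \<le> n"
    and a: "\<And>t. t \<in> basic_open T f \<Longrightarrow> admissible m n (h t)"
    and reg: "regular_mat_family n N T f (\<lambda>t. GL_inv n (h t))"
    and k: "\<And>t. t \<in> basic_open T f \<Longrightarrow> colength n (lattice_flag n (h t) 0) = k"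
  shows "\<exists>g\<in>poly_fun N. g p \<noteq> 0 \<and>
    (\<exists>q. trivializes_quotient m n (k + j) N T (\<lambda>t. f t * g t) (\<lambda>t. vec_to_OC m n ` lattice_flag n (h t) j) q)"
proof -
  have h: "h t \<in> carrier (GL_K n)" and hi: "h t \<in> int_mat n" if "t \<in> basic_open T f" for t
    using a[OF that] by (simp_all add: admissible_def)
  let ?q = "\<lambda>s e t v. vec s (\<lambda>r. fls_nth ((GL_inv n (h t) *\<^sub>v v) $ fst (e r)) (snd (e r)))"
  obtain s e g where g: "g \<in> poly_fun N" "g p \<noteq> 0" and e: "\<And>r. r < s \<Longrightarrow> e r \<in> flag_functionals n j"
    and q: "quotient_map (int_vec n) s (lattice_flag n (h p) j) (?q s e p)"
    and K: "\<And>t. t \<in> basic_open T (\<lambda>t. f t * g t) \<Longrightarrow> \<exists>K. lattice_flag n (h t) j \<subseteq> K \<and>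
      quotient_map (int_vec n) s K (?q s e t)"
    by (rule local_quotients[where j = j and h = h, OF f p h hi reg], assumption, assumption, rule that)
  have quot: "\<exists>q. quotient_map (int_vec n) (k + j) (lattice_flag n (h t) j) q" if t: "t \<in> basic_open T f" for t
  proof -
    obtain q0 where "quotient_map (int_vec n) k (lattice_flag n (h t) 0) q0"
      using lattice_flag_0_quotient[OF h[OF t] hi[OF t]] k[OF t] by metis
    from lattice_flag_colength[OF h[OF t] this j] show ?thesis by blast
  qed
  have s: "s = k + j" using quot[OF p] colength_eq[OF q] colength_eq by metis
  have qt: "quotient_map (int_vec n) s (lattice_flag n (h t) j) (?q s e t)"
    if t: "t \<in> basic_open T (\<lambda>t. f t * g t)" for t
  proof -
    have tf: "t \<in> basic_open T f" using t basic_open_mult[of T f g] by blast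
    obtain K where K: "lattice_flag n (h t) j \<subseteq> K" "quotient_map (int_vec n) s K (?q s e t)" using K[OF t] by blast
    obtain q' where q': "quotient_map (int_vec n) s (lattice_flag n (h t) j) q'" using quot[OF tf] s by blast
    have "lattice_flag n (h t) j = K" by (rule quotient_map_same_kernel[OF int_vec_subspace K(2) q' K(1)])
    then show ?thesis using K(2) by simp
  qed
  have inj: "inj_on (vec_to_OC m n) (int_vec n)" and im: "carrier (OC m n) = vec_to_OC m n ` int_vec n"
    using bij_vec_to_OC[OF m, of n] by (auto simp: bij_betw_def)
  let ?r = "the_inv_into (int_vec n) (vec_to_OC m n)"
  have "trivializes_quotient m n s N T (\<lambda>t. f t * g t) (\<lambda>t. vec_to_OC m n ` lattice_flag n (h t) j)
      (\<lambda>t a. ?q s e t (?r a))"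
    unfolding trivializes_quotient_iff
  proof (intro conjI ballI allI impI)
    fix t assume t: "t \<in> basic_open T (\<lambda>t. f t * g t)"
    have tf: "t \<in> basic_open T f" using t basic_open_mult[of T f g] by blast
    have "quotient_map (int_vec n) s (lattice_flag n (h t) j) (\<lambda>v. ?q s e t (?r (vec_to_OC m n v)))"
      using qt[OF t] quotient_map_cong[OF int_vec_subspace, of n "?q s e t" "\<lambda>v. ?q s e t (?r (vec_to_OC m n v))"]
      by (simp add: the_inv_into_f_f[OF inj])
    then show "OC_quotient_map m n s (vec_to_OC m n ` lattice_flag n (h t) j) (\<lambda>a. ?q s e t (?r a))"
      by (simp add: OC_quotient_map_iff[OF m lattice_flag_int[OF h[OF tf] hi[OF tf]]])
  next
    fix a i assume a: "a \<in> carrier (OC m n)" and i: "i < s"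
    obtain v where v: "v \<in> int_vec n" "?r a = v"
      using a im the_inv_into_f_f[OF inj] by auto
    have "regular_fun N T f (\<lambda>t. fls_nth ((GL_inv n (h t) *\<^sub>v v) $ fst (e i)) (snd (e i)))"
      by (rule regular_mat_family_mult_vec[OF f reg GL_K_inv(2)[OF h] v(1)])
        (use e[OF i] in \<open>auto simp: flag_functionals_def\<close>)
    then show "regular_fun N T (\<lambda>t. f t * g t) (\<lambda>t. ?q s e t (?r a) $ i)"
      using regular_fun_restrict[OF g(1)] i v(2) by simp
  qed
  then show ?thesis using g s by blast
qed

lemma Fl_morphism_imp_PHilb_morphism:
  assumes m: "m > 0" and n: "n > 0" and u: "u \<in> T \<rightarrow> Spr m n" and mor: "Fl_morphism n N T u"
  shows "PHilb_morphism m n N T (\<lambda>t. Spr_to_PHilb m n (u t))"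
  unfolding PHilb_morphism_def locally_on_def
proof
  fix p assume pT: "p \<in> T"
  obtain f \<gamma> where f: "f \<in> poly_fun N" "f p \<noteq> 0" and G: "regular_GL_family n N T f \<gamma>"
    and ug: "\<And>t. t \<in> basic_open T f \<Longrightarrow> u t = Icoset n (\<gamma> t)"
    using mor pT unfolding Fl_morphism_def locally_on_def by blast
  have p: "p \<in> basic_open T f" using pT f by (simp add: basic_open_def)
  define h where "h t = dual_mat n (\<gamma> t)" for t
  have gam: "\<gamma> t \<in> carrier (GL_K n)" if "t \<in> basic_open T f" for t
    using G that by (simp add: regular_GL_family_def)
  have adm: "admissible m n (h t)" if t: "t \<in> basic_open T f" for t
  proof -
    have "u t \<in> Spr m n" using u t by (auto simp: basic_open_def)
    then show ?thesis unfolding h_def using Spr_iff_admissible[OF n gam[OF t]] ug[OF t] by simp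
  qed
  have h: "h t \<in> carrier (GL_K n)" and hi: "h t \<in> int_mat n" if "t \<in> basic_open T f" for t
    using adm[OF that] by (simp_all add: admissible_def)
  have regh: "regular_mat_family n N T f h"
    using regular_mat_family_anti_transpose[of n N T f "\<lambda>t. GL_inv n (\<gamma> t)"] G
    by (simp add: regular_GL_family_def h_def[abs_def] dual_mat_def)
  have regi: "regular_mat_family n N T f (\<lambda>t. GL_inv n (h t))"
  proof -
    have "regular_mat_family n N T f (\<lambda>t. anti_transpose n (\<gamma> t))"
      using regular_mat_family_anti_transpose G by (simp add: regular_GL_family_def)
    moreover have "GL_inv n (h t) = anti_transpose n (\<gamma> t)" if "t \<in> basic_open T f" for t
      unfolding h_def by (rule dual_mat(2)[OF gam[OF that]])
    ultimately show ?thesis by (rule regular_mat_family_cong[OF sym, rotated])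
  qed
  \<comment> \<open>The colength at \<open>p\<close> becomes the index of the component. It is fixed
    before the trivializations, because the ideal of colength \<open>s\<close> is the lattice in
    position \<open>s - ?k\<close>.\<close>
  let ?k = "colength n (lattice_flag n (h p) 0)"
  obtain g where g: "g \<in> poly_fun N" "g p \<noteq> 0"
    and k: "\<And>t. t \<in> basic_open T (\<lambda>t. f t * g t) \<Longrightarrow> colength n (lattice_flag n (h t) 0) = ?k"
    by (rule colength_locally_constant[where h = h, OF f(1) p h hi regh regi], assumption, assumption, rule that)
  let ?f = "\<lambda>t. f t * g t"
  have f': "?f \<in> poly_fun N" "?f p \<noteq> 0" using f g by (auto intro: poly_fun.mult)
  have sub: "t \<in> basic_open T f" if "t \<in> basic_open T ?f" for t using that basic_open_mult[of T f g] by blast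
  let ?P = "\<lambda>j f. \<exists>q. trivializes_quotient m n (?k + j) N T f (\<lambda>t. vec_to_OC m n ` lattice_flag n (h t) j) q"
  \<comment> \<open>The flag has \<open>n + 1\<close> members, and the neighbourhoods that
    trivialize them are intersected.\<close>
  have "\<exists>g'\<in>poly_fun N. g' p \<noteq> 0 \<and> (\<forall>j<Suc n. ?P j (\<lambda>t. ?f t * g' t))"
  proof (rule locally_finite_conj[OF f'])
    show "?P j (\<lambda>t. f t * g t)" if "?P j f" "g \<in> poly_fun N" for j f g
      using that(1) trivializes_quotient_restrict[OF _ that(2)] by (elim exE) (rule exI)
    show "\<exists>g'\<in>poly_fun N. g' p \<noteq> 0 \<and> ?P j (\<lambda>t. ?f t * g' t)" if "j < Suc n" for j
    proof (rule lattice_family_trivializes[OF m f'(1)])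
      show "p \<in> basic_open T ?f" using f' pT by (simp add: basic_open_def)
      show "j \<le> n" using that by simp
      show "admissible m n (h t)" if "t \<in> basic_open T ?f" for t by (rule adm[OF sub[OF that]])
      show "regular_mat_family n N T ?f (\<lambda>t. GL_inv n (h t))"
        by (rule regular_mat_family_restrict[OF g(1) regi])
      show "colength n (lattice_flag n (h t) 0) = ?k" if "t \<in> basic_open T ?f" for t by (rule k[OF that])
    qed
  qed
  then obtain g' where g': "g' \<in> poly_fun N" "g' p \<noteq> 0" "\<And>j. j \<le> n \<Longrightarrow> ?P j (\<lambda>t. ?f t * g' t)"
    by auto
  let ?F = "\<lambda>t. ?f t * g' t"
  have F: "?F \<in> poly_fun N" "?F p \<noteq> 0" using f' g' by (auto intro: poly_fun.mult)
  have v: "Spr_to_PHilb m n (u t) = flag_point m n (h t)" "colength n (lattice_flag n (h t) 0) = ?k"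
    if "t \<in> basic_open T ?F" for t
  proof -
    have tf': "t \<in> basic_open T ?f" using that by (auto simp: basic_open_def)
    then show "colength n (lattice_flag n (h t) 0) = ?k" by (rule k)
    show "Spr_to_PHilb m n (u t) = flag_point m n (h t)"
      unfolding ug[OF sub[OF tf']] h_def by (rule Spr_to_PHilb_eq[OF gam[OF sub[OF tf']]])
  qed
  have "fst (Spr_to_PHilb m n (u t)) = ?k" if "t \<in> basic_open T ?F" for t
    using v[OF that] by (simp add: flag_point_def Let_def)
  moreover have "\<exists>q. trivializes_quotient m n s N T ?F (\<lambda>t. snd (Spr_to_PHilb m n (u t)) s) q"
    if s: "s \<in> {?k..?k + n}" for s
  proof -
    have "snd (Spr_to_PHilb m n (u t)) s = vec_to_OC m n ` lattice_flag n (h t) (s - ?k)"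
      if "t \<in> basic_open T ?F" for t
      using v[OF that] s by (simp add: flag_point_def Let_def)
    note cong = trivializes_quotient_cong[of T ?F, OF this]
    have "s - ?k \<le> n" "?k + (s - ?k) = s" using s by auto
    then show ?thesis using g'(3)[of "s - ?k"] by (simp add: cong)
  qed
  ultimately show "\<exists>f\<in>poly_fun N. f p \<noteq> 0 \<and> (\<exists>k. (\<forall>t\<in>basic_open T f. fst (Spr_to_PHilb m n (u t)) = k) \<and>
      (\<forall>s\<in>{k..k + n}. \<exists>q. trivializes_quotient m n s N T f (\<lambda>t. snd (Spr_to_PHilb m n (u t)) s) q))"
    using F by (intro bexI[of _ ?F] conjI exI[of _ ?k]) auto
qed

subsection \<open>From families of quotients to families of lattices\<close>

text \<open>Integrality already bounds the poles, so only regularity of the coefficients is required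
  in addition.\<close>

definition regular_vec_family ::
    "nat \<Rightarrow> nat \<Rightarrow> complex vec set \<Rightarrow> (complex vec \<Rightarrow> complex) \<Rightarrow> (complex vec \<Rightarrow> complex fls vec) \<Rightarrow> bool" where
  "regular_vec_family n N T f a \<longleftrightarrow> (\<forall>t\<in>basic_open T f. a t \<in> int_vec n) \<and>
     (\<forall>i<n. \<forall>l. regular_fun N T f (\<lambda>t. fls_nth (a t $ i) l))"

lemma regular_vec_familyD:
  assumes "regular_vec_family n N T f a"
  shows "t \<in> basic_open T f \<Longrightarrow> a t \<in> int_vec n" "i < n \<Longrightarrow> regular_fun N T f (\<lambda>t. fls_nth (a t $ i) l)"
  using assms by (simp_all add: regular_vec_family_def)

lemma regular_vec_family_const: "v \<in> int_vec n \<Longrightarrow> regular_vec_family n N T f (\<lambda>_. v)"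
  by (simp add: regular_vec_family_def regular_fun_const)

lemma regular_vec_family_lin_comb:
  assumes f: "f \<in> poly_fun N" and w: "\<And>i. i < k \<Longrightarrow> regular_vec_family n N T f (w i)"
    and c: "\<And>i. i < k \<Longrightarrow> regular_fun N T f (c i)"
  shows "regular_vec_family n N T f (\<lambda>t. lin_comb n (\<lambda>i. w i t) (\<lambda>i. c i t) k)"
  unfolding regular_vec_family_def
proof (intro conjI ballI allI impI)
  show "lin_comb n (\<lambda>i. w i t) (\<lambda>i. c i t) k \<in> int_vec n" if "t \<in> basic_open T f" for t
    by (rule lin_comb_closed[OF int_vec_subspace]) (rule regular_vec_familyD(1)[OF w that])
  fix i l assume i: "i < n"
  have "(\<lambda>t. fls_nth (lin_comb n (\<lambda>i. w i t) (\<lambda>i. c i t) k $ i) l) =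
      (\<lambda>t. \<Sum>j<k. c j t * fls_nth (w j t $ i) l)"
    using i by (simp add: lin_comb_def fls_nth_sum)
  then show "regular_fun N T f (\<lambda>t. fls_nth (lin_comb n (\<lambda>i. w i t) (\<lambda>i. c i t) k $ i) l)"
    using regular_vec_familyD(2)[OF w i] c by (auto intro!: regular_fun_sum[OF f] regular_fun_mult)
qed

lemma regular_vec_family_diff:
  assumes f: "f \<in> poly_fun N" and a: "regular_vec_family n N T f a" and b: "regular_vec_family n N T f b"
  shows "regular_vec_family n N T f (\<lambda>t. a t + fls_const (- 1) \<cdot>\<^sub>v b t)"
  unfolding regular_vec_family_def
proof (intro conjI ballI allI impI)
  show "a t + fls_const (- 1) \<cdot>\<^sub>v b t \<in> int_vec n" if "t \<in> basic_open T f" for t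
    using regular_vec_familyD(1)[OF a that] regular_vec_familyD(1)[OF b that]
    by (intro int_vec_add int_vec_smult int_ring_const)
  fix i l assume i: "i < n"
  have "regular_fun N T f (\<lambda>t. fls_nth (a t $ i) l + - fls_nth (b t $ i) l)"
    by (intro regular_fun_add[OF f] regular_fun_uminus regular_vec_familyD(2)[OF a i] regular_vec_familyD(2)[OF b i])
  then show "regular_fun N T f (\<lambda>t. fls_nth ((a t + fls_const (- 1) \<cdot>\<^sub>v b t) $ i) l)"
    by (subst regular_fun_cong[of T f _ "\<lambda>t. fls_nth (a t $ i) l + - fls_nth (b t $ i) l"])
      (use i int_vec_dim[OF regular_vec_familyD(1)[OF a]] int_vec_dim[OF regular_vec_familyD(1)[OF b]] in auto)
qed

lemma regular_vec_family_restrict: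
  assumes "g \<in> poly_fun N" "regular_vec_family n N T f a"
  shows "regular_vec_family n N T (\<lambda>t. f t * g t) a"
  using assms regular_fun_restrict[OF assms(1)] basic_open_mult[of T f g]
  unfolding regular_vec_family_def by blast

text \<open>Among \<open>a, \<epsilon>a, \<dots>, \<epsilon>^s a\<close> there is a linear relation modulo \<open>M\<close>, and its lowest term is a unit multiple
  of a power of \<open>\<epsilon>\<close>.\<close>

lemma power_lattice_subset:
  assumes M: "Y_submodule m n M" and q: "quotient_map (int_vec n) s M q"
  shows "power_lattice n s \<subseteq> M"
proof
  fix b assume "b \<in> power_lattice n s"
  then obtain a where a: "a \<in> int_vec n" "b = fls_X ^ s \<cdot>\<^sub>v a" using power_lattice_iff by blast
  have "fls_X ^ i \<cdot>\<^sub>v a \<in> int_vec n" for i by (rule int_vec_smult[OF int_ring_X_power a(1)])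
  then obtain c where c: "\<exists>i\<le>s. c i \<noteq> 0" "lin_comb n (\<lambda>i. fls_X ^ i \<cdot>\<^sub>v a) c (Suc s) \<in> M"
    using quotient_map_dependence[OF int_vec_subspace q, of "\<lambda>i. fls_X ^ i \<cdot>\<^sub>v a"] by blast
  \<comment> \<open>The linear relation reads \<open>F a \<in> M\<close> for a nonzero polynomial
    \<open>F\<close> in \<epsilon> of degree at most \<open>s\<close>. It is a unit times
    \<epsilon>^d with \<open>d \<le> s\<close>, so it divides \<epsilon>^s in the power series
    ring.\<close>
  define F where "F = Abs_fps (\<lambda>i. if i \<le> s then c i else 0)"
  obtain i where i: "i \<le> s" "fps_nth F i \<noteq> 0" using c(1) by (auto simp: F_def)
  let ?d = "subdegree F"
  have d: "?d \<le> s" using subdegree_leI[OF i(2)] i(1) by simp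
  have F0: "F \<noteq> 0" using i(2) by auto
  let ?U = "fps_shift ?d F"
  have U: "fps_nth ?U 0 \<noteq> 0" using nth_subdegree_nonzero[OF F0] by simp
  have "fps_X ^ s = fps_X ^ (s - ?d) * inverse ?U * F"
  proof -
    have "fps_X ^ (s - ?d) * inverse ?U * F = fps_X ^ (s - ?d) * inverse ?U * (?U * fps_X ^ ?d)"
      using subdegree_decompose[of F] by simp
    also have "\<dots> = (inverse ?U * ?U) * (fps_X ^ (s - ?d) * fps_X ^ ?d)" by (simp add: ac_simps)
    also have "\<dots> = fps_X ^ s" using inverse_mult_eq_1[OF U] d by (simp flip: power_add)
    finally show ?thesis ..
  qed
  then have X: "fls_X ^ s = fps_to_fls (fps_X ^ (s - ?d) * inverse ?U) * fps_to_fls F"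
    by (metis fls_times_fps_to_fls fps_to_fls_power fps_X_to_fls)
  have "fps_to_fls F = (\<Sum>i<Suc s. fls_const (c i) * fls_X ^ i)"
  proof (rule fls_eqI)
    fix l :: int
    have "fls_nth (\<Sum>i<Suc s. fls_const (c i) * fls_X ^ i) l = (\<Sum>i<Suc s. if int i = l then c i else 0)"
      unfolding fls_nth_sum by (rule sum.cong) (auto simp: fls_X_power_nth)
    also have "\<dots> = fls_nth (fps_to_fls F) l"
    proof (cases "l < 0")
      case True
      then show ?thesis by (auto intro!: sum.neutral)
    next
      case False
      then obtain i where "l = int i" using nonneg_int_cases by (metis not_less)
      then show ?thesis by (simp add: F_def)
    qed
    finally show "fls_nth (fps_to_fls F) l = fls_nth (\<Sum>i<Suc s. fls_const (c i) * fls_X ^ i) l" ..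
  qed
  then have "lin_comb n (\<lambda>i. fls_X ^ i \<cdot>\<^sub>v a) c (Suc s) = fps_to_fls F \<cdot>\<^sub>v a"
    using int_vec_dim[OF a(1)]
    by (intro eq_vecI) (simp_all add: lin_comb_def sum_distrib_right mult.assoc del: sum.lessThan_Suc)
  then have "fps_to_fls F \<cdot>\<^sub>v a \<in> M" using c(2) by simp
  then have "fps_to_fls (fps_X ^ (s - ?d) * inverse ?U) \<cdot>\<^sub>v (fps_to_fls F \<cdot>\<^sub>v a) \<in> M"
    using M unfolding Y_submodule_def by blast
  then show "b \<in> M" unfolding a(2) X by (simp add: smult_smult_assoc)
qed

text \<open>Regularity of \<open>Q\<close> is given on fixed vectors, here it is needed on a moving
  one. All kernels contain \<epsilon>^s C[[\<epsilon>]]^n, and modulo this lattice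
  \<open>a t\<close> is a combination of \<open>n * s\<close> fixed vectors whose coefficients are
  coefficients of \<open>a t\<close>, hence regular.\<close>

lemma regular_quotient_apply:
  assumes f: "f \<in> poly_fun N"
    and M: "\<And>t. t \<in> basic_open T f \<Longrightarrow> Y_submodule m n (M t)"
    and Q: "\<And>t. t \<in> basic_open T f \<Longrightarrow> quotient_map (int_vec n) s (M t) (Q t)"
    and reg: "\<And>v r. v \<in> int_vec n \<Longrightarrow> r < s \<Longrightarrow> regular_fun N T f (\<lambda>t. Q t v $ r)"
    and a: "regular_vec_family n N T f a" and r: "r < s"
  shows "regular_fun N T f (\<lambda>t. Q t (a t) $ r)"
proof -
  let ?p = "\<lambda>v. vec (n * s) (\<lambda>r. fls_nth (v $ (r div s)) (int (r mod s)))"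
  note pq = power_lattice_quotient[of n s]
  obtain w where w: "\<And>i. i < n * s \<Longrightarrow> w i \<in> int_vec n" "\<And>i. i < n * s \<Longrightarrow> ?p (w i) = unit_vec (n * s) i"
    using quotient_map_dual_basis[OF pq] by blast
  have "Q t (a t) $ r = (\<Sum>i<n * s. fls_nth (a t $ (i div s)) (int (i mod s)) * Q t (w i) $ r)"
    if t: "t \<in> basic_open T f" for t
  proof -
    have ai: "a t \<in> int_vec n" by (rule regular_vec_familyD(1)[OF a t])
    let ?c = "\<lambda>i. ?p (a t) $ i"
    let ?l = "lin_comb n w ?c (n * s)"
    have li: "?l \<in> int_vec n" by (rule lin_comb_closed[OF int_vec_subspace w(1)])
    let ?b = "a t + fls_const (- 1) \<cdot>\<^sub>v ?l"
    have li': "fls_const (- 1) \<cdot>\<^sub>v ?l \<in> int_vec n" by (rule int_vec_smult[OF int_ring_const li])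
    have bi: "?b \<in> int_vec n" by (rule int_vec_add[OF ai li'])
    have "?p ?b = ?p (a t) + (- 1) \<cdot>\<^sub>v ?p ?l"
      unfolding quotient_mapD(3)[OF pq ai li'] quotient_mapD(4)[OF pq li] ..
    also have "?p ?l = vec (n * s) ?c" by (rule quotient_map_dual_lin_comb[OF int_vec_subspace pq w])
    also have "?p (a t) + (- 1) \<cdot>\<^sub>v vec (n * s) ?c = 0\<^sub>v (n * s)" by (intro eq_vecI) auto
    finally have "?b \<in> power_lattice n s" using quotient_mapD(5)[OF pq] bi by blast
    then have "?b \<in> M t" using power_lattice_subset[OF M[OF t] Q[OF t]] by blast
    then have b0: "Q t ?b = 0\<^sub>v s" using quotient_mapD(5)[OF Q[OF t]] by blast
    have "a t = ?b + ?l"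
      using int_vec_dim[OF ai] int_vec_dim[OF li] by (intro eq_vecI) auto
    then have "Q t (a t) = Q t ?b + Q t ?l" using quotient_mapD(3)[OF Q[OF t] bi li] by metis
    also have "\<dots> = Q t ?l" unfolding b0 using quotient_mapD(2)[OF Q[OF t] li] by simp
    also have "Q t ?l = vec s (\<lambda>r. \<Sum>i<n * s. ?c i * Q t (w i) $ r)"
      by (rule quotient_map_lin_comb[OF int_vec_subspace Q[OF t] w(1)])
    finally show ?thesis using r by simp
  qed
  moreover have "regular_fun N T f (\<lambda>t. \<Sum>i<n * s. fls_nth (a t $ (i div s)) (int (i mod s)) * Q t (w i) $ r)"
    using reg[OF w(1) r] regular_vec_familyD(2)[OF a]
    by (intro regular_fun_sum[OF f] regular_fun_mult) (auto simp: less_mult_imp_div_less)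
  ultimately show ?thesis by (subst regular_fun_cong) auto
qed

text \<open>Extends \<open>w\<close> from \<open>p\<close> to nearby parameters. A combination of
  vectors dual to \<open>Q p\<close>, with coefficients found by Cramer's rule, is subtracted so
  that the result stays in the kernel of \<open>Q t\<close>. Some coordinate of \<open>Q'\<close> is
  nonzero at \<open>p\<close> and remains invertible on a smaller neighbourhood.\<close>

lemma local_section:
  assumes f: "f \<in> poly_fun N" and p: "p \<in> basic_open T f"
    and Q: "\<And>t. t \<in> basic_open T f \<Longrightarrow> quotient_map (int_vec n) s (M t) (Q t)"
    and reg: "\<And>v r. v \<in> int_vec n \<Longrightarrow> r < s \<Longrightarrow> regular_fun N T f (\<lambda>t. Q t v $ r)"
    and M': "\<And>t. t \<in> basic_open T f \<Longrightarrow> Y_submodule m n (M' t)"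
    and Q': "\<And>t. t \<in> basic_open T f \<Longrightarrow> quotient_map (int_vec n) s' (M' t) (Q' t)"
    and reg': "\<And>v r. v \<in> int_vec n \<Longrightarrow> r < s' \<Longrightarrow> regular_fun N T f (\<lambda>t. Q' t v $ r)"
    and w: "w \<in> M p" "w \<notin> M' p"
  shows "\<exists>g\<in>poly_fun N. g p \<noteq> 0 \<and> (\<exists>a r. regular_vec_family n N T (\<lambda>t. f t * g t) a \<and> r < s' \<and>
    (\<forall>t\<in>basic_open T (\<lambda>t. f t * g t). a t \<in> M t \<and> Q' t (a t) $ r \<noteq> 0) \<and>
    regular_fun N T (\<lambda>t. f t * g t) (\<lambda>t. 1 / Q' t (a t) $ r))"
proof -
  have wi: "w \<in> int_vec n" using w(1) quotient_mapD(5)[OF Q[OF p]] by blast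
  obtain v where v: "\<And>i. i < s \<Longrightarrow> v i \<in> int_vec n" "\<And>i. i < s \<Longrightarrow> Q p (v i) = unit_vec s i"
    using quotient_map_dual_basis[OF Q[OF p]] by blast
  let ?A = "\<lambda>r i t. Q t (v i) $ r"
  let ?D = "\<lambda>t. det (mat s s (\<lambda>(r, i). ?A r i t))"
  have rD: "regular_fun N T f ?D" by (rule regular_fun_det[OF f]) (rule reg[OF v(1)])
  have "mat s s (\<lambda>(r, i). ?A r i p) = 1\<^sub>m s"
    by (rule eq_matI) (auto simp: v(2) unit_vec_def)
  then have "?D p \<noteq> 0" by simp
  then obtain g where g: "g \<in> poly_fun N" "g p \<noteq> 0"
    and D: "\<And>t. t \<in> basic_open T (\<lambda>t. f t * g t) \<Longrightarrow> ?D t \<noteq> 0"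
    and Dinv: "regular_fun N T (\<lambda>t. f t * g t) (\<lambda>t. 1 / ?D t)"
    using regular_fun_inverse[OF f rD p] by blast
  let ?f = "\<lambda>t. f t * g t"
  have f': "?f \<in> poly_fun N" by (rule poly_fun.mult[OF f g(1)])
  have p': "p \<in> basic_open T ?f" using p g(2) by (simp add: basic_open_def)
  have sub: "t \<in> basic_open T f" if "t \<in> basic_open T ?f" for t using that basic_open_mult[of T f g] by blast
  obtain c where c: "\<And>i. i < s \<Longrightarrow> regular_fun N T ?f (c i)"
    "\<And>t r. t \<in> basic_open T ?f \<Longrightarrow> r < s \<Longrightarrow> (\<Sum>i<s. c i t * ?A r i t) = Q t w $ r"
  proof (rule regular_fun_solve[where a = ?A and b = "\<lambda>r t. Q t w $ r", OF f' _ _ D Dinv])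
    show "regular_fun N T ?f (?A r i)" if "r < s" "i < s" for r i
      by (rule regular_fun_restrict[OF g(1) reg[OF v(1)[OF that(2)] that(1)]])
    show "regular_fun N T ?f (\<lambda>t. Q t w $ r)" if "r < s" for r
      by (rule regular_fun_restrict[OF g(1) reg[OF wi that]])
  qed (assumption, rule that)
  define a where "a t = w + fls_const (- 1) \<cdot>\<^sub>v lin_comb n v (\<lambda>i. c i t) s" for t
  have ra: "regular_vec_family n N T ?f a"
    unfolding a_def[abs_def]
    by (intro regular_vec_family_diff[OF f'] regular_vec_family_const[OF wi]
        regular_vec_family_lin_comb[OF f', of s n T "\<lambda>i t. v i"] regular_vec_family_const v(1) c(1))
  have aM: "a t \<in> M t" if t: "t \<in> basic_open T ?f" for t
  proof -
    note Qt = Q[OF sub[OF t]]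
    let ?l = "lin_comb n v (\<lambda>i. c i t) s"
    have li: "?l \<in> int_vec n" by (rule lin_comb_closed[OF int_vec_subspace v(1)])
    have "Q t (a t) = Q t w + (- 1) \<cdot>\<^sub>v Q t ?l"
      unfolding a_def quotient_mapD(3)[OF Qt wi int_vec_smult[OF int_ring_const li]] quotient_mapD(4)[OF Qt li] ..
    also have "Q t ?l = vec s (\<lambda>r. \<Sum>i<s. c i t * ?A r i t)"
      by (rule quotient_map_lin_comb[OF int_vec_subspace Qt v(1)])
    also have "Q t w + (- 1) \<cdot>\<^sub>v vec s (\<lambda>r. \<Sum>i<s. c i t * ?A r i t) = 0\<^sub>v s"
      using quotient_mapD(2)[OF Qt wi] c(2)[OF t] by (intro eq_vecI) auto
    finally show ?thesis using quotient_mapD(5)[OF Qt] regular_vec_familyD(1)[OF ra t] by blast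
  qed
  \<comment> \<open>At \<open>p\<close> the system has the identity matrix and a vanishing
    right-hand side, so the correction is zero and \<open>a p\<close> is \<open>w\<close>.\<close>
  have "c i p = 0" if i: "i < s" for i
  proof -
    have "(\<Sum>j<s. c j p * ?A i j p) = (\<Sum>j<s. if j = i then c j p else 0)"
      by (rule sum.cong) (use i in \<open>auto simp: v(2) unit_vec_def\<close>)
    moreover have "Q p w = 0\<^sub>v s" using w(1) quotient_mapD(5)[OF Q[OF p]] by blast
    ultimately show ?thesis using c(2)[OF p' i] i by simp
  qed
  then have "lin_comb n v (\<lambda>i. c i p) s = 0\<^sub>v n" by (rule lin_comb_coeff_0)
  then have "a p = w" unfolding a_def using int_vec_dim[OF wi] by (intro eq_vecI) auto
  then have "Q' p (a p) \<noteq> 0\<^sub>v s'" using w(2) wi quotient_mapD(5)[OF Q'[OF p]] by blast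
  moreover have "Q' p (a p) \<in> carrier_vec s'"
    by (rule quotient_mapD(2)[OF Q'[OF p] regular_vec_familyD(1)[OF ra p']])
  ultimately obtain r where r: "r < s'" "Q' p (a p) $ r \<noteq> 0"
    by (metis carrier_vecD eq_vecI index_zero_vec)
  have rE: "regular_fun N T ?f (\<lambda>t. Q' t (a t) $ r)"
    by (rule regular_quotient_apply[OF f' M'[OF sub] Q'[OF sub] regular_fun_restrict[OF g(1) reg'] ra r(1)])
  obtain g' where g': "g' \<in> poly_fun N" "g' p \<noteq> 0"
    "\<And>t. t \<in> basic_open T (\<lambda>t. ?f t * g' t) \<Longrightarrow> Q' t (a t) $ r \<noteq> 0"
    "regular_fun N T (\<lambda>t. ?f t * g' t) (\<lambda>t. 1 / Q' t (a t) $ r)"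
    using regular_fun_inverse[OF f' rE p' r(2)] by blast
  have eq: "(\<lambda>t. f t * (g t * g' t)) = (\<lambda>t. ?f t * g' t)" by (simp add: mult.assoc)
  show ?thesis
  proof (intro bexI[of _ "\<lambda>t. g t * g' t"] conjI exI[of _ a] exI[of _ r], unfold eq)
    show "regular_vec_family n N T (\<lambda>t. ?f t * g' t) a" by (rule regular_vec_family_restrict[OF g'(1) ra])
    show "\<forall>t\<in>basic_open T (\<lambda>t. ?f t * g' t). a t \<in> M t \<and> Q' t (a t) $ r \<noteq> 0"
      using g'(3) aM basic_open_mult[of T ?f g'] by blast
  qed (use g g' r in \<open>auto intro: poly_fun.mult\<close>)
qed

text \<open>Subtracting the constant parts of the first \<open>i\<close> coordinates moves
  \<open>h c\<close> into the i-th lattice. At \<open>i = n\<close> the remainder is divisible by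
  \<epsilon>, so the division can continue.\<close>

lemma flag_residual:
  assumes h: "h \<in> carrier (GL_K n)" and hw: "h = mat n n (\<lambda>(r, j). w j $ r)"
    and w: "\<And>j. j < n \<Longrightarrow> w j \<in> carrier_vec n" and c: "c \<in> int_vec n" and i: "i \<le> n"
  defines "res \<equiv> h *\<^sub>v c + fls_const (- 1) \<cdot>\<^sub>v lin_comb n w (\<lambda>j. fls_nth (c $ j) 0) i"
  shows "GL_inv n h *\<^sub>v res = vec n (\<lambda>j. if j < i then c $ j - fls_const (fls_nth (c $ j) 0) else c $ j)"
    "res \<in> lattice_flag n h i"
proof -
  note hc = GL_K_carrier[OF h] and cc = int_vec_carrier[OF c]
  let ?z = "vec n (\<lambda>j. if j < i then fls_const (fls_nth (c $ j) 0) else 0)"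
  let ?y = "vec n (\<lambda>j. if j < i then c $ j - fls_const (fls_nth (c $ j) 0) else c $ j)"
  have "lin_comb n w (\<lambda>j. fls_nth (c $ j) 0) i = h *\<^sub>v ?z"
  proof (rule eq_vecI)
    fix r assume "r < dim_vec (h *\<^sub>v ?z)"
    then have r: "r < n" using hc by simp
    have "(h *\<^sub>v ?z) $ r = (\<Sum>j<n. h $$ (r, j) * ?z $ j)"
      by (rule mult_mat_vec_index[OF hc _ r]) simp
    also have "\<dots> = (\<Sum>j<n. if j < i then fls_const (fls_nth (c $ j) 0) * w j $ r else 0)"
      using r by (intro sum.cong) (auto simp: hw)
    also have "\<dots> = (\<Sum>j<i. fls_const (fls_nth (c $ j) 0) * w j $ r)"
      using i by (intro sum.mono_neutral_cong_right) auto
    finally show "lin_comb n w (\<lambda>j. fls_nth (c $ j) 0) i $ r = (h *\<^sub>v ?z) $ r"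
      using r by (simp add: lin_comb_def)
  qed (use hc in \<open>simp add: lin_comb_def\<close>)
  then have "res = h *\<^sub>v c + h *\<^sub>v (fls_const (- 1) \<cdot>\<^sub>v ?z)"
    unfolding res_def using mult_mat_vec[OF hc, of ?z "fls_const (- 1)"] by simp
  also have "\<dots> = h *\<^sub>v (c + fls_const (- 1) \<cdot>\<^sub>v ?z)"
    by (rule mult_add_distrib_mat_vec[OF hc cc, symmetric]) simp
  also have "c + fls_const (- 1) \<cdot>\<^sub>v ?z = ?y" using cc by (intro eq_vecI) auto
  finally have res: "res = h *\<^sub>v ?y" .
  show "GL_inv n h *\<^sub>v res = ?y" unfolding res by (rule GL_K_inv_vec(2)[OF h]) simp
  have "?y \<in> int_vec n"
  proof (rule int_vecI)
    fix j assume "j < n"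
    then show "?y $ j \<in> int_ring"
      using int_ring_add[OF int_vec_index[OF c] int_ring_uminus[OF int_ring_const], of j] int_vec_index[OF c, of j]
      by (cases "j < i") simp_all
  qed simp
  then have "?y \<in> std_lattice n i" using i by (simp add: std_lattice_def)
  then show "res \<in> lattice_flag n h i" unfolding res using lattice_flag_iff[OF h, of ?y] by simp
qed

text \<open>Dividing by \<open>h\<close> with respect to the adapted basis determines one coefficient at a time, each by a
  quotient of values of the trivialization.\<close>

lemma inverse_coeff_regular:
  assumes f: "f \<in> poly_fun N"
    and h: "\<And>t. t \<in> basic_open T f \<Longrightarrow> h t \<in> carrier (GL_K n)"
    and hw: "\<And>t. t \<in> basic_open T f \<Longrightarrow> h t = mat n n (\<lambda>(r, j). w j t $ r)"
    and w: "\<And>j. j < n \<Longrightarrow> regular_vec_family n N T f (w j)"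
    and fl: "\<And>t j. t \<in> basic_open T f \<Longrightarrow> j \<le> n \<Longrightarrow> lattice_flag n (h t) j = M j t"
    and M: "\<And>t j. t \<in> basic_open T f \<Longrightarrow> j \<le> n \<Longrightarrow> Y_submodule m n (M j t)"
    and Q: "\<And>t j. t \<in> basic_open T f \<Longrightarrow> j \<le> n \<Longrightarrow> quotient_map (int_vec n) (k + j) (M j t) (Q j t)"
    and reg: "\<And>j v r. j \<le> n \<Longrightarrow> v \<in> int_vec n \<Longrightarrow> r < k + j \<Longrightarrow> regular_fun N T f (\<lambda>t. Q j t v $ r)"
    and r: "\<And>j. j < n \<Longrightarrow> r j < k + Suc j"
    and E: "\<And>t j. t \<in> basic_open T f \<Longrightarrow> j < n \<Longrightarrow> Q (Suc j) t (w j t) $ r j \<noteq> 0"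
    and Einv: "\<And>j. j < n \<Longrightarrow> regular_fun N T f (\<lambda>t. 1 / Q (Suc j) t (w j t) $ r j)"
    and a: "regular_vec_family n N T f a" "\<And>t. t \<in> basic_open T f \<Longrightarrow> a t \<in> M 0 t" and i: "i < n"
  shows "regular_fun N T f (\<lambda>t. fls_nth ((GL_inv n (h t) *\<^sub>v a t) $ i) (int l))"
  using a i
proof (induction l arbitrary: a i)
  \<comment> \<open>The constant terms of all coordinates are settled ahead of the two induction
    cases: they are the base case, and the inductive step subtracts them.\<close>
  fix a assume a: "regular_vec_family n N T f a" "\<And>t. t \<in> basic_open T f \<Longrightarrow> a t \<in> M 0 t"
  define c where "c t = GL_inv n (h t) *\<^sub>v a t" for t
  define res where "res i t = a t + fls_const (- 1) \<cdot>\<^sub>v lin_comb n (\<lambda>j. w j t) (\<lambda>j. fls_nth (c t $ j) 0) i" for i t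
  have ai: "a t \<in> int_vec n" if "t \<in> basic_open T f" for t by (rule regular_vec_familyD(1)[OF a(1) that])
  have wi: "w j t \<in> int_vec n" if "t \<in> basic_open T f" "j < n" for t j
    by (rule regular_vec_familyD(1)[OF w[OF that(2)] that(1)])
  have ci: "c t \<in> int_vec n" if t: "t \<in> basic_open T f" for t
    using a(2)[OF t] fl[OF t, of 0] by (auto simp: c_def lattice_flag_def std_lattice_0)
  have res': "GL_inv n (h t) *\<^sub>v res i t = vec n (\<lambda>j. if j < i then c t $ j - fls_const (fls_nth (c t $ j) 0) else c t $ j)"
    "res i t \<in> M i t" if t: "t \<in> basic_open T f" and i: "i \<le> n" for t i
  proof -
    have ha: "h t *\<^sub>v c t = a t" unfolding c_def by (rule GL_K_inv_vec(1)[OF h[OF t] int_vec_carrier[OF ai[OF t]]])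
    note fr = flag_residual[OF h[OF t] hw[OF t] int_vec_carrier[OF wi[OF t]] ci[OF t] i, unfolded ha]
    show "GL_inv n (h t) *\<^sub>v res i t = vec n (\<lambda>j. if j < i then c t $ j - fls_const (fls_nth (c t $ j) 0) else c t $ j)"
      unfolding res_def by (rule fr(1))
    show "res i t \<in> M i t" unfolding res_def fl[OF t i, symmetric] by (rule fr(2))
  qed
  have c0: "regular_fun N T f (\<lambda>t. fls_nth (c t $ i) 0)" if "i < n" for i
    using that
  proof (induction i rule: less_induct)
    case (less i)
    have rr: "regular_vec_family n N T f (res i)"
      unfolding res_def[abs_def]
      by (intro regular_vec_family_diff[OF f a(1)] regular_vec_family_lin_comb[OF f]) (use less w in auto)
    \<comment> \<open>Passing from \<open>res i\<close> to \<open>res (Suc i)\<close> subtracts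
      \<open>w i\<close> times this constant term and lands in \<open>M (Suc i)\<close>. Applying
      \<open>Q (Suc i)\<close> and reading coordinate \<open>r i\<close> leaves one linear equation,
      solvable because \<open>w i\<close> has a nonzero value there.\<close>
    have "fls_nth (c t $ i) 0 = Q (Suc i) t (res i t) $ r i * (1 / Q (Suc i) t (w i t) $ r i)"
      if t: "t \<in> basic_open T f" for t
    proof -
      let ?g = "fls_nth (c t $ i) 0"
      have Si: "Suc i \<le> n" using less.prems by simp
      note Qt = Q[OF t Si]
      have ri: "res i t \<in> int_vec n" by (rule regular_vec_familyD(1)[OF rr t])
      note wit = wi[OF t less.prems]
      have gw: "fls_const (- ?g) \<cdot>\<^sub>v w i t \<in> int_vec n" by (rule int_vec_smult[OF int_ring_const wit])
      have "lin_comb n (\<lambda>j. w j t) (\<lambda>j. fls_nth (c t $ j) 0) (Suc i) =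
          lin_comb n (\<lambda>j. w j t) (\<lambda>j. fls_nth (c t $ j) 0) i + fls_const ?g \<cdot>\<^sub>v w i t"
        by (rule lin_comb_Suc[of "\<lambda>j. w j t" i n, OF int_vec_carrier[OF wit]])
      then have rS: "res (Suc i) t = res i t + fls_const (- ?g) \<cdot>\<^sub>v w i t"
        unfolding res_def using int_vec_dim[OF ai[OF t]] int_vec_dim[OF wit]
        by (intro eq_vecI) (auto simp: lin_comb_def)
      have "Q (Suc i) t (res (Suc i) t) = 0\<^sub>v (k + Suc i)"
        using res'(2)[OF t Si] quotient_mapD(5)[OF Qt] by blast
      then have "Q (Suc i) t (res i t) + (- ?g) \<cdot>\<^sub>v Q (Suc i) t (w i t) = 0\<^sub>v (k + Suc i)"
        unfolding rS quotient_mapD(3)[OF Qt ri gw] quotient_mapD(4)[OF Qt wit] .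
      from arg_cong[OF this, of "\<lambda>v. v $ r i"]
      have "Q (Suc i) t (res i t) $ r i = ?g * Q (Suc i) t (w i t) $ r i"
        using r[OF less.prems] quotient_mapD(2)[OF Qt ri] quotient_mapD(2)[OF Qt wit] by auto
      then show ?thesis using E[OF t less.prems] by simp
    qed
    moreover have "regular_fun N T f (\<lambda>t. Q (Suc i) t (res i t) $ r i * (1 / Q (Suc i) t (w i t) $ r i))"
    proof (rule regular_fun_mult[OF _ Einv[OF less.prems]])
      have Si: "Suc i \<le> n" using less.prems by simp
      show "regular_fun N T f (\<lambda>t. Q (Suc i) t (res i t) $ r i)"
        by (rule regular_quotient_apply[OF f M[OF _ Si] Q[OF _ Si] reg[OF Si] rr r[OF less.prems]])
    qed
    ultimately show ?case by (subst regular_fun_cong) auto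
  qed
  {
    fix i assume "i < n"
    then show "regular_fun N T f (\<lambda>t. fls_nth ((GL_inv n (h t) *\<^sub>v a t) $ i) (int 0))"
      using c0 by (simp add: c_def)
  next
    fix l i
    assume IH: "\<And>a i. regular_vec_family n N T f a \<Longrightarrow> (\<And>t. t \<in> basic_open T f \<Longrightarrow> a t \<in> M 0 t) \<Longrightarrow> i < n \<Longrightarrow>
        regular_fun N T f (\<lambda>t. fls_nth ((GL_inv n (h t) *\<^sub>v a t) $ i) (int l))"
      and i: "i < n"
    \<comment> \<open>The remainder after all \<open>n\<close> subtractions, divided by \<epsilon>.
      It is a regular family in \<open>M 0\<close> again, and the coefficients of its coordinates
      are those of \<open>a\<close> shifted by one. Shifting explicitly makes the regularity
      visible.\<close>
    define b where "b t = vec n (\<lambda>j. fls_shift 1 (res n t $ j))" for t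
    have rr: "regular_vec_family n N T f (res n)"
      unfolding res_def[abs_def]
      by (intro regular_vec_family_diff[OF f a(1)] regular_vec_family_lin_comb[OF f]) (use c0 w in auto)
    have b: "b t \<in> M 0 t" "res n t = fls_X \<cdot>\<^sub>v b t" if t: "t \<in> basic_open T f" for t
    proof -
      obtain y where y: "y \<in> M 0 t" "res n t = fls_X \<cdot>\<^sub>v y"
        using res'(2)[OF t order_refl] lattice_flag_n[OF h[OF t]] fl[OF t] by auto
      have "y \<in> int_vec n" using y(1) M[OF t, of 0] by (auto simp: Y_submodule_def)
      then have "b t = y"
        unfolding b_def y(2) by (intro eq_vecI) (auto simp: int_vec_dim fls_X_times_conv_shift)
      then show "b t \<in> M 0 t" "res n t = fls_X \<cdot>\<^sub>v b t" using y by auto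
    qed
    have bi: "b t \<in> int_vec n" if t: "t \<in> basic_open T f" for t
      using b(1)[OF t] M[OF t, of 0] by (auto simp: Y_submodule_def)
    have rb: "regular_vec_family n N T f b"
      unfolding regular_vec_family_def
      using bi regular_vec_familyD(2)[OF rr] by (simp add: b_def)
    have "fls_nth ((GL_inv n (h t) *\<^sub>v a t) $ i) (int (Suc l)) =
        fls_nth ((GL_inv n (h t) *\<^sub>v b t) $ i) (int l)" if t: "t \<in> basic_open T f" for t
    proof -
      let ?x = "(GL_inv n (h t) *\<^sub>v b t) $ i"
      have "GL_inv n (h t) *\<^sub>v res n t = fls_X \<cdot>\<^sub>v (GL_inv n (h t) *\<^sub>v b t)"
        unfolding b(2)[OF t] by (rule mult_mat_vec[OF GL_K_inv(2)[OF h[OF t]] int_vec_carrier[OF bi[OF t]]])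
      then have "(GL_inv n (h t) *\<^sub>v res n t) $ i = fls_X * ?x"
        using i GL_K_inv(2)[OF h[OF t]] by simp
      moreover have "(GL_inv n (h t) *\<^sub>v res n t) $ i = c t $ i - fls_const (fls_nth (c t $ i) 0)"
        unfolding res'(1)[OF t order_refl] using i by simp
      ultimately have eq: "c t $ i - fls_const (fls_nth (c t $ i) 0) = fls_X * ?x" by simp
      have "fls_nth (c t $ i) (int (Suc l)) = fls_nth (c t $ i - fls_const (fls_nth (c t $ i) 0)) (int (Suc l))"
        by simp
      also have "\<dots> = fls_nth ?x (int l)" unfolding eq using fls_X_power_mult_nth[of 1 ?x] by simp
      finally show ?thesis by (simp add: c_def)
    qed
    then show "regular_fun N T f (\<lambda>t. fls_nth ((GL_inv n (h t) *\<^sub>v a t) $ i) (int (Suc l)))"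
      using IH[OF rb b(1) i] by (subst regular_fun_cong) auto
  }
qed

text \<open>The constant vectors \<epsilon>^k b_j lie in all the lattices, so \<open>reg\<close>
  applies to them. Dividing by \<epsilon>^k gives the columns of the inverse, whose poles are
  thereby bounded by \<open>k\<close> uniformly.\<close>

lemma inverse_family_regular:
  assumes f: "f \<in> poly_fun N"
    and h: "\<And>t. t \<in> basic_open T f \<Longrightarrow> h t \<in> carrier (GL_K n)"
    and fl: "\<And>t. t \<in> basic_open T f \<Longrightarrow> power_lattice n k \<subseteq> lattice_flag n (h t) 0"
    and reg: "\<And>a i l. regular_vec_family n N T f a \<Longrightarrow>
      (\<And>t. t \<in> basic_open T f \<Longrightarrow> a t \<in> lattice_flag n (h t) 0) \<Longrightarrow> i < n \<Longrightarrow>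
      regular_fun N T f (\<lambda>t. fls_nth ((GL_inv n (h t) *\<^sub>v a t) $ i) (int l))"
  shows "regular_mat_family n N T f (\<lambda>t. GL_inv n (h t))"
  unfolding regular_mat_family_def
proof (intro allI impI conjI)
  fix i j assume ij: "i < n" "j < n"
  let ?v = "fls_X ^ k \<cdot>\<^sub>v unit_vec n j"
  have ui: "unit_vec n j \<in> int_vec n" by (rule std_lattice_int[OF unit_vec_std_lattice[OF ij(2)]])
  have vp: "?v \<in> power_lattice n k" using power_lattice_iff ui by blast
  then have vi: "?v \<in> int_vec n" by (simp add: power_lattice_def)
  have vfl: "?v \<in> lattice_flag n (h t) 0" if "t \<in> basic_open T f" for t using fl[OF that] vp by blast
  have eq: "fls_nth ((GL_inv n (h t)) $$ (i, j)) l = fls_nth ((GL_inv n (h t) *\<^sub>v ?v) $ i) (l + int k)"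
    if t: "t \<in> basic_open T f" for t l
  proof -
    note ic = GL_K_inv(2)[OF h[OF t]]
    have "(GL_inv n (h t) *\<^sub>v ?v) $ i = fls_X ^ k * (GL_inv n (h t)) $$ (i, j)"
      using mult_mat_vec[OF ic unit_vec_carrier, of "fls_X ^ k" j] mult_mat_unit_vec[OF ic ij] ic ij by simp
    then show ?thesis by (simp add: fls_X_power_mult_nth)
  qed
  have neg: "fls_nth ((GL_inv n (h t)) $$ (i, j)) l = 0" if t: "t \<in> basic_open T f" and l: "l < - int k" for t l
  proof -
    have "GL_inv n (h t) *\<^sub>v ?v \<in> int_vec n" using vfl[OF t] by (simp add: lattice_flag_def std_lattice_0)
    from int_vec_index[OF this ij(1)] show ?thesis unfolding eq[OF t] int_ring_iff using l by simp
  qed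
  show "regular_fun N T f (\<lambda>t. fls_nth ((GL_inv n (h t)) $$ (i, j)) l)" for l
  proof (cases "l < - int k")
    case True
    have "regular_fun N T f (\<lambda>t. 0)" by (rule regular_fun_const)
    then show ?thesis by (subst regular_fun_cong) (use neg True in auto)
  next
    case False
    then obtain l' where l': "l + int k = int l'" using nonneg_int_cases[of "l + int k"] by auto
    have "regular_fun N T f (\<lambda>t. fls_nth ((GL_inv n (h t) *\<^sub>v ?v) $ i) (int l'))"
      by (rule reg[OF regular_vec_family_const[OF vi] vfl ij(1)])
    then show ?thesis by (subst regular_fun_cong) (use eq l' in auto)
  qed
  show "\<exists>d. \<forall>t\<in>basic_open T f. \<forall>l<d. fls_nth ((GL_inv n (h t)) $$ (i, j)) l = 0"
    using neg by blast
qed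

lemma PHilb_morphism_imp_Fl_morphism:
  assumes m: "m > 0" and n: "n > 0" and u: "u \<in> T \<rightarrow> Spr m n"
    and mor: "PHilb_morphism m n N T (\<lambda>t. Spr_to_PHilb m n (u t))"
  shows "Fl_morphism n N T u"
  unfolding Fl_morphism_def locally_on_def
proof
  fix p assume pT: "p \<in> T"
  obtain f k where f: "f \<in> poly_fun N" "f p \<noteq> 0"
    and k: "\<And>t. t \<in> basic_open T f \<Longrightarrow> fst (Spr_to_PHilb m n (u t)) = k"
    and triv: "\<forall>s\<in>{k..k + n}. \<exists>q. trivializes_quotient m n s N T f (\<lambda>t. snd (Spr_to_PHilb m n (u t)) s) q"
    using mor pT unfolding PHilb_morphism_def locally_on_def by blast
  obtain q where q: "\<And>s. s \<in> {k..k + n} \<Longrightarrow>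
      trivializes_quotient m n s N T f (\<lambda>t. snd (Spr_to_PHilb m n (u t)) s) (q s)"
    using bchoice[OF triv] by blast
  have p: "p \<in> basic_open T f" using pT f by (simp add: basic_open_def)
  define J where "J t = snd (Spr_to_PHilb m n (u t))" for t
  have uS: "u t \<in> Spr m n" if "t \<in> basic_open T f" for t using u that by (auto simp: basic_open_def)
  have J: "J t \<in> PHilb m n k" "Spr_to_PHilb m n (u t) = (k, J t)" if t: "t \<in> basic_open T f" for t
  proof -
    show eq: "Spr_to_PHilb m n (u t) = (k, J t)" using k[OF t] by (simp add: J_def prod_eq_iff)
    have "Spr_to_PHilb m n (u t) \<in> (SIGMA k:UNIV. PHilb m n k)"
      using bij_betw_apply[OF bij_Spr_to_PHilb[OF m n] uS[OF t]] .
    then show "J t \<in> PHilb m n k" unfolding eq by simp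
  qed
  define M where "M j t = ideal_lattice m n (J t (k + j))" for j t
  define Q where "Q j t v = q (k + j) t (vec_to_OC m n v)" for j t v
  have L1: "Y_submodule m n (M j t)" if t: "t \<in> basic_open T f" and j: "j \<le> n" for t j
    unfolding M_def by (rule PHilb_lattices(1)[OF m n J(1)[OF t] j])
  have L2: "vec_to_OC m n ` M j t = J t (k + j)" if t: "t \<in> basic_open T f" and j: "j \<le> n" for t j
    unfolding M_def by (rule PHilb_lattices(2)[OF m n J(1)[OF t] j])
  have L3: "M (Suc j) t \<subseteq> M j t" if t: "t \<in> basic_open T f" and j: "j < n" for t j
    unfolding M_def by (rule PHilb_lattices(4)[OF m n J(1)[OF t] j])
  have L4: "M n t = (\<lambda>v. fls_X \<cdot>\<^sub>v v) ` M 0 t" if t: "t \<in> basic_open T f" for t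
    unfolding M_def by (rule PHilb_lattices(5)[OF m n J(1)[OF t]])
  have L5: "\<exists>w. w \<in> M j t \<and> w \<notin> M (Suc j) t" if t: "t \<in> basic_open T f" and j: "j < n" for t j
    unfolding M_def by (rule PHilb_lattices(6)[OF m n J(1)[OF t] j])
  have Q: "quotient_map (int_vec n) (k + j) (M j t) (Q j t)" if t: "t \<in> basic_open T f" and j: "j \<le> n" for t j
  proof -
    have "OC_quotient_map m n (k + j) (vec_to_OC m n ` M j t) (q (k + j) t)"
      using q[of "k + j"] j t unfolding trivializes_quotient_iff L2[OF t j] J_def by auto
    moreover have "M j t \<subseteq> int_vec n" by (auto simp: M_def ideal_lattice_def)
    ultimately show ?thesis unfolding Q_def[abs_def] using OC_quotient_map_iff[OF m] by blast
  qed
  have reg: "regular_fun N T f (\<lambda>t. Q j t v $ r)" if "j \<le> n" "v \<in> int_vec n" "r < k + j" for j v r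
    using q[of "k + j"] that vec_to_OC_closed unfolding trivializes_quotient_iff Q_def by auto
  let ?P = "\<lambda>j f. \<exists>a r. regular_vec_family n N T f a \<and> r < k + Suc j \<and>
    (\<forall>t\<in>basic_open T f. a t \<in> M j t \<and> Q (Suc j) t (a t) $ r \<noteq> 0) \<and>
    regular_fun N T f (\<lambda>t. 1 / Q (Suc j) t (a t) $ r)"
  have "\<exists>g\<in>poly_fun N. g p \<noteq> 0 \<and> (\<forall>j<n. ?P j (\<lambda>t. f t * g t))"
  proof (rule locally_finite_conj[OF f])
    show "?P j (\<lambda>t. f t * g t)" if P: "?P j f" and g: "g \<in> poly_fun N" for j f g
    proof -
      obtain a r where ar: "regular_vec_family n N T f a" "r < k + Suc j"
        "\<forall>t\<in>basic_open T f. a t \<in> M j t \<and> Q (Suc j) t (a t) $ r \<noteq> 0"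
        "regular_fun N T f (\<lambda>t. 1 / Q (Suc j) t (a t) $ r)" using P by blast
      show ?thesis
        using regular_vec_family_restrict[OF g ar(1)] ar(2) regular_fun_restrict[OF g ar(4)] ar(3)
          basic_open_mult[of T f g] by (intro exI[of _ a] exI[of _ r]) blast
    qed
    show "\<exists>g\<in>poly_fun N. g p \<noteq> 0 \<and> ?P j (\<lambda>t. f t * g t)" if j: "j < n" for j
    proof -
      have j': "j \<le> n" "Suc j \<le> n" using j by auto
      obtain w where w: "w \<in> M j p" "w \<notin> M (Suc j) p" using L5[OF p j] by blast
      show ?thesis
        by (rule local_section[where M = "M j" and Q = "Q j" and M' = "M (Suc j)" and Q' = "Q (Suc j)",
              OF f(1) p Q[OF _ j'(1)] reg[OF j'(1)] L1[OF _ j'(2)] Q[OF _ j'(2)] reg[OF j'(2)] w])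
    qed
  qed
  then obtain g where g: "g \<in> poly_fun N" "g p \<noteq> 0" "\<forall>j<n. ?P j (\<lambda>t. f t * g t)" by blast
  let ?F = "\<lambda>t. f t * g t"
  have F: "?F \<in> poly_fun N" "?F p \<noteq> 0" using f g by (auto intro: poly_fun.mult)
  have sub: "t \<in> basic_open T f" if "t \<in> basic_open T ?F" for t using that basic_open_mult[of T f g] by blast
  define S where "S j a r \<longleftrightarrow> regular_vec_family n N T ?F a \<and> r < k + Suc j \<and>
    (\<forall>t\<in>basic_open T ?F. a t \<in> M j t \<and> Q (Suc j) t (a t) $ r \<noteq> 0) \<and>
    regular_fun N T ?F (\<lambda>t. 1 / Q (Suc j) t (a t) $ r)" for j a r
  have "\<forall>j<n. \<exists>a r. S j a r" using g(3) unfolding S_def .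
  then obtain a r where S: "\<And>j. j < n \<Longrightarrow> S j (a j) (r j)" by metis
  have ar: "\<And>j. j < n \<Longrightarrow> regular_vec_family n N T ?F (a j)" "\<And>j. j < n \<Longrightarrow> r j < k + Suc j"
    "\<And>j t. j < n \<Longrightarrow> t \<in> basic_open T ?F \<Longrightarrow> a j t \<in> M j t"
    "\<And>j t. j < n \<Longrightarrow> t \<in> basic_open T ?F \<Longrightarrow> Q (Suc j) t (a j t) $ r j \<noteq> 0"
    "\<And>j. j < n \<Longrightarrow> regular_fun N T ?F (\<lambda>t. 1 / Q (Suc j) t (a j t) $ r j)"
    using S unfolding S_def by simp_all
  define h where "h t = mat n n (\<lambda>(r, j). a j t $ r)" for t
  have hfl: "admissible m n (h t)" "\<And>j. j \<le> n \<Longrightarrow> lattice_flag n (h t) j = M j t"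
    if t: "t \<in> basic_open T ?F" for t
  proof -
    \<comment> \<open>A single nonzero coordinate of \<open>Q (Suc j)\<close> keeps the section
      outside its kernel, so the sections form an adapted basis at every parameter and not only at
      \<open>p\<close>.\<close>
    have nM: "a j t \<notin> M (Suc j) t" if j: "j < n" for j
    proof
      assume "a j t \<in> M (Suc j) t"
      moreover have "Suc j \<le> n" using j by simp
      ultimately have "Q (Suc j) t (a j t) = 0\<^sub>v (k + Suc j)"
        using quotient_mapD(5)[OF Q[OF sub[OF t]]] by blast
      then show False using ar(4)[OF j t] ar(2)[OF j] by simp
    qed
    note ab = adapted_basis[where M = "\<lambda>j. M j t" and w = "\<lambda>j. a j t",
        OF n L1[OF sub[OF t]] Q[OF sub[OF t]] L3[OF sub[OF t]] L4[OF sub[OF t]] ar(3)[OF _ t] nM]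
    show "admissible m n (h t)" "\<And>j. j \<le> n \<Longrightarrow> lattice_flag n (h t) j = M j t"
      unfolding h_def using ab by blast+
  qed
  have hG: "h t \<in> carrier (GL_K n)" if "t \<in> basic_open T ?F" for t
    using hfl(1)[OF that] by (simp add: admissible_def)
  have regh: "regular_mat_family n N T ?F h"
    unfolding regular_mat_family_def
  proof (intro allI impI conjI)
    fix i j assume ij: "i < n" "j < n"
    show "regular_fun N T ?F (\<lambda>t. fls_nth (h t $$ (i, j)) l)" for l
      using regular_vec_familyD(2)[OF ar(1)[OF ij(2)] ij(1)] ij by (simp add: h_def)
    have "fls_nth (h t $$ (i, j)) l = 0" if "t \<in> basic_open T ?F" "l < 0" for t l
      using int_vec_index[OF regular_vec_familyD(1)[OF ar(1)[OF ij(2)] that(1)] ij(1)] that(2) ij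
      by (simp add: h_def int_ring_iff)
    then show "\<exists>d. \<forall>t\<in>basic_open T ?F. \<forall>l<d. fls_nth (h t $$ (i, j)) l = 0" by blast
  qed
  have regi: "regular_mat_family n N T ?F (\<lambda>t. GL_inv n (h t))"
  proof (rule inverse_family_regular[where h = h and k = k, OF F(1) hG])
    show "power_lattice n k \<subseteq> lattice_flag n (h t) 0" if t: "t \<in> basic_open T ?F" for t
      unfolding hfl(2)[OF t le0]
      using power_lattice_subset[OF L1[OF sub[OF t] le0] Q[OF sub[OF t] le0]] by simp
    fix b i l assume b: "regular_vec_family n N T ?F b"
      "\<And>t. t \<in> basic_open T ?F \<Longrightarrow> b t \<in> lattice_flag n (h t) 0" and i: "i < n"
    show "regular_fun N T ?F (\<lambda>t. fls_nth ((GL_inv n (h t) *\<^sub>v b t) $ i) (int l))"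
    proof (rule inverse_coeff_regular[where h = h and w = a and M = M and Q = Q and r = r and k = k and m = m, OF F(1) hG])
      show "b t \<in> M 0 t" if "t \<in> basic_open T ?F" for t using b(2)[OF that] hfl(2)[OF that, of 0] by simp
      show "regular_fun N T ?F (\<lambda>t. Q j t v $ r)" if "j \<le> n" "v \<in> int_vec n" "r < k + j" for j v r
        by (rule regular_fun_restrict[OF g(1) reg[OF that]])
    qed (use ar hfl L1 Q sub b(1) i in \<open>auto simp: h_def\<close>)
  qed
  \<comment> \<open>The duality is involutive, so dualizing the adapted bases leads back to
    representatives of points of the Springer fibre.\<close>
  define \<gamma> where "\<gamma> t = dual_mat n (h t)" for t
  have gam: "\<gamma> t \<in> carrier (GL_K n)" "dual_mat n (\<gamma> t) = h t" if "t \<in> basic_open T ?F" for t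
    unfolding \<gamma>_def using dual_mat[OF hG[OF that]] by blast+
  have "regular_GL_family n N T ?F \<gamma>"
    unfolding regular_GL_family_def
  proof (intro conjI ballI)
    show "\<gamma> t \<in> carrier (GL_K n)" if "t \<in> basic_open T ?F" for t by (rule gam(1)[OF that])
    show "regular_mat_family n N T ?F \<gamma>"
      unfolding \<gamma>_def[abs_def] dual_mat_def by (rule regular_mat_family_anti_transpose[OF regi])
    have "anti_transpose n (h t) = GL_inv n (\<gamma> t)" if "t \<in> basic_open T ?F" for t
      unfolding \<gamma>_def dual_mat(2)[OF hG[OF that]] ..
    then show "regular_mat_family n N T ?F (\<lambda>t. GL_inv n (\<gamma> t))"
      by (rule regular_mat_family_cong[OF _ regular_mat_family_anti_transpose[OF regh]])
  qed
  \<comment> \<open>Representatives need not be compared: both points are mapped to the same flag of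
    ideals, and the map on points is injective.\<close>
  moreover have "u t = Icoset n (\<gamma> t)" if t: "t \<in> basic_open T ?F" for t
  proof (rule inj_onD[OF bij_betw_imp_inj_on[OF bij_Spr_to_PHilb[OF m n]]])
    show "u t \<in> Spr m n" by (rule uS[OF sub[OF t]])
    show "Icoset n (\<gamma> t) \<in> Spr m n"
      using Spr_iff_admissible[OF n gam(1)[OF t]] hfl(1)[OF t] gam(2)[OF t] by simp
    have "flag_point m n (h t) = (k, J t)"
      by (rule flag_point_eqI[OF m n J(1)[OF sub[OF t]]]) (use hfl(2)[OF t] in \<open>simp add: M_def\<close>)
    then show "Spr_to_PHilb m n (u t) = Spr_to_PHilb m n (Icoset n (\<gamma> t))"
      using Spr_to_PHilb_eq[OF gam(1)[OF t], of m] gam(2)[OF t] J(2)[OF sub[OF t]] by simp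
  qed
  ultimately show "\<exists>f\<in>poly_fun N. f p \<noteq> 0 \<and> (\<exists>\<gamma>. regular_GL_family n N T f \<gamma> \<and>
      (\<forall>t\<in>basic_open T f. u t = Icoset n (\<gamma> t)))"
    using F by (intro bexI[of _ ?F] conjI exI[of _ \<gamma>] ballI)
qed

theorem proposition7p19:
  fixes m n :: nat
  assumes "m > 0" and "n > 0" and "coprime m n"
  shows "isomorphic_via_morphisms
           (Spr m n) (Fl_morphism n)
           (SIGMA k:UNIV. PHilb m n k) (PHilb_morphism m n)"
  unfolding isomorphic_via_morphisms_def
  using bij_Spr_to_PHilb[OF assms(1,2)] Fl_morphism_imp_PHilb_morphism[OF assms(1,2)]
    PHilb_morphism_imp_Fl_morphism[OF assms(1,2)]
  by blast

end
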